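(* Let $q\in(-1,1)$, let $\nu$ be a compactly supported probability measure on $\mathbb{R}$, and let $X$ be the associated $q$-Lévy process with associated processes $Y_k$ and vacuum state $\varphi$, as in the context. For every $n\ge1$, $\pi\in\mathcal{P}(n)$ and $t>0$, the partition-dependent stochastic measure $\mathrm{St}_\pi(t)=\lim_{\delta(\mathcal{I})\to0}\mathrm{St}_\pi(t;\mathcal{I})$ is well-defined as a limit in $L^2(\mathcal{A}^{\mathrm{alg}}_X,\varphi)$, and equals $$\mathrm{St}_\pi(t)=\sum_{S\subset\pi}q^{\mathrm{rc}(S,\pi)}R_{\pi\setminus S}(t)\,\psi\big(Y_{|B|}(t):B\in S\big).$$
   Context: **Process.** Let $r_1=0$ and $r_{k+2}=\int_{\mathbb{R}}x^k\,d\nu(x)$, $k\ge0$ (so $r_2=1$). Let $\mathcal{H}=L^2(\mathbb{R}_+,dt)\otimes L^2(\mathbb{R},\nu)$ (complexification of the real $L^2$ space). $\mathcal{F}_q(\mathcal{H})$ is the completion of $\bigoplus_{n\ge0}\mathcal{H}^{\otimes n}$ (algebraic sum, $\mathcal{H}^{\otimes0}=\mathbb{C}\Omega$) in the inner product $\langle\vec\xi,\vec\eta\rangle_q=\langle\vec\xi,P\vec\eta\rangle_0$, where $\langle\cdot,\cdot\rangle_0$ is the usual inner product and $P(\xi_1\otimes\dots\otimes\xi_n)=\sum_{\sigma\in\mathrm{Sym}(n)}q^{i(\sigma)}\xi_{\sigma(1)}\otimes\dots\otimes\xi_{\sigma(n)}$, $i(\sigma)$ = number of inversions. On it, $a^*(\zeta)$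 is left tensoring by $\zeta$; $a(\zeta)\Omega=0$, $a(\zeta)(\eta_1\otimes\dots\otimes\eta_n)=\sum_kq^{k-1}\langle\zeta,\eta_k\rangle\eta_1\otimes\dots\check\eta_k\dots\otimes\eta_n$; $p(T)\Omega=0$, $p(T)(\eta_1\otimes\dots\otimes\eta_n)=\sum_kq^{k-1}(T\eta_k)\otimes\eta_1\otimes\dots\check\eta_k\dots\otimes\eta_n$ (check = omit). For a bounded interval $I=[a,b)\subset\mathbb{R}_+$ and $k\ge1$, $Y_k(I)=a(\mathbf{1}_I\otimes x^{k-1})+a^*(\mathbf{1}_I\otimes x^{k-1})+p(M_{\mathbf{1}_I\otimes x^k})$, with $M_g$ multiplication by $g$; these are bounded operators. $X(I)=Y_1(I)$, $X(t)=X([0,t))$, $Y_k(t)=Y_k([0,t))$. $\mathcal{A}^{\mathrm{alg}}_X$ is the complex unital algebra generated by all $X(t)$, $\varphi[A]=\langle\Omega,A\Omega\rangle$, $\langle A,B\rangle_\varphi=\varphi[A^*B]=\langle A\Omega,B\Omega\rangle_q$, and $L^2(\mathcal{A}^{\mathrm{alg}}_X,\varphi)$ is the completion of $\mathcal{A}^{\mathrm{alg}}_X$. The same inner product is used on the larger algebra generated by all $Y_k(t)$, and the resulting $L^2$ spaces are identified with subspaces of $\mathcal{F}_q(\mathcal{H})$ through $A\mapsto A\Omega$ (so the $Y_k(t)$ may be regarded as elements of $L^2(\mathcal{A}^{\mathrm{alg}}_X,\varphi)$). **Multiple integrals.** For processes $Z_1,\dots,Z_k$ among the $Y_j$ and disjoint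 intervals $I_1,\dots,I_k$, $\int\mathbf{1}_{I_1\times\dots\times I_k}dZ_1\cdots dZ_k=Z_1(I_1)\cdots Z_k(I_k)$, extended linearly and by $L^2$-continuity to $F\in L^2(\mathbb{R}_+^k)$, with values in $L^2(\varphi)$. The full stochastic measure $\psi(Z_1(t),\dots,Z_k(t))$ is the integral of $F=\mathbf{1}_{[0,t)^k}$. In $\psi(Y_{|B|}(t):B\in S)$ the classes $B\in S$ are ordered by increasing $\min(B)$; for $S=\emptyset$ it equals $1$. **Stochastic measures.** For a subdivision $\mathcal{I}=\{I_i\}_{i=1}^N$ of $[0,t)$ into intervals, $\delta(\mathcal{I})=\max_i|I_i|$, and $\mathrm{St}_\pi(t;\mathcal{I})=\sum_{\vec u}X(I_{u(1)})\cdots X(I_{u(n)})$, the sum over $\vec u\in\{1,\dots,N\}^n$ with $u(i)=u(j)$ if and only if $i,j$ lie in the same class of $\pi$. For a collection $\pi\setminus S$ of classes, $R_{\pi\setminus S}(t)=t^{|\pi\setminus S|}\prod_{B\in\pi\setminus S}r_{|B|}$. **Restricted crossings.** $\mathcal{P}(n)$ is the set of set partitions of $\{1,\dots,n\}$. For $S\subset\pi\in\mathcal{P}(n)$, $\mathrm{rc}(S,\pi)=\sum_{k=1}^n\mathrm{rc}(k,S,\pi)$, where for $k\in B\in\pi$: $\mathrm{rc}(k,S,\pi)=0$ if $k=\max(B)$; otherwise, with $j=\min\{i\in B:i>k\}$, it is the number of classes $C\in\pi$ with $C\cap\{k+1,\dots,j-1\}\neq\emptyset$ and ($C\in S$ or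 $C\cap\{1,\dots,k\}\ne\emptyset$). *)

theory Defs
  imports
    "HOL-Probability.Probability"
    "HOL-Combinatorics.Combinatorics"
    "HOL-Library.Disjoint_Sets"
    "HOL-Library.Poly_Mapping"
    "HOL-Library.Function_Algebras"
begin

text \<open>Addition, zero and finite sums of functions (vectors of the completed Fock space, operators) are
  pointwise throughout.\<close>


section \<open>The one-particle space\<close>

definition rplus :: "real measure"
  where "rplus = restrict_space lborel {0..}"

definition L2 :: "'a measure \<Rightarrow> ('a \<Rightarrow> complex) set"
  where "L2 M = {f \<in> borel_measurable M. integrable M (\<lambda>x. (cmod (f x))\<^sup>2)}"

definition L2_inner :: "'a measure \<Rightarrow> ('a \<Rightarrow> complex) \<Rightarrow> ('a \<Rightarrow> complex) \<Rightarrow> complex"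
  where "L2_inner M f g = (\<integral>x. cnj (f x) * g x \<partial>M)"

definition L2_dist :: "'a measure \<Rightarrow> ('a \<Rightarrow> complex) \<Rightarrow> ('a \<Rightarrow> complex) \<Rightarrow> real"
  where "L2_dist M f g = sqrt (\<integral>x. (cmod (f x - g x))\<^sup>2 \<partial>M)"

text \<open>The Hilbert tensor product of \<open>L2\<close> of the half-line and \<open>L2 \<nu>\<close> is \<open>L2\<close> of the product measure;
  the elementary tensor of \<open>f\<close> and \<open>g\<close> is the function \<open>(s, x) \<mapsto> f s * g x\<close>. Functions are not
  identified almost everywhere here; this identification is made by the inner product below.\<close>

type_synonym hvec = "real \<times> real \<Rightarrow> complex"

definition hmeas :: "real measure \<Rightarrow> (real \<times> real) measure"
  where "hmeas \<nu> = rplus \<Otimes>\<^sub>M \<nu>"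

definition ind_mono :: "real set \<Rightarrow> nat \<Rightarrow> hvec"
  where "ind_mono I k = (\<lambda>(s, x). indicator I s * complex_of_real (x ^ k))"


section \<open>The algebraic q-Fock space\<close>

text \<open>The word \<open>[\<eta>\<^sub>1, \<dots>, \<eta>\<^sub>n]\<close> stands for the simple tensor \<open>\<eta>\<^sub>1 \<otimes> \<dots> \<otimes> \<eta>\<^sub>n\<close> and the empty word for the
  vacuum. A vector is a formal finite linear combination of words. The relations of the tensor
  product (multilinearity, almost everywhere equality) are not imposed on the nose: they generate
  precisely the null vectors of the q-inner product, since \<open>P\<close> is strictly positive for
  \<open>-1 < q < 1\<close>, and null vectors become zero in the completion.\<close>

type_synonym tens = "hvec list \<Rightarrow>\<^sub>0 complex"

definition scale :: "complex \<Rightarrow> ('a \<Rightarrow>\<^sub>0 complex) \<Rightarrow> 'a \<Rightarrow>\<^sub>0 complex"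
  where "scale c f = Poly_Mapping.map (\<lambda>x. c * x) f"

definition lin_ext :: "('a \<Rightarrow> 'b \<Rightarrow>\<^sub>0 complex) \<Rightarrow> ('a \<Rightarrow>\<^sub>0 complex) \<Rightarrow> 'b \<Rightarrow>\<^sub>0 complex"
  where "lin_ext \<Phi> f = (\<Sum>w \<in> Poly_Mapping.keys f. scale (Poly_Mapping.lookup f w) (\<Phi> w))"

definition tens_carrier :: "real measure \<Rightarrow> tens set"
  where "tens_carrier \<nu> = {f. \<forall>w \<in> Poly_Mapping.keys f. set w \<subseteq> L2 (hmeas \<nu>)}"

definition inversion_number :: "nat \<Rightarrow> (nat \<Rightarrow> nat) \<Rightarrow> nat"
  where "inversion_number n \<sigma> = card {(i, j). i < j \<and> j < n \<and> \<sigma> j < \<sigma> i}"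

definition q_sym :: "real \<Rightarrow> tens \<Rightarrow> tens"
  where "q_sym q = lin_ext (\<lambda>w. \<Sum>\<sigma> | \<sigma> permutes {..<length w}.
    Poly_Mapping.single (map (\<lambda>i. w ! \<sigma> i) [0..<length w])
      (complex_of_real (q ^ inversion_number (length w) \<sigma>)))"

definition word_inner :: "real measure \<Rightarrow> hvec list \<Rightarrow> hvec list \<Rightarrow> complex"
  where "word_inner \<nu> v w = (if length v = length w
    then \<Prod>i<length v. L2_inner (hmeas \<nu>) (v ! i) (w ! i) else 0)"

definition tens_inner0 :: "real measure \<Rightarrow> tens \<Rightarrow> tens \<Rightarrow> complex"
  where "tens_inner0 \<nu> f g = (\<Sum>v \<in> Poly_Mapping.keys f. \<Sum>w \<in> Poly_Mapping.keys g.
    cnj (Poly_Mapping.lookup f v) * Poly_Mapping.lookup g w * word_inner \<nu> v w)"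

definition tens_inner :: "real \<Rightarrow> real measure \<Rightarrow> tens \<Rightarrow> tens \<Rightarrow> complex"
  where "tens_inner q \<nu> f g = tens_inner0 \<nu> f (q_sym q g)"

definition tens_norm :: "real \<Rightarrow> real measure \<Rightarrow> tens \<Rightarrow> real"
  where "tens_norm q \<nu> f = sqrt (Re (tens_inner q \<nu> f f))"

text \<open>Positions in a word are counted from 0, hence the factors \<open>q ^ k\<close>.\<close>

definition tens_create :: "hvec \<Rightarrow> tens \<Rightarrow> tens"
  where "tens_create \<zeta> = lin_ext (\<lambda>w. Poly_Mapping.single (\<zeta> # w) 1)"

definition tens_annihilate :: "real \<Rightarrow> real measure \<Rightarrow> hvec \<Rightarrow> tens \<Rightarrow> tens"
  where "tens_annihilate q \<nu> \<zeta> = lin_ext (\<lambda>w. \<Sum>k<length w.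
    Poly_Mapping.single (take k w @ drop (Suc k) w)
      (complex_of_real (q ^ k) * L2_inner (hmeas \<nu>) \<zeta> (w ! k)))"

definition tens_preserve :: "real \<Rightarrow> (hvec \<Rightarrow> hvec) \<Rightarrow> tens \<Rightarrow> tens"
  where "tens_preserve q T = lin_ext (\<lambda>w. \<Sum>k<length w.
    Poly_Mapping.single (T (w ! k) # take k w @ drop (Suc k) w) (complex_of_real (q ^ k)))"

definition mult_op :: "hvec \<Rightarrow> hvec \<Rightarrow> hvec"
  where "mult_op g f = (\<lambda>z. g z * f z)"

definition tens_Y :: "real \<Rightarrow> real measure \<Rightarrow> nat \<Rightarrow> real set \<Rightarrow> tens \<Rightarrow> tens"
  where "tens_Y q \<nu> k I = tens_annihilate q \<nu> (ind_mono I (k - 1))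
    + tens_create (ind_mono I (k - 1)) + tens_preserve q (mult_op (ind_mono I k))"


section \<open>The q-Fock space\<close>

text \<open>The completion: elements are represented by Cauchy sequences of algebraic vectors, and two
  representatives are equal as elements of the completion iff they satisfy \<open>fock_eq\<close>.\<close>

type_synonym fvec = "nat \<Rightarrow> tens"

definition fock :: "real \<Rightarrow> real measure \<Rightarrow> fvec set"
  where "fock q \<nu> = {s. (\<forall>m. s m \<in> tens_carrier \<nu>) \<and>
    (\<forall>e>0. \<exists>M. \<forall>i\<ge>M. \<forall>j\<ge>M. tens_norm q \<nu> (s i - s j) < e)}"

definition fock_inner :: "real \<Rightarrow> real measure \<Rightarrow> fvec \<Rightarrow> fvec \<Rightarrow> complex"
  where "fock_inner q \<nu> u v = lim (\<lambda>m. tens_inner q \<nu> (u m) (v m))"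

definition fock_norm :: "real \<Rightarrow> real measure \<Rightarrow> fvec \<Rightarrow> real"
  where "fock_norm q \<nu> u = sqrt (Re (fock_inner q \<nu> u u))"

definition fock_dist :: "real \<Rightarrow> real measure \<Rightarrow> fvec \<Rightarrow> fvec \<Rightarrow> real"
  where "fock_dist q \<nu> u v = fock_norm q \<nu> (\<lambda>m. u m - v m)"

definition fock_eq :: "real \<Rightarrow> real measure \<Rightarrow> fvec \<Rightarrow> fvec \<Rightarrow> bool"
  where "fock_eq q \<nu> u v \<longleftrightarrow> u \<in> fock q \<nu> \<and> v \<in> fock q \<nu> \<and> fock_dist q \<nu> u v = 0"

definition fock_scale :: "complex \<Rightarrow> fvec \<Rightarrow> fvec"
  where "fock_scale c u = (\<lambda>m. scale c (u m))"

definition vacuum :: fvec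
  where "vacuum = (\<lambda>_. Poly_Mapping.single [] 1)"


section \<open>The processes and the algebra they generate\<close>

text \<open>The operators are bounded for the q-norm, so their continuous extension to the completion acts
  termwise on Cauchy sequences.\<close>

type_synonym fop = "fvec \<Rightarrow> fvec"

definition Y_op :: "real \<Rightarrow> real measure \<Rightarrow> nat \<Rightarrow> real set \<Rightarrow> fop"
  where "Y_op q \<nu> k I = (\<lambda>u m. tens_Y q \<nu> k I (u m))"

definition X_op :: "real \<Rightarrow> real measure \<Rightarrow> real set \<Rightarrow> fop"
  where "X_op q \<nu> I = Y_op q \<nu> 1 I"

definition op_prod :: "fop list \<Rightarrow> fop"
  where "op_prod As = foldr (\<circ>) As id"

inductive_set X_algebra :: "real \<Rightarrow> real measure \<Rightarrow> fop set"
  for q :: real and \<nu> :: "real measure" where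
  one: "id \<in> X_algebra q \<nu>"
| gen: "t \<ge> 0 \<Longrightarrow> X_op q \<nu> {0..<t} \<in> X_algebra q \<nu>"
| add: "A \<in> X_algebra q \<nu> \<Longrightarrow> B \<in> X_algebra q \<nu> \<Longrightarrow> A + B \<in> X_algebra q \<nu>"
| scale: "A \<in> X_algebra q \<nu> \<Longrightarrow> (\<lambda>u. fock_scale c (A u)) \<in> X_algebra q \<nu>"
| mult: "A \<in> X_algebra q \<nu> \<Longrightarrow> B \<in> X_algebra q \<nu> \<Longrightarrow> A \<circ> B \<in> X_algebra q \<nu>"

text \<open>The inner product of operators \<open>A\<close> and \<open>B\<close> in the vacuum state is that of the vectors
  \<open>A vacuum\<close> and \<open>B vacuum\<close>, so the completion of the algebra is the closure of its orbit of the
  vacuum vector.\<close>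

definition L2_X :: "real \<Rightarrow> real measure \<Rightarrow> fvec set"
  where "L2_X q \<nu> =
    {v \<in> fock q \<nu>. \<forall>e>0. \<exists>A \<in> X_algebra q \<nu>. fock_dist q \<nu> (A vacuum) v < e}"

definition half_open :: "real set \<Rightarrow> bool"
  where "half_open I \<longleftrightarrow> (\<exists>a b. 0 \<le> a \<and> a < b \<and> I = {a..<b})"


section \<open>Multiple stochastic integrals\<close>

text \<open>A list \<open>G\<close> of pairs \<open>(c, [I\<^sub>1, \<dots>, I\<^sub>k])\<close> represents the linear combination, with coefficients
  \<open>c\<close>, of indicators of boxes \<open>I\<^sub>1 \<times> \<dots> \<times> I\<^sub>k\<close> with disjoint sides. The list \<open>ks\<close> holds the indices of
  the integrators \<open>Y\<close>.\<close>

type_synonym simple = "(complex \<times> real set list) list"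

definition rplus_pow :: "nat \<Rightarrow> (nat \<Rightarrow> real) measure"
  where "rplus_pow k = PiM {..<k} (\<lambda>_. rplus)"

definition box_ind :: "real set list \<Rightarrow> (nat \<Rightarrow> real) \<Rightarrow> complex"
  where "box_ind Is = (\<lambda>x. \<Prod>i<length Is. indicator (Is ! i) (x i))"

definition simple_functions :: "nat \<Rightarrow> simple set"
  where "simple_functions k = {G. \<forall>(c, Is) \<in> set G. length Is = k \<and>
    (\<forall>I \<in> set Is. half_open I) \<and> (\<forall>i<k. \<forall>j<k. i \<noteq> j \<longrightarrow> Is ! i \<inter> Is ! j = {})}"

definition simple_fun :: "simple \<Rightarrow> (nat \<Rightarrow> real) \<Rightarrow> complex"
  where "simple_fun G = (\<lambda>x. \<Sum>(c, Is) \<leftarrow> G. c * box_ind Is x)"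

definition simple_integral :: "real \<Rightarrow> real measure \<Rightarrow> nat list \<Rightarrow> simple \<Rightarrow> fvec"
  where "simple_integral q \<nu> ks G =
    (\<Sum>(c, Is) \<leftarrow> G. fock_scale c (op_prod (map2 (Y_op q \<nu>) ks Is) vacuum))"

definition simple_near :: "nat \<Rightarrow> ((nat \<Rightarrow> real) \<Rightarrow> complex) \<Rightarrow> simple filter"
  where "simple_near k F = (INF d \<in> {0<..}.
    principal {G \<in> simple_functions k. L2_dist (rplus_pow k) (simple_fun G) F < d})"

text \<open>Extension by continuity: the value at \<open>F\<close> is the limit of the integrals of the simple
  functions approaching \<open>F\<close> in \<open>L2\<close> (the simple functions above are dense, diagonals being null).\<close>

definition has_multiple_integral ::
    "real \<Rightarrow> real measure \<Rightarrow> nat list \<Rightarrow> ((nat \<Rightarrow> real) \<Rightarrow> complex) \<Rightarrow> fvec \<Rightarrow> bool"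
  where "has_multiple_integral q \<nu> ks F v \<longleftrightarrow>
    F \<in> L2 (rplus_pow (length ks)) \<and> v \<in> fock q \<nu> \<and>
    ((\<lambda>G. fock_dist q \<nu> (simple_integral q \<nu> ks G) v) \<longlongrightarrow> 0) (simple_near (length ks) F)"

text \<open>The full stochastic measure of \<open>Y\<^bsub>ks!0\<^esub>(t), Y\<^bsub>ks!1\<^esub>(t), \<dots>\<close>. The integral is unique up to \<open>fock_eq\<close>.\<close>

definition full_measure :: "real \<Rightarrow> real measure \<Rightarrow> nat list \<Rightarrow> real \<Rightarrow> fvec"
  where "full_measure q \<nu> ks t = (if ks = [] then vacuum
    else SOME v. has_multiple_integral q \<nu> ks (box_ind (replicate (length ks) {0..<t})) v)"


section \<open>Partition-dependent stochastic measures\<close>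

definition subdivision :: "real \<Rightarrow> real set list \<Rightarrow> bool"
  where "subdivision t Is \<longleftrightarrow> (\<forall>I \<in> set Is. half_open I) \<and>
    (\<forall>i<length Is. \<forall>j<length Is. i \<noteq> j \<longrightarrow> Is ! i \<inter> Is ! j = {}) \<and> \<Union> (set Is) = {0..<t}"

definition mesh :: "real set list \<Rightarrow> real"
  where "mesh Is = Max (measure lborel ` set Is)"

definition fine_subdivisions :: "real \<Rightarrow> real set list filter"
  where "fine_subdivisions t = (INF d \<in> {0<..}. principal {Is. subdivision t Is \<and> mesh Is < d})"

definition St_sum ::
    "real \<Rightarrow> real measure \<Rightarrow> nat \<Rightarrow> nat set set \<Rightarrow> real set list \<Rightarrow> fop"
  where "St_sum q \<nu> n \<pi> Is =
    (\<Sum>u \<in> {u \<in> {1..n} \<rightarrow>\<^sub>E {..<length Is}.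
        \<forall>i\<in>{1..n}. \<forall>j\<in>{1..n}. u i = u j \<longleftrightarrow> (\<exists>B\<in>\<pi>. i \<in> B \<and> j \<in> B)}.
      op_prod (map (\<lambda>i. X_op q \<nu> (Is ! u i)) [1..<Suc n]))"

definition has_stochastic_measure ::
    "real \<Rightarrow> real measure \<Rightarrow> nat \<Rightarrow> nat set set \<Rightarrow> real \<Rightarrow> fvec \<Rightarrow> bool"
  where "has_stochastic_measure q \<nu> n \<pi> t v \<longleftrightarrow>
    ((\<lambda>Is. fock_dist q \<nu> (St_sum q \<nu> n \<pi> Is vacuum) v) \<longlongrightarrow> 0) (fine_subdivisions t)"

definition r_moment :: "real measure \<Rightarrow> nat \<Rightarrow> real"
  where "r_moment \<nu> k = (if k = 1 then 0 else \<integral>x. x ^ (k - 2) \<partial>\<nu>)"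

definition R_coeff :: "real measure \<Rightarrow> nat set set \<Rightarrow> real \<Rightarrow> real"
  where "R_coeff \<nu> \<tau> t = t ^ card \<tau> * (\<Prod>B\<in>\<tau>. r_moment \<nu> (card B))"

text \<open>Restricted crossings; here \<open>\<pi>\<close> is a partition of \<open>{1..n}\<close> and \<open>S \<subseteq> \<pi>\<close>.\<close>

definition rc_at :: "nat \<Rightarrow> nat set set \<Rightarrow> nat set set \<Rightarrow> nat"
  where "rc_at k S \<pi> = (let B = (THE B. B \<in> \<pi> \<and> k \<in> B) in
    if k = Max B then 0
    else let j = Min {i \<in> B. i > k} in
      card {C \<in> \<pi>. C \<inter> {k+1..j-1} \<noteq> {} \<and> (C \<in> S \<or> C \<inter> {1..k} \<noteq> {})})"

definition rc :: "nat \<Rightarrow> nat set set \<Rightarrow> nat set set \<Rightarrow> nat"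
  where "rc n S \<pi> = (\<Sum>k=1..n. rc_at k S \<pi>)"

definition class_sizes :: "nat set set \<Rightarrow> nat list"
  where "class_sizes S = map card (sorted_key_list_of_set Min S)"

end

theory Submission
  imports Defs
begin

text \<open>Evaluating words pointwise (\<open>tens_fun\<close>) turns formal combinations into functions on powers of the
  one-particle space. The processes and the q-inner product depend only on these functions, and the q-inner
  product is a sum of \<open>L2\<close> inner products, because \<open>q ^ inversion_number\<close> is a positive definite function
  on permutations. The norm of a combination of words of step functions, with the exponents of the space
  variable fixed, is then bounded by the \<open>L2\<close> norm of a combination of indicators of boxes; in
  particular the full stochastic measure of \<open>Y\<^bsub>k\<^esub>\<close>'s is the word with letters \<open>ind_mono {0..<t} (k - 1)\<close>.

  Applying the product of the \<open>X\<close>'s to the vacuum from the right, each operator either creates a new letter,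
  or annihilates or preserves the letter of its own class, other classes living on disjoint intervals.
  A term in which a class occurs twice sums to something of the order of the mesh. The remaining terms are
  indexed by the set \<open>S\<close> of classes that still have a letter at the end, and the exponent of \<open>q\<close> collected
  on the way counts the letters to the left of the one that is annihilated or preserved, which are the
  restricted crossings.\<close>

section \<open>Formal linear combinations\<close>

text \<open>The expansion is carried out symbolically, with classes in place of intervals. The
  resulting finite list of terms does not depend on the subdivision, so the limit is taken term by
  term, each error being of order \<open>sqrt (mesh Is)\<close>. The rightmost position of a class
  creates a letter with exponent 0, each preservation raises the exponent by 1, and an annihilation
  turns the exponent j into the j-th moment of \<nu> times the length of the interval. At the
  leftmost position of a class of size m this gives j = m - 2, and a singleton cannot be annihilated
  at all: this is the shift in \<open>r_moment\<close> and its value 0 at 1. A class occurs twice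
  through a second creation while it has a letter, or through an annihilation before its leftmost
  position; its length then enters at least squared. Operators act from the right, so the fate of a
  class is decided only at its least element, and until then it has a letter whatever
  \<open>S\<close> is. Hence restricted crossings count a class if it is in \<open>S\<close> or
  meets \<open>{1..k}\<close>.\<close>

lemma lookup_scale [simp]: "Poly_Mapping.lookup (scale c f) w = c * Poly_Mapping.lookup f w"
  by (simp add: scale_def Poly_Mapping.map.rep_eq when_def)

interpretation formal: module "scale :: complex \<Rightarrow> ('a \<Rightarrow>\<^sub>0 complex) \<Rightarrow> 'a \<Rightarrow>\<^sub>0 complex"
  by standard (auto intro!: poly_mapping_eqI simp: lookup_add algebra_simps)

lemma keys_scale: "Poly_Mapping.keys (scale c f) \<subseteq> Poly_Mapping.keys f"
  by (auto simp: in_keys_iff)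

lemma scale_single [simp]: "scale c (Poly_Mapping.single w d) = Poly_Mapping.single w (c * d)"
  by (rule poly_mapping_eqI) (simp add: lookup_single when_def)

text \<open>Values at points, inner products with a fixed word and coefficients of an image under
  \<open>lin_ext\<close> all have this form, so linearity is proved once for all of them.\<close>

definition lin_eval :: "('a \<Rightarrow> complex) \<Rightarrow> ('a \<Rightarrow>\<^sub>0 complex) \<Rightarrow> complex"
  where "lin_eval \<psi> f = (\<Sum>w \<in> Poly_Mapping.keys f. Poly_Mapping.lookup f w * \<psi> w)"

lemma lin_eval_superset:
  assumes "finite A" "Poly_Mapping.keys f \<subseteq> A"
  shows "lin_eval \<psi> f = (\<Sum>w \<in> A. Poly_Mapping.lookup f w * \<psi> w)"
  unfolding lin_eval_def using assms by (intro sum.mono_neutral_left) (auto simp: in_keys_iff)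

lemma lin_eval_cong:
  assumes "\<And>w. w \<in> Poly_Mapping.keys f \<Longrightarrow> \<psi> w = \<psi>' w"
  shows "lin_eval \<psi> f = lin_eval \<psi>' f"
  unfolding lin_eval_def using assms by (intro sum.cong) auto

lemma lin_eval_zero [simp]: "lin_eval \<psi> 0 = 0"
  by (simp add: lin_eval_def)

lemma lin_eval_add: "lin_eval \<psi> (f + g) = lin_eval \<psi> f + lin_eval \<psi> g"
proof -
  define A where "A = Poly_Mapping.keys f \<union> Poly_Mapping.keys g"
  have "finite A" "Poly_Mapping.keys f \<subseteq> A" "Poly_Mapping.keys g \<subseteq> A" "Poly_Mapping.keys (f + g) \<subseteq> A"
    using Poly_Mapping.keys_add[of f g] by (auto simp: A_def)
  then show ?thesis
    by (simp add: lin_eval_superset[of A] lookup_add algebra_simps sum.distrib)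
qed

lemma lin_eval_scale: "lin_eval \<psi> (scale c f) = c * lin_eval \<psi> f"
  by (simp add: lin_eval_superset[OF finite_keys keys_scale] lin_eval_def[of \<psi> f] sum_distrib_left mult.assoc)

lemma lin_eval_diff: "lin_eval \<psi> (f - g) = lin_eval \<psi> f - lin_eval \<psi> g"
  using lin_eval_add[of \<psi> "f - g" g] by simp

lemma lin_eval_sum: "lin_eval \<psi> (\<Sum>i\<in>A. f i) = (\<Sum>i\<in>A. lin_eval \<psi> (f i))"
  by (induction A rule: infinite_finite_induct) (simp_all add: lin_eval_add)

lemma lin_eval_single [simp]: "lin_eval \<psi> (Poly_Mapping.single w c) = c * \<psi> w"
  by (subst lin_eval_superset[of "{w}"]) auto

lemma lin_eval_lin_ext: "lin_eval \<psi> (lin_ext \<Phi> f) = lin_eval (\<lambda>w. lin_eval \<psi> (\<Phi> w)) f"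
  by (simp add: lin_ext_def lin_eval_sum lin_eval_scale lin_eval_def[of "\<lambda>w. lin_eval \<psi> (\<Phi> w)"])

lemma lin_eval_fun_add: "lin_eval (\<lambda>w. \<psi> w + \<psi>' w) f = lin_eval \<psi> f + lin_eval \<psi>' f"
  by (simp add: lin_eval_def algebra_simps sum.distrib)

lemma lin_eval_fun_cmult: "lin_eval (\<lambda>w. c * \<psi> w) f = c * lin_eval \<psi> f"
  by (simp add: lin_eval_def sum_distrib_left mult_ac)

lemma lin_eval_fun_sum: "lin_eval (\<lambda>w. \<Sum>i\<in>A. \<psi> i w) f = (\<Sum>i\<in>A. lin_eval (\<psi> i) f)"
  unfolding lin_eval_def by (simp add: sum_distrib_left) (rule sum.swap)

lemma lin_eval_fun_zero [simp]: "lin_eval (\<lambda>w. 0) f = 0"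
  by (simp add: lin_eval_def)

lemma lin_eval_integral:
  assumes "\<And>w. w \<in> Poly_Mapping.keys f \<Longrightarrow> integrable M (\<psi> w)"
  shows "lin_eval (\<lambda>w. \<integral>x. \<psi> w x \<partial>M) f = (\<integral>x. lin_eval (\<lambda>w. \<psi> w x) f \<partial>M)"
  unfolding lin_eval_def using assms by (subst Bochner_Integration.integral_sum) auto

lemma integrable_lin_eval:
  fixes \<psi> :: "'a \<Rightarrow> 'b \<Rightarrow> complex"
  assumes "\<And>w. w \<in> Poly_Mapping.keys f \<Longrightarrow> integrable M (\<psi> w)"
  shows "integrable M (\<lambda>x. lin_eval (\<lambda>w. \<psi> w x) f)"
  unfolding lin_eval_def using assms by (intro Bochner_Integration.integrable_sum) auto

lemma keys_sum_subset: "Poly_Mapping.keys (\<Sum>i\<in>A. f i) \<subseteq> (\<Union>i\<in>A. Poly_Mapping.keys (f i))"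
proof (induction A rule: infinite_finite_induct)
  case (insert x F)
  then show ?case
    using Poly_Mapping.keys_add[of "f x" "sum f F"] by auto
qed auto

section \<open>Tensors as functions\<close>

text \<open>The last two clauses make a word vanish on lists of the wrong length, so a single
  function on lists records all tensor degrees, with the vacuum living at the empty list.\<close>

fun word_fun :: "('a \<Rightarrow> complex) list \<Rightarrow> 'a list \<Rightarrow> complex" where
  "word_fun [] [] = 1"
| "word_fun (f # w) (z # zs) = f z * word_fun w zs"
| "word_fun [] (z # zs) = 0"
| "word_fun (f # w) [] = 0"

lemma word_fun_length: "length w \<noteq> length zs \<Longrightarrow> word_fun w zs = 0"
  by (induction w zs rule: word_fun.induct) auto

lemma word_fun_append:
  "length v = length ys \<Longrightarrow> word_fun (v @ w) (ys @ zs) = word_fun v ys * word_fun w zs"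
  by (induction v ys rule: word_fun.induct) (auto simp: mult_ac)

lemma word_fun_nth: "length w = length zs \<Longrightarrow> word_fun w zs = (\<Prod>i<length w. (w ! i) (zs ! i))"
  by (induction w zs rule: word_fun.induct) (auto simp: prod.lessThan_Suc_shift simp del: prod.lessThan_Suc)

text \<open>Removing the \<open>k\<close>-th letter is dual to inserting a point at position
  \<open>k\<close>. Annihilation and preservation, which are defined by removing letters, thereby
  become operations on functions.\<close>

lemma word_fun_insert:
  assumes "k < length w" "length w = Suc (length zs)"
  shows "word_fun w (take k zs @ y # drop k zs)
    = (w ! k) y * word_fun (take k w @ drop (Suc k) w) zs"
proof -
  have "word_fun (take k w @ w ! k # drop (Suc k) w) (take k zs @ y # drop k zs)
      = word_fun (take k w) (take k zs) * ((w ! k) y * word_fun (drop (Suc k) w) (drop k zs))"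
    using assms by (subst word_fun_append) auto
  moreover have "word_fun (take k w @ drop (Suc k) w) (take k zs @ drop k zs)
      = word_fun (take k w) (take k zs) * word_fun (drop (Suc k) w) (drop k zs)"
    using assms by (subst word_fun_append) auto
  ultimately show ?thesis
    using assms(1) by (simp flip: id_take_nth_drop)
qed

definition tens_fun :: "tens \<Rightarrow> (real \<times> real) list \<Rightarrow> complex"
  where "tens_fun f zs = lin_eval (\<lambda>w. word_fun w zs) f"

text \<open>Equality at every point rather than almost everywhere. The relations used later are
  multilinearity in the letters and the vanishing of a letter with empty interval, and both hold
  pointwise for step letters.\<close>

definition tens_eq :: "tens \<Rightarrow> tens \<Rightarrow> bool"
  where "tens_eq f g \<longleftrightarrow> (\<forall>zs. tens_fun f zs = tens_fun g zs)"

lemma tens_fun_simps [simp]: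
  "tens_fun 0 zs = 0"
  "tens_fun (f + g) zs = tens_fun f zs + tens_fun g zs"
  "tens_fun (f - g) zs = tens_fun f zs - tens_fun g zs"
  "tens_fun (scale c f) zs = c * tens_fun f zs"
  "tens_fun (Poly_Mapping.single w c) zs = c * word_fun w zs"
  by (simp_all add: tens_fun_def lin_eval_add lin_eval_diff lin_eval_scale)

lemma tens_fun_sum: "tens_fun (\<Sum>i\<in>A. f i) zs = (\<Sum>i\<in>A. tens_fun (f i) zs)"
  by (simp add: tens_fun_def lin_eval_sum)

lemma borel_measurable_cnj [measurable (raw)]:
  "f \<in> borel_measurable M \<Longrightarrow> (\<lambda>x. cnj (f x)) \<in> borel_measurable M"
  by (rule borel_measurable_continuous_on[where f = cnj]) (auto intro: continuous_intros)

lemma L2_mult_integrable: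
  assumes "f \<in> L2 M" "g \<in> L2 M"
  shows "integrable M (\<lambda>x. cnj (f x) * g x)"
proof -
  have [measurable]: "f \<in> borel_measurable M" "g \<in> borel_measurable M"
    using assms by (auto simp: L2_def)
  have "integrable M (\<lambda>x. (cmod (f x))\<^sup>2 + (cmod (g x))\<^sup>2)"
    using assms by (auto simp: L2_def)
  then show ?thesis
  proof (rule Bochner_Integration.integrable_bound)
    have "cmod (f x) * cmod (g x) \<le> (cmod (f x))\<^sup>2 + (cmod (g x))\<^sup>2" for x
    proof -
      have "2 * (cmod (f x) * cmod (g x)) \<le> (cmod (f x))\<^sup>2 + (cmod (g x))\<^sup>2"
        using sum_squares_bound[of "cmod (f x)" "cmod (g x)"] by (simp add: mult.assoc)
      moreover have "0 \<le> cmod (f x) * cmod (g x)" by simp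
      ultimately show ?thesis by linarith
    qed
    then show "AE x in M. cmod (cnj (f x) * g x) \<le> norm ((cmod (f x))\<^sup>2 + (cmod (g x))\<^sup>2)"
      by (auto simp: norm_mult)
  qed measurable
qed

lemma tens_fun_create:
  "tens_fun (tens_create \<zeta> f) [] = 0"
  "tens_fun (tens_create \<zeta> f) (z # zs) = \<zeta> z * tens_fun f zs"
  by (simp_all add: tens_create_def tens_fun_def lin_eval_lin_ext lin_eval_fun_cmult)

text \<open>The right-hand side sees \<open>f\<close> only through \<open>tens_fun f\<close>. Square
  integrability of the letters lets the integral pass through the finite combination, and words
  whose length is not \<open>Suc (length zs)\<close> give 0 on both sides.\<close>

lemma tens_fun_annihilate:
  assumes f: "f \<in> tens_carrier \<nu>" and \<zeta>: "\<zeta> \<in> L2 (hmeas \<nu>)"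
  shows "tens_fun (tens_annihilate q \<nu> \<zeta> f) zs = (\<Sum>k\<le>length zs. complex_of_real (q ^ k) *
    (\<integral>y. cnj (\<zeta> y) * tens_fun f (take k zs @ y # drop k zs) \<partial>hmeas \<nu>))"
proof -
  have int: "integrable (hmeas \<nu>) (\<lambda>y. cnj (\<zeta> y) * word_fun w (take k zs @ y # drop k zs))"
    and eq: "(\<integral>y. cnj (\<zeta> y) * word_fun w (take k zs @ y # drop k zs) \<partial>hmeas \<nu>)
       = (if length w = Suc (length zs) then L2_inner (hmeas \<nu>) \<zeta> (w ! k) *
           word_fun (take k w @ drop (Suc k) w) zs else 0)"
    if w: "w \<in> Poly_Mapping.keys f" and k: "k \<le> length zs" for w k
  proof -
    have "integrable (hmeas \<nu>) (\<lambda>y. cnj (\<zeta> y) * word_fun w (take k zs @ y # drop k zs))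
      \<and> (\<integral>y. cnj (\<zeta> y) * word_fun w (take k zs @ y # drop k zs) \<partial>hmeas \<nu>)
       = (if length w = Suc (length zs) then L2_inner (hmeas \<nu>) \<zeta> (w ! k) *
           word_fun (take k w @ drop (Suc k) w) zs else 0)"
    proof (cases "length w = Suc (length zs)")
      case True
      with k have "w ! k \<in> set w" by simp
      with w f have "w ! k \<in> L2 (hmeas \<nu>)" by (auto simp: tens_carrier_def)
      then show ?thesis
        using True k L2_mult_integrable[OF \<zeta>, of "w ! k"]
        by (simp add: word_fun_insert L2_inner_def flip: mult.assoc)
    next
      case False
      with k show ?thesis by (simp add: word_fun_length)
    qed
    then show "integrable (hmeas \<nu>) (\<lambda>y. cnj (\<zeta> y) * word_fun w (take k zs @ y # drop k zs))"
     "(\<integral>y. cnj (\<zeta> y) * word_fun w (take k zs @ y # drop k zs) \<partial>hmeas \<nu>)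
       = (if length w = Suc (length zs) then L2_inner (hmeas \<nu>) \<zeta> (w ! k) *
           word_fun (take k w @ drop (Suc k) w) zs else 0)"
      by auto
  qed
  have "tens_fun (tens_annihilate q \<nu> \<zeta> f) zs
     = lin_eval (\<lambda>w. \<Sum>k<length w. complex_of_real (q ^ k) * L2_inner (hmeas \<nu>) \<zeta> (w ! k) *
         word_fun (take k w @ drop (Suc k) w) zs) f"
    by (simp add: tens_fun_def tens_annihilate_def lin_eval_lin_ext lin_eval_sum)
  also have "\<dots> = lin_eval (\<lambda>w. \<Sum>k\<le>length zs. complex_of_real (q ^ k) *
      (\<integral>y. cnj (\<zeta> y) * word_fun w (take k zs @ y # drop k zs) \<partial>hmeas \<nu>)) f"
  proof (rule lin_eval_cong)
    fix w assume w: "w \<in> Poly_Mapping.keys f"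
    show "(\<Sum>k<length w. complex_of_real (q ^ k) * L2_inner (hmeas \<nu>) \<zeta> (w ! k) *
         word_fun (take k w @ drop (Suc k) w) zs) = (\<Sum>k\<le>length zs. complex_of_real (q ^ k) *
      (\<integral>y. cnj (\<zeta> y) * word_fun w (take k zs @ y # drop k zs) \<partial>hmeas \<nu>))"
    proof (cases "length w = Suc (length zs)")
      case True
      then show ?thesis
        by (intro sum.cong) (auto simp: eq[OF w] mult.assoc)
    next
      case False
      have "(\<Sum>k<length w. complex_of_real (q ^ k) * L2_inner (hmeas \<nu>) \<zeta> (w ! k) *
         word_fun (take k w @ drop (Suc k) w) zs) = 0"
        using False by (intro sum.neutral) (auto simp: word_fun_length)
      with False show ?thesis
        using eq[OF w] by simp
    qed
  qed
  also have "\<dots> = (\<Sum>k\<le>length zs. complex_of_real (q ^ k) *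
    lin_eval (\<lambda>w. \<integral>y. cnj (\<zeta> y) * word_fun w (take k zs @ y # drop k zs) \<partial>hmeas \<nu>) f)"
    by (simp add: lin_eval_fun_sum lin_eval_fun_cmult)
  also have "\<dots> = (\<Sum>k\<le>length zs. complex_of_real (q ^ k) *
    (\<integral>y. cnj (\<zeta> y) * tens_fun f (take k zs @ y # drop k zs) \<partial>hmeas \<nu>))"
    using int by (intro sum.cong) (auto simp: lin_eval_integral lin_eval_fun_cmult tens_fun_def)
  finally show ?thesis .
qed

lemma tens_fun_preserve:
  "tens_fun (tens_preserve q (mult_op g) f) [] = 0"
  "tens_fun (tens_preserve q (mult_op g) f) (z # zs) = (\<Sum>k\<le>length zs. complex_of_real (q ^ k) *
     (g z * tens_fun f (take k zs @ z # drop k zs)))"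
proof -
  show "tens_fun (tens_preserve q (mult_op g) f) [] = 0"
    by (simp add: tens_fun_def tens_preserve_def lin_eval_lin_ext lin_eval_sum)
  have "tens_fun (tens_preserve q (mult_op g) f) (z # zs)
     = lin_eval (\<lambda>w. \<Sum>k<length w. complex_of_real (q ^ k) *
         (g z * (w ! k) z * word_fun (take k w @ drop (Suc k) w) zs)) f"
    by (simp add: tens_fun_def tens_preserve_def lin_eval_lin_ext lin_eval_sum mult_op_def)
  also have "\<dots> = lin_eval (\<lambda>w. \<Sum>k\<le>length zs. complex_of_real (q ^ k) *
      (g z * word_fun w (take k zs @ z # drop k zs))) f"
  proof (rule lin_eval_cong)
    fix w
    show "(\<Sum>k<length w. complex_of_real (q ^ k) *
         (g z * (w ! k) z * word_fun (take k w @ drop (Suc k) w) zs))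
       = (\<Sum>k\<le>length zs. complex_of_real (q ^ k) *
      (g z * word_fun w (take k zs @ z # drop k zs)))"
    proof (cases "length w = Suc (length zs)")
      case True
      then show ?thesis
        by (intro sum.cong) (auto simp: word_fun_insert mult.assoc)
    next
      case False
      have "(\<Sum>k<length w. complex_of_real (q ^ k) *
         (g z * (w ! k) z * word_fun (take k w @ drop (Suc k) w) zs)) = 0"
        using False by (intro sum.neutral) (auto simp: word_fun_length)
      moreover have "(\<Sum>k\<le>length zs. complex_of_real (q ^ k) *
          (g z * word_fun w (take k zs @ z # drop k zs))) = 0"
        using False by (intro sum.neutral) (auto simp: word_fun_length)
      ultimately show ?thesis by simp
    qed
  qed
  finally show "tens_fun (tens_preserve q (mult_op g) f) (z # zs) = (\<Sum>k\<le>length zs.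
     complex_of_real (q ^ k) * (g z * tens_fun f (take k zs @ z # drop k zs)))"
    by (simp add: tens_fun_def lin_eval_fun_sum lin_eval_fun_cmult)
qed

lemma tens_eq_refl [simp]: "tens_eq f f"
  and tens_eq_trans [trans]: "tens_eq f g \<Longrightarrow> tens_eq g h \<Longrightarrow> tens_eq f h"
  by (simp_all add: tens_eq_def)

lemma tens_eq_add: "tens_eq f g \<Longrightarrow> tens_eq f' g' \<Longrightarrow> tens_eq (f + f') (g + g')"
  and tens_eq_diff: "tens_eq f g \<Longrightarrow> tens_eq f' g' \<Longrightarrow> tens_eq (f - f') (g - g')"
  and tens_eq_scale: "tens_eq f g \<Longrightarrow> tens_eq (scale c f) (scale c g)"
  by (simp_all add: tens_eq_def)

lemma tens_eq_sum: "(\<And>i. i \<in> A \<Longrightarrow> tens_eq (f i) (g i)) \<Longrightarrow> tens_eq (sum f A) (sum g A)"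
  by (simp add: tens_eq_def tens_fun_sum)

lemma tens_eq_sum_list:
  "(\<And>i. i \<in> set xs \<Longrightarrow> tens_eq (f i) (g i)) \<Longrightarrow> tens_eq (sum_list (map f xs)) (sum_list (map g xs))"
  by (induction xs) (auto intro: tens_eq_add)

lemma tens_carrier_zero [simp]: "0 \<in> tens_carrier \<nu>"
  by (simp add: tens_carrier_def)

lemma tens_carrier_add: "f \<in> tens_carrier \<nu> \<Longrightarrow> g \<in> tens_carrier \<nu> \<Longrightarrow> f + g \<in> tens_carrier \<nu>"
  unfolding tens_carrier_def using Poly_Mapping.keys_add[of f g] by fastforce

lemma tens_carrier_scale: "f \<in> tens_carrier \<nu> \<Longrightarrow> scale c f \<in> tens_carrier \<nu>"
  unfolding tens_carrier_def using keys_scale[of c f] by fastforce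

lemma tens_carrier_diff: "f \<in> tens_carrier \<nu> \<Longrightarrow> g \<in> tens_carrier \<nu> \<Longrightarrow> f - g \<in> tens_carrier \<nu>"
  using tens_carrier_add[of f \<nu> "scale (- 1) g"] tens_carrier_scale[of g \<nu> "- 1"] by simp

lemma tens_carrier_single: "set w \<subseteq> L2 (hmeas \<nu>) \<Longrightarrow> Poly_Mapping.single w c \<in> tens_carrier \<nu>"
  by (simp add: tens_carrier_def)

lemma tens_carrier_sum: "(\<And>i. i \<in> A \<Longrightarrow> f i \<in> tens_carrier \<nu>) \<Longrightarrow> sum f A \<in> tens_carrier \<nu>"
  by (induction A rule: infinite_finite_induct) (auto intro: tens_carrier_add)

lemma tens_carrier_sum_list:
  "(\<And>i. i \<in> set xs \<Longrightarrow> f i \<in> tens_carrier \<nu>) \<Longrightarrow> sum_list (map f xs) \<in> tens_carrier \<nu>"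
  by (induction xs) (auto intro: tens_carrier_add)

section \<open>The q-inner product is positive\<close>

definition perm_word :: "(nat \<Rightarrow> nat) \<Rightarrow> 'a list \<Rightarrow> 'a list"
  where "perm_word \<sigma> w = map (\<lambda>i. w ! \<sigma> i) [0..<length w]"

lemma length_perm_word [simp]: "length (perm_word \<sigma> w) = length w"
  by (simp add: perm_word_def)

lemma perm_word_nth: "i < length w \<Longrightarrow> perm_word \<sigma> w ! i = w ! \<sigma> i"
  by (simp add: perm_word_def)

lemma perm_word_comp:
  assumes "\<tau> permutes {..<length w}"
  shows "perm_word \<tau> (perm_word \<sigma> w) = perm_word (\<sigma> \<circ> \<tau>) w"
proof (rule nth_equalityI)
  fix i assume "i < length (perm_word \<tau> (perm_word \<sigma> w))"
  then have i: "i < length w" by simp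
  with assms have "\<tau> i < length w"
    using permutes_in_image[of \<tau> "{..<length w}" i] by simp
  with i show "perm_word \<tau> (perm_word \<sigma> w) ! i = perm_word (\<sigma> \<circ> \<tau>) w ! i"
    by (simp add: perm_word_nth)
qed simp

lemma set_perm_word:
  assumes "\<sigma> permutes {..<length w}"
  shows "set (perm_word \<sigma> w) \<subseteq> set w"
proof -
  have "\<sigma> i < length w" if "i < length w" for i
    using permutes_in_image[OF assms, of i] that by simp
  then show ?thesis by (auto simp: perm_word_def)
qed

lemma word_fun_perm_word:
  assumes "\<tau> permutes {..<n}"
  shows "word_fun (perm_word \<tau> w) (map z [0..<n]) = word_fun w (map (z \<circ> inv \<tau>) [0..<n])"
proof (cases "length w = n")
  case True
  have "(\<Prod>i<n. (w ! \<tau> i) (z i)) = (\<Prod>i<n. (w ! i) (z (inv \<tau> i)))"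
    by (subst (2) prod.permute[OF assms]) (simp add: permutes_inverses[OF assms])
  with True show ?thesis
    by (simp add: word_fun_nth perm_word_nth)
qed (simp add: word_fun_length)

lemma word_inner_perm_word:
  assumes "\<tau> permutes {..<n}" "length v = n" "length w = n"
  shows "word_inner \<nu> (perm_word \<tau> v) (perm_word \<tau> w) = word_inner \<nu> v w"
proof -
  have "(\<Prod>i<n. L2_inner (hmeas \<nu>) (v ! \<tau> i) (w ! \<tau> i)) = (\<Prod>i<n. L2_inner (hmeas \<nu>) (v ! i) (w ! i))"
    by (subst (2) prod.permute[OF assms(1)]) simp
  with assms show ?thesis
    by (simp add: word_inner_def perm_word_nth)
qed

section \<open>Inversions as disagreements of sign vectors on pairs of positions\<close>

definition pairs :: "nat \<Rightarrow> (nat \<times> nat) set"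
  where "pairs n = {(i, j). i < j \<and> j < n}"

lemma finite_pairs [simp]: "finite (pairs n)"
  by (rule finite_subset[of _ "{..<n} \<times> {..<n}"]) (auto simp: pairs_def)

definition order_sign :: "(nat \<Rightarrow> nat) \<Rightarrow> nat \<times> nat \<Rightarrow> real"
  where "order_sign \<tau> p = (if \<tau> (fst p) < \<tau> (snd p) then 1 else - 1)"

text \<open>The Walsh functions of the sign vector \<open>order_sign \<tau>\<close>, indexed by sets
  of pairs.\<close>

definition character :: "(nat \<times> nat) set \<Rightarrow> (nat \<Rightarrow> nat) \<Rightarrow> real"
  where "character T \<tau> = (\<Prod>p\<in>T. order_sign \<tau> p)"

text \<open>The coefficient belonging to \<open>T\<close> when the product over all pairs of
  \<open>(1 + q) / 2 + (1 - q) / 2 * s\<close> is multiplied out. Positivity of the q-inner product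
  for \<open>-1 < q < 1\<close> rests on the sign of these numbers.\<close>

definition character_weight :: "real \<Rightarrow> nat \<Rightarrow> (nat \<times> nat) set \<Rightarrow> real"
  where "character_weight q n T = (\<Prod>p\<in>T. (1 - q) / 2) * (\<Prod>p\<in>pairs n - T. (1 + q) / 2)"

lemma character_weight_nonneg: "- 1 < q \<Longrightarrow> q < 1 \<Longrightarrow> 0 \<le> character_weight q n T"
  unfolding character_weight_def by (intro mult_nonneg_nonneg prod_nonneg) auto

text \<open>A pair {a, b} on whose order \<tau> and \<rho> disagree corresponds to the inversion of
  \<open>\<rho> \<circ> inv \<tau>\<close> at the positions \<open>\<tau> a\<close> and
  \<open>\<tau> b\<close>; \<open>min\<close> and \<open>max\<close> sort these into an ordered
  pair.\<close>

lemma inversion_number_disagreement: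
  assumes \<tau>: "\<tau> permutes {..<n}" and \<rho>: "\<rho> permutes {..<n}"
  shows "inversion_number n (\<rho> \<circ> inv \<tau>) = card {p \<in> pairs n. order_sign \<tau> p \<noteq> order_sign \<rho> p}"
proof -
  have inj: "\<tau> a = \<tau> b \<longleftrightarrow> a = b" "\<rho> a = \<rho> b \<longleftrightarrow> a = b" "inv \<tau> a = inv \<tau> b \<longleftrightarrow> a = b" for a b
    using permutes_inj[OF \<tau>] permutes_inj[OF \<rho>] permutes_inj[OF permutes_inv[OF \<tau>]]
    by (auto simp: inj_eq)
  have lt: "\<tau> a < n \<longleftrightarrow> a < n" "inv \<tau> a < n \<longleftrightarrow> a < n" for a
    using permutes_in_image[OF \<tau>] permutes_in_image[OF permutes_inv[OF \<tau>]] by auto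
  have inv [simp]: "\<tau> (inv \<tau> a) = a" "inv \<tau> (\<tau> a) = a" for a
    using permutes_inverses[OF \<tau>] by auto
  have "bij_betw (\<lambda>(a, b). (min (\<tau> a) (\<tau> b), max (\<tau> a) (\<tau> b)))
      {p \<in> pairs n. order_sign \<tau> p \<noteq> order_sign \<rho> p}
      {(i, j). i < j \<and> j < n \<and> (\<rho> \<circ> inv \<tau>) j < (\<rho> \<circ> inv \<tau>) i}"
  proof (rule bij_betw_byWitness[where
      f' = "\<lambda>(i, j). (min (inv \<tau> i) (inv \<tau> j), max (inv \<tau> i) (inv \<tau> j))"])
    show "\<forall>p\<in>{p \<in> pairs n. order_sign \<tau> p \<noteq> order_sign \<rho> p}.
      (\<lambda>(i, j). (min (inv \<tau> i) (inv \<tau> j), max (inv \<tau> i) (inv \<tau> j)))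
        ((\<lambda>(a, b). (min (\<tau> a) (\<tau> b), max (\<tau> a) (\<tau> b))) p) = p"
      by (auto simp: pairs_def min_def max_def split: if_splits)
    show "\<forall>p\<in>{(i, j). i < j \<and> j < n \<and> (\<rho> \<circ> inv \<tau>) j < (\<rho> \<circ> inv \<tau>) i}.
      (\<lambda>(a, b). (min (\<tau> a) (\<tau> b), max (\<tau> a) (\<tau> b)))
       ((\<lambda>(i, j). (min (inv \<tau> i) (inv \<tau> j), max (inv \<tau> i) (inv \<tau> j))) p) = p"
      by (auto simp: min_def max_def split: if_splits)
    show "(\<lambda>(a, b). (min (\<tau> a) (\<tau> b), max (\<tau> a) (\<tau> b))) `
      {p \<in> pairs n. order_sign \<tau> p \<noteq> order_sign \<rho> p}
      \<subseteq> {(i, j). i < j \<and> j < n \<and> (\<rho> \<circ> inv \<tau>) j < (\<rho> \<circ> inv \<tau>) i}"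
    proof (rule image_subsetI)
      fix p assume p: "p \<in> {p \<in> pairs n. order_sign \<tau> p \<noteq> order_sign \<rho> p}"
      obtain a b where ab: "p = (a, b)" by (cases p)
      with p have "a < b" "b < n" and s: "order_sign \<tau> (a, b) \<noteq> order_sign \<rho> (a, b)"
        by (auto simp: pairs_def)
      then have "min (\<tau> a) (\<tau> b) < max (\<tau> a) (\<tau> b) \<and> max (\<tau> a) (\<tau> b) < n
         \<and> \<rho> (inv \<tau> (max (\<tau> a) (\<tau> b))) < \<rho> (inv \<tau> (min (\<tau> a) (\<tau> b)))"
        using s lt(1)[of a] lt(1)[of b] inj(1)[of a b] inj(2)[of a b]
        by (auto simp: order_sign_def min_def max_def split: if_splits)
      then show "(\<lambda>(a, b). (min (\<tau> a) (\<tau> b), max (\<tau> a) (\<tau> b))) p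
        \<in> {(i, j). i < j \<and> j < n \<and> (\<rho> \<circ> inv \<tau>) j < (\<rho> \<circ> inv \<tau>) i}"
        by (simp add: ab)
    qed
    show "(\<lambda>(i, j). (min (inv \<tau> i) (inv \<tau> j), max (inv \<tau> i) (inv \<tau> j))) `
      {(i, j). i < j \<and> j < n \<and> (\<rho> \<circ> inv \<tau>) j < (\<rho> \<circ> inv \<tau>) i}
      \<subseteq> {p \<in> pairs n. order_sign \<tau> p \<noteq> order_sign \<rho> p}"
    proof (rule image_subsetI)
      fix p assume p: "p \<in> {(i, j). i < j \<and> j < n \<and> (\<rho> \<circ> inv \<tau>) j < (\<rho> \<circ> inv \<tau>) i}"
      obtain i j where p_eq: "p = (i, j)" by (cases p)
      with p have ij: "i < j" "j < n" and s: "\<rho> (inv \<tau> j) < \<rho> (inv \<tau> i)"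
        by auto
      have "(min (inv \<tau> i) (inv \<tau> j), max (inv \<tau> i) (inv \<tau> j)) \<in> pairs n
        \<and> order_sign \<tau> (min (inv \<tau> i) (inv \<tau> j), max (inv \<tau> i) (inv \<tau> j))
          \<noteq> order_sign \<rho> (min (inv \<tau> i) (inv \<tau> j), max (inv \<tau> i) (inv \<tau> j))"
        using s ij lt(2)[of i] lt(2)[of j] inj(3)[of i j]
        by (auto simp: pairs_def order_sign_def min_def max_def)
      then show "(\<lambda>(i, j). (min (inv \<tau> i) (inv \<tau> j), max (inv \<tau> i) (inv \<tau> j))) p
        \<in> {p \<in> pairs n. order_sign \<tau> p \<noteq> order_sign \<rho> p}"
        by (simp add: p_eq)
    qed
  qed
  then show ?thesis
    unfolding inversion_number_def by (simp add: bij_betw_same_card)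
qed

text \<open>The kernel \<open>(\<tau>, \<rho>) \<mapsto> q ^ inversion_number n (\<rho> \<circ> inv \<tau>)\<close> is a product over pairs of the positive
  semidefinite kernel with values \<open>1\<close> and \<open>q\<close>, which equals \<open>(1 + q) / 2 + (1 - q) / 2 * (\<plusminus>1) * (\<plusminus>1)\<close>.\<close>

lemma inversion_kernel:
  assumes \<tau>: "\<tau> permutes {..<n}" and \<rho>: "\<rho> permutes {..<n}"
  shows "q ^ inversion_number n (\<rho> \<circ> inv \<tau>)
    = (\<Sum>T\<in>Pow (pairs n). character_weight q n T * (character T \<tau> * character T \<rho>))"
proof -
  have "q ^ inversion_number n (\<rho> \<circ> inv \<tau>)
      = (\<Prod>p\<in>{p \<in> pairs n. order_sign \<tau> p \<noteq> order_sign \<rho> p}. q)"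
    by (simp add: inversion_number_disagreement[OF assms])
  also have "\<dots> = (\<Prod>p\<in>pairs n. if order_sign \<tau> p \<noteq> order_sign \<rho> p then q else 1)"
    by (subst prod.inter_filter) auto
  also have "\<dots> = (\<Prod>p\<in>pairs n. (1 - q) / 2 * (order_sign \<tau> p * order_sign \<rho> p) + (1 + q) / 2)"
    by (intro prod.cong) (auto simp: order_sign_def field_simps)
  also have "\<dots> = (\<Sum>T\<in>Pow (pairs n). character_weight q n T * (character T \<tau> * character T \<rho>))"
    by (subst prod_add, simp, intro sum.cong refl)
       (simp only: character_weight_def character_def prod.distrib, simp only: mult_ac)
  finally show ?thesis .
qed

section \<open>The inner product of words as a sum over sign characters\<close>

definition q_kernel :: "real \<Rightarrow> real measure \<Rightarrow> hvec list \<Rightarrow> hvec list \<Rightarrow> complex"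
  where "q_kernel q \<nu> v w = (\<Sum>\<sigma> | \<sigma> permutes {..<length w}.
    complex_of_real (q ^ inversion_number (length w) \<sigma>) * word_inner \<nu> v (perm_word \<sigma> w))"

lemma tens_inner_kernel:
  "tens_inner q \<nu> f g = (\<Sum>v \<in> Poly_Mapping.keys f. cnj (Poly_Mapping.lookup f v) * lin_eval (q_kernel q \<nu> v) g)"
proof -
  have eq: "lin_eval (word_inner \<nu> v) (q_sym q g) = lin_eval (q_kernel q \<nu> v) g" for v
    unfolding q_sym_def lin_eval_lin_ext q_kernel_def
    by (simp add: lin_eval_sum perm_word_def)
  show ?thesis
    unfolding eq[symmetric]
    by (simp add: tens_inner_def tens_inner0_def lin_eval_def sum_distrib_left mult.assoc)
qed

text \<open>The usual inner product is unchanged when the same \<tau> permutes both words. Averaging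
  over \<tau>, whence the division by \<open>fact n\<close>, turns the single sum over permutations
  into a double one, and in that form the kernel is diagonalized by the characters.\<close>

lemma q_kernel_eq:
  assumes v: "length v = n" and w: "length w = n"
  shows "q_kernel q \<nu> v w = (\<Sum>T\<in>Pow (pairs n). complex_of_real (character_weight q n T / fact n) *
    (\<Sum>\<tau> | \<tau> permutes {..<n}. \<Sum>\<rho> | \<rho> permutes {..<n}.
      complex_of_real (character T \<tau> * character T \<rho>) * word_inner \<nu> (perm_word \<tau> v) (perm_word \<rho> w)))"
proof -
  let ?P = "{\<tau>. \<tau> permutes {..<n}}"
  have "q_kernel q \<nu> v w = (\<Sum>\<rho>\<in>?P.
      complex_of_real (q ^ inversion_number n (\<rho> \<circ> inv \<tau>)) * word_inner \<nu> (perm_word \<tau> v) (perm_word \<rho> w))"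
    if \<tau>: "\<tau> \<in> ?P" for \<tau>
  proof -
    have t: "\<tau> permutes {..<n}" using \<tau> by simp
    have "q_kernel q \<nu> v w = (\<Sum>\<sigma>\<in>?P. complex_of_real (q ^ inversion_number n \<sigma>) *
        word_inner \<nu> (perm_word \<tau> v) (perm_word (\<sigma> \<circ> \<tau>) w))"
      unfolding q_kernel_def w
      by (intro sum.cong refl)
         (use t v w in \<open>simp add: word_inner_perm_word flip: perm_word_comp\<close>)
    also have "\<dots> = (\<Sum>\<rho>\<in>?P. complex_of_real (q ^ inversion_number n (\<rho> \<circ> inv \<tau>)) *
        word_inner \<nu> (perm_word \<tau> v) (perm_word \<rho> w))"
      by (rule sum.reindex_bij_witness[of _ "\<lambda>\<rho>. \<rho> \<circ> inv \<tau>" "\<lambda>\<sigma>. \<sigma> \<circ> \<tau>"])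
         (use t in \<open>auto simp: o_assoc[symmetric] permutes_inv_o permutes_compose permutes_inv\<close>)
    finally show ?thesis .
  qed
  then have "(\<Sum>\<tau>\<in>?P. q_kernel q \<nu> v w) = (\<Sum>\<tau>\<in>?P. \<Sum>\<rho>\<in>?P.
      complex_of_real (q ^ inversion_number n (\<rho> \<circ> inv \<tau>)) * word_inner \<nu> (perm_word \<tau> v) (perm_word \<rho> w))"
    by (rule sum.cong[OF refl])
  then have "of_nat (card ?P) * q_kernel q \<nu> v w = (\<Sum>\<tau>\<in>?P. \<Sum>\<rho>\<in>?P.
      complex_of_real (q ^ inversion_number n (\<rho> \<circ> inv \<tau>)) * word_inner \<nu> (perm_word \<tau> v) (perm_word \<rho> w))"
    by (simp only: sum_constant)
  also have "\<dots> = (\<Sum>\<tau>\<in>?P. \<Sum>\<rho>\<in>?P. \<Sum>T\<in>Pow (pairs n). complex_of_real (character_weight q n T) *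
      (complex_of_real (character T \<tau> * character T \<rho>) * word_inner \<nu> (perm_word \<tau> v) (perm_word \<rho> w)))"
    by (intro sum.cong refl) (simp add: inversion_kernel sum_distrib_right mult.assoc)
  also have "\<dots> = (\<Sum>T\<in>Pow (pairs n). complex_of_real (character_weight q n T) * (\<Sum>\<tau>\<in>?P. \<Sum>\<rho>\<in>?P.
      complex_of_real (character T \<tau> * character T \<rho>) * word_inner \<nu> (perm_word \<tau> v) (perm_word \<rho> w)))"
    unfolding sum_distrib_left sum.swap[of _ "Pow (pairs n)" ?P] ..
  finally have "q_kernel q \<nu> v w = (\<Sum>T\<in>Pow (pairs n). complex_of_real (character_weight q n T) * (\<Sum>\<tau>\<in>?P. \<Sum>\<rho>\<in>?P.
      complex_of_real (character T \<tau> * character T \<rho>) * word_inner \<nu> (perm_word \<tau> v) (perm_word \<rho> w))) / fact n"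
    by (simp add: card_permutations[of "{..<n}" n] field_simps)
  then show ?thesis
    by (simp add: sum_divide_distrib)
qed

locale q_levy = prob_space \<nu> for \<nu> :: "real measure" +
  fixes q :: real
  assumes q_gt: "- 1 < q" and q_lt: "q < 1"
    and sets_nu: "sets \<nu> = sets borel"
    and compact_support: "\<exists>K. compact K \<and> measure \<nu> K = 1"
begin

lemma space_nu [simp]: "space \<nu> = UNIV"
  using sets_eq_imp_space_eq[OF sets_nu] by simp

lemma sigma_finite_rplus: "sigma_finite_measure rplus"
  unfolding rplus_def by (rule sigma_finite_measure_restrict_space[OF sigma_finite_lborel]) simp

lemma sigma_finite_hmeas: "sigma_finite_measure (hmeas \<nu>)"
  unfolding hmeas_def by (intro sigma_finite_pair_measure sigma_finite_rplus) unfold_locales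

sublocale rp: product_sigma_finite "\<lambda>_ :: nat. rplus"
  by (simp add: product_sigma_finite_def sigma_finite_rplus)

sublocale hp: product_sigma_finite "\<lambda>_ :: nat. hmeas \<nu>"
  by (simp add: product_sigma_finite_def sigma_finite_hmeas)

definition hpow :: "nat \<Rightarrow> (nat \<Rightarrow> real \<times> real) measure"
  where "hpow n = PiM {..<n} (\<lambda>_. hmeas \<nu>)"

lemma word_inner_integral:
  assumes "length v = n" "length w = n" "set v \<subseteq> L2 (hmeas \<nu>)" "set w \<subseteq> L2 (hmeas \<nu>)"
  shows "integrable (hpow n) (\<lambda>z. cnj (word_fun v (map z [0..<n])) * word_fun w (map z [0..<n]))"
    and "word_inner \<nu> v w = (\<integral>z. cnj (word_fun v (map z [0..<n])) * word_fun w (map z [0..<n]) \<partial>hpow n)"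
proof -
  have eq: "cnj (word_fun v (map z [0..<n])) * word_fun w (map z [0..<n])
    = (\<Prod>i<n. cnj ((v ! i) (z i)) * (w ! i) (z i))" for z
    using assms by (simp add: word_fun_nth prod.distrib)
  have int: "integrable (hmeas \<nu>) (\<lambda>x. cnj ((v ! i) x) * (w ! i) x)" if "i \<in> {..<n}" for i
  proof -
    have "v ! i \<in> set v" "w ! i \<in> set w" using that assms by auto
    with assms show ?thesis by (intro L2_mult_integrable) auto
  qed
  show "integrable (hpow n) (\<lambda>z. cnj (word_fun v (map z [0..<n])) * word_fun w (map z [0..<n]))"
    unfolding eq hpow_def by (rule hp.product_integrable_prod) (use int in auto)
  show "word_inner \<nu> v w = (\<integral>z. cnj (word_fun v (map z [0..<n])) * word_fun w (map z [0..<n]) \<partial>hpow n)"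
    unfolding eq hpow_def by (subst hp.product_integral_prod) (use int assms in \<open>auto simp: word_inner_def L2_inner_def\<close>)
qed

text \<open>A symmetrization twisted by the signs of \<open>character T\<close>; for
  \<open>T = {}\<close> it is the plain sum over all permutations of the arguments.\<close>

definition component :: "nat \<Rightarrow> (nat \<times> nat) set \<Rightarrow> tens \<Rightarrow> (nat \<Rightarrow> real \<times> real) \<Rightarrow> complex"
  where "component n T f z = (\<Sum>\<tau> | \<tau> permutes {..<n}.
    complex_of_real (character T \<tau>) * tens_fun f (map (z \<circ> inv \<tau>) [0..<n]))"

definition word_component :: "nat \<Rightarrow> (nat \<times> nat) set \<Rightarrow> hvec list \<Rightarrow> (nat \<Rightarrow> real \<times> real) \<Rightarrow> complex"
  where "word_component n T w z = (\<Sum>\<tau> | \<tau> permutes {..<n}.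
    complex_of_real (character T \<tau>) * word_fun (perm_word \<tau> w) (map z [0..<n]))"

lemma component_eq: "component n T f z = lin_eval (\<lambda>w. word_component n T w z) f"
  by (simp add: component_def word_component_def tens_fun_def lin_eval_fun_sum lin_eval_fun_cmult
      word_fun_perm_word)

lemma word_component_length: "length w \<noteq> n \<Longrightarrow> word_component n T w z = 0"
  by (simp add: word_component_def word_fun_length)

lemma word_component_mult:
  assumes v: "set v \<subseteq> L2 (hmeas \<nu>)" and w: "set w \<subseteq> L2 (hmeas \<nu>)"
  shows "integrable (hpow n) (\<lambda>z. cnj (word_component n T v z) * word_component n T w z)"
    and "length v = n \<Longrightarrow> length w = n \<Longrightarrow>
      (\<integral>z. cnj (word_component n T v z) * word_component n T w z \<partial>hpow n)
      = (\<Sum>\<tau> | \<tau> permutes {..<n}. \<Sum>\<rho> | \<rho> permutes {..<n}.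
        complex_of_real (character T \<tau> * character T \<rho>) * word_inner \<nu> (perm_word \<tau> v) (perm_word \<rho> w))"
proof -
  have eq: "cnj (word_component n T v z) * word_component n T w z
    = (\<Sum>\<tau> | \<tau> permutes {..<n}. \<Sum>\<rho> | \<rho> permutes {..<n}.
        complex_of_real (character T \<tau> * character T \<rho>) *
        (cnj (word_fun (perm_word \<tau> v) (map z [0..<n])) * word_fun (perm_word \<rho> w) (map z [0..<n])))" for z
    unfolding word_component_def cnj_sum sum_product by (intro sum.cong refl) simp
  have L2: "set (perm_word \<tau> v) \<subseteq> L2 (hmeas \<nu>)" "set (perm_word \<tau> w) \<subseteq> L2 (hmeas \<nu>)"
    if "length v = n" "length w = n" "\<tau> \<in> {\<tau>. \<tau> permutes {..<n}}" for \<tau>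
    using that set_perm_word[of \<tau> v] set_perm_word[of \<tau> w] v w by auto
  show "integrable (hpow n) (\<lambda>z. cnj (word_component n T v z) * word_component n T w z)"
  proof (cases "length v = n \<and> length w = n")
    case True
    then show ?thesis
      unfolding eq
      by (intro Bochner_Integration.integrable_sum integrable_mult_right word_inner_integral(1) L2) auto
  next
    case False
    then have "(\<lambda>z. cnj (word_component n T v z) * word_component n T w z) = (\<lambda>z. 0)"
      by (auto simp: word_component_length)
    then show ?thesis by simp
  qed
  assume len: "length v = n" "length w = n"
  have int: "integrable (hpow n) (\<lambda>z. complex_of_real (character T \<tau> * character T \<rho>) *
        (cnj (word_fun (perm_word \<tau> v) (map z [0..<n])) * word_fun (perm_word \<rho> w) (map z [0..<n])))"
    if "\<tau> permutes {..<n}" "\<rho> permutes {..<n}" for \<tau> \<rho>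
    using that len by (intro integrable_mult_right word_inner_integral(1) L2) auto
  have "(\<integral>z. cnj (word_component n T v z) * word_component n T w z \<partial>hpow n)
    = (\<Sum>\<tau> | \<tau> permutes {..<n}. \<Sum>\<rho> | \<rho> permutes {..<n}.
        (\<integral>z. complex_of_real (character T \<tau> * character T \<rho>) *
        (cnj (word_fun (perm_word \<tau> v) (map z [0..<n])) * word_fun (perm_word \<rho> w) (map z [0..<n])) \<partial>hpow n))"
    unfolding eq using int
    by (subst Bochner_Integration.integral_sum, force intro!: Bochner_Integration.integrable_sum)
       (intro sum.cong refl, subst Bochner_Integration.integral_sum, auto)
  also have "\<dots> = (\<Sum>\<tau> | \<tau> permutes {..<n}. \<Sum>\<rho> | \<rho> permutes {..<n}.
        complex_of_real (character T \<tau> * character T \<rho>) * word_inner \<nu> (perm_word \<tau> v) (perm_word \<rho> w))"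
    using len L2
    by (intro sum.cong refl) (simp add: word_inner_integral(2)[where n = n])
  finally show "(\<integral>z. cnj (word_component n T v z) * word_component n T w z \<partial>hpow n)
      = (\<Sum>\<tau> | \<tau> permutes {..<n}. \<Sum>\<rho> | \<rho> permutes {..<n}.
        complex_of_real (character T \<tau> * character T \<rho>) * word_inner \<nu> (perm_word \<tau> v) (perm_word \<rho> w))" .
qed

lemma q_kernel_integral:
  assumes v: "set v \<subseteq> L2 (hmeas \<nu>)" and w: "set w \<subseteq> L2 (hmeas \<nu>)" and N: "length v < N"
  shows "q_kernel q \<nu> v w = (\<Sum>n<N. \<Sum>T\<in>Pow (pairs n). complex_of_real (character_weight q n T / fact n) *
    (\<integral>z. cnj (word_component n T v z) * word_component n T w z \<partial>hpow n))"
proof (cases "length v = length w")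
  case True
  define a where "a n = (\<Sum>T\<in>Pow (pairs n). complex_of_real (character_weight q n T / fact n) *
    (\<integral>z. cnj (word_component n T v z) * word_component n T w z \<partial>hpow n))" for n
  have "a n = 0" if "n \<noteq> length v" for n
    using that by (simp add: a_def word_component_length)
  then have "(\<Sum>n<N. a n) = a (length v)"
    using N by (subst sum.remove[of _ "length v"]) auto
  also have "\<dots> = q_kernel q \<nu> v w"
    using True v w by (simp add: a_def q_kernel_eq word_component_mult(2))
  finally show ?thesis by (simp add: a_def)
next
  case False
  then have "q_kernel q \<nu> v w = 0"
    by (simp add: q_kernel_def word_inner_def)
  moreover have "(\<lambda>z. cnj (word_component n T v z) * word_component n T w z) = (\<lambda>z. 0)" for n T
    using False by (cases "length v = n") (auto simp: word_component_length)
  ultimately show ?thesis by simp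
qed

lemma component_mult_integrable:
  assumes f: "f \<in> tens_carrier \<nu>" and g: "g \<in> tens_carrier \<nu>"
  shows "integrable (hpow n) (\<lambda>z. cnj (component n T f z) * component n T g z)"
proof -
  have "cnj (component n T f z) * component n T g z = (\<Sum>v\<in>Poly_Mapping.keys f. \<Sum>w\<in>Poly_Mapping.keys g.
    cnj (Poly_Mapping.lookup f v) * Poly_Mapping.lookup g w *
     (cnj (word_component n T v z) * word_component n T w z))" for z
    unfolding component_eq lin_eval_def cnj_sum sum_product by (intro sum.cong refl) simp
  then show ?thesis
    using f g by (auto intro!: Bochner_Integration.integrable_sum integrable_mult_right word_component_mult(1)
        simp: tens_carrier_def)
qed

text \<open>Positivity and independence of the representative are both read off from this formula:
  the weights are nonnegative, and a component depends on a vector only through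
  \<open>tens_fun\<close>. A bound on the degrees of \<open>f\<close> makes the sum finite, since
  components in degrees absent from \<open>f\<close> vanish.\<close>

lemma tens_inner_components:
  assumes f: "f \<in> tens_carrier \<nu>" and g: "g \<in> tens_carrier \<nu>"
    and N: "\<And>v. v \<in> Poly_Mapping.keys f \<Longrightarrow> length v < N"
  shows "tens_inner q \<nu> f g = (\<Sum>n<N. \<Sum>T\<in>Pow (pairs n). complex_of_real (character_weight q n T / fact n) *
    (\<integral>z. cnj (component n T f z) * component n T g z \<partial>hpow n))"
proof -
  let ?c = "\<lambda>n T. complex_of_real (character_weight q n T / fact n)"
  have fL: "set v \<subseteq> L2 (hmeas \<nu>)" if "v \<in> Poly_Mapping.keys f" for v
    using f that by (auto simp: tens_carrier_def)
  have gL: "set v \<subseteq> L2 (hmeas \<nu>)" if "v \<in> Poly_Mapping.keys g" for v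
    using g that by (auto simp: tens_carrier_def)
  have intg: "integrable (hpow n) (\<lambda>z. cnj (word_component n T v z) * component n T g z)"
    if "v \<in> Poly_Mapping.keys f" for n T v
    unfolding component_eq lin_eval_fun_cmult[symmetric]
    by (intro integrable_lin_eval word_component_mult(1) fL[OF that] gL)
  have eq: "lin_eval (q_kernel q \<nu> v) g = (\<Sum>n<N. \<Sum>T\<in>Pow (pairs n). ?c n T *
      (\<integral>z. cnj (word_component n T v z) * component n T g z \<partial>hpow n))"
    if v: "v \<in> Poly_Mapping.keys f" for v
  proof -
    have "lin_eval (q_kernel q \<nu> v) g = lin_eval (\<lambda>w. \<Sum>n<N. \<Sum>T\<in>Pow (pairs n). ?c n T *
      (\<integral>z. cnj (word_component n T v z) * word_component n T w z \<partial>hpow n)) g"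
      by (intro lin_eval_cong q_kernel_integral fL[OF v] gL N[OF v])
    also have "\<dots> = (\<Sum>n<N. \<Sum>T\<in>Pow (pairs n). ?c n T *
      (\<integral>z. cnj (word_component n T v z) * component n T g z \<partial>hpow n))"
      unfolding lin_eval_fun_sum lin_eval_fun_cmult component_eq
      by (intro sum.cong refl arg_cong2[where f = "(*)"], subst lin_eval_integral)
         (auto intro!: word_component_mult(1) fL[OF v] gL simp: lin_eval_fun_cmult)
    finally show ?thesis .
  qed
  have "tens_inner q \<nu> f g = (\<Sum>v \<in> Poly_Mapping.keys f. \<Sum>n<N. \<Sum>T\<in>Pow (pairs n).
      ?c n T * (cnj (Poly_Mapping.lookup f v) *
      (\<integral>z. cnj (word_component n T v z) * component n T g z \<partial>hpow n)))"
    unfolding tens_inner_kernel by (intro sum.cong refl) (simp add: eq sum_distrib_left mult_ac)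
  also have "\<dots> = (\<Sum>n<N. \<Sum>T\<in>Pow (pairs n). ?c n T * (\<Sum>v \<in> Poly_Mapping.keys f.
      (\<integral>z. cnj (Poly_Mapping.lookup f v) * (cnj (word_component n T v z) * component n T g z) \<partial>hpow n)))"
    by (subst sum.swap, intro sum.cong refl, subst sum.swap) (simp add: sum_distrib_left)
  also have "\<dots> = (\<Sum>n<N. \<Sum>T\<in>Pow (pairs n). ?c n T *
      (\<integral>z. cnj (component n T f z) * component n T g z \<partial>hpow n))"
  proof (intro sum.cong refl arg_cong2[where f = "(*)"])
    fix n T
    have "(\<Sum>v \<in> Poly_Mapping.keys f.
      (\<integral>z. cnj (Poly_Mapping.lookup f v) * (cnj (word_component n T v z) * component n T g z) \<partial>hpow n))
      = (\<integral>z. (\<Sum>v \<in> Poly_Mapping.keys f. cnj (Poly_Mapping.lookup f v) *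
          (cnj (word_component n T v z) * component n T g z)) \<partial>hpow n)"
      using intg by (subst Bochner_Integration.integral_sum) auto
    also have "\<dots> = (\<integral>z. cnj (component n T f z) * component n T g z \<partial>hpow n)"
      by (simp add: component_eq[of _ _ f] lin_eval_def sum_distrib_right mult.assoc)
    finally show "(\<Sum>v \<in> Poly_Mapping.keys f.
      (\<integral>z. cnj (Poly_Mapping.lookup f v) * (cnj (word_component n T v z) * component n T g z) \<partial>hpow n))
      = (\<integral>z. cnj (component n T f z) * component n T g z \<partial>hpow n)" .
  qed
  finally show ?thesis .
qed

end

section \<open>The Fock space as a seminormed space\<close>

lemma tens_inner_add_left: "tens_inner q \<nu> (f + g) h = tens_inner q \<nu> f h + tens_inner q \<nu> g h"
  and tens_inner_scale_left: "tens_inner q \<nu> (scale c f) h = cnj c * tens_inner q \<nu> f h"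
proof -
  have "tens_inner q \<nu> f h = cnj (lin_eval (\<lambda>v. cnj (lin_eval (q_kernel q \<nu> v) h)) f)" for f
    by (simp add: tens_inner_kernel lin_eval_def)
  then show "tens_inner q \<nu> (f + g) h = tens_inner q \<nu> f h + tens_inner q \<nu> g h"
    and "tens_inner q \<nu> (scale c f) h = cnj c * tens_inner q \<nu> f h"
    by (simp_all add: lin_eval_add lin_eval_scale)
qed

lemma tens_inner_add_right: "tens_inner q \<nu> h (f + g) = tens_inner q \<nu> h f + tens_inner q \<nu> h g"
  and tens_inner_scale_right: "tens_inner q \<nu> h (scale c f) = c * tens_inner q \<nu> h f"
  by (simp_all add: tens_inner_kernel lin_eval_add lin_eval_scale algebra_simps sum.distrib sum_distrib_left)

text \<open>Yields the Cauchy-Schwarz inequality for a form that may be degenerate. If the leading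
  coefficient vanishes, the polynomial is linear and bounded below, so its slope is 0.\<close>

lemma quadratic_nonneg_discriminant:
  fixes a b c :: real
  assumes c: "0 \<le> c" and "\<And>s. 0 \<le> a + s * b + s\<^sup>2 * c"
  shows "b\<^sup>2 \<le> 4 * a * c"
proof (cases "c = 0")
  case True
  have "b = 0"
  proof (rule ccontr)
    assume "b \<noteq> 0"
    \<comment> \<open>At this \<open>s\<close> the linear polynomial takes the value -1.\<close>
    then show False using assms(2)[of "- (a + 1) / b"] True by simp
  qed
  then show ?thesis using True by simp
next
  case False
  with c have "c > 0" by simp
  then show ?thesis
    using assms(2)[of "- b / (2 * c)"] by (simp add: field_simps power2_eq_square)
qed

context q_levy
begin

lemma tens_inner_self:
  assumes f: "f \<in> tens_carrier \<nu>"
  shows "0 \<le> tens_norm q \<nu> f" "tens_inner q \<nu> f f = complex_of_real ((tens_norm q \<nu> f)\<^sup>2)"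
proof -
  obtain N where N: "\<And>v. v \<in> Poly_Mapping.keys f \<Longrightarrow> length v < N"
  proof
    fix v assume "v \<in> Poly_Mapping.keys f"
    then show "length v < Suc (Max (length ` Poly_Mapping.keys f))"
      by (simp add: less_Suc_eq_le)
  qed
  define r where "r = (\<Sum>n<N. \<Sum>T\<in>Pow (pairs n). character_weight q n T / fact n *
    (\<integral>z. (cmod (component n T f z))\<^sup>2 \<partial>hpow n))"
  have "cnj (component n T f z) * component n T f z = complex_of_real ((cmod (component n T f z))\<^sup>2)" for n T z
    using complex_norm_square[of "component n T f z"] by (simp add: mult.commute)
  then have eq: "tens_inner q \<nu> f f = complex_of_real r"
    by (simp add: tens_inner_components[OF f f N] r_def flip: integral_complex_of_real)
  have "0 \<le> r"
    unfolding r_def using character_weight_nonneg[OF q_gt q_lt]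
    by (intro sum_nonneg mult_nonneg_nonneg divide_nonneg_nonneg) auto
  with eq show "0 \<le> tens_norm q \<nu> f" "tens_inner q \<nu> f f = complex_of_real ((tens_norm q \<nu> f)\<^sup>2)"
    by (simp_all add: tens_norm_def)
qed

lemma tens_norm_square: "f \<in> tens_carrier \<nu> \<Longrightarrow> (tens_norm q \<nu> f)\<^sup>2 = Re (tens_inner q \<nu> f f)"
  by (simp add: tens_inner_self(2))

lemma tens_norm_cong:
  assumes f: "f \<in> tens_carrier \<nu>" and g: "g \<in> tens_carrier \<nu>" and eq: "tens_eq f g"
  shows "tens_norm q \<nu> f = tens_norm q \<nu> g"
proof -
  define N where "N = Suc (Max (length ` (Poly_Mapping.keys f \<union> Poly_Mapping.keys g)))"
  have N: "length v < N" if "v \<in> Poly_Mapping.keys f \<union> Poly_Mapping.keys g" for v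
    using that unfolding N_def by (intro le_imp_less_Suc Max_ge) auto
  have "component n T f = component n T g" for n T
    using eq by (intro ext) (simp add: component_def tens_eq_def)
  then have "tens_inner q \<nu> f f = tens_inner q \<nu> g g"
    using N by (simp add: tens_inner_components[OF f f, of N] tens_inner_components[OF g g, of N])
  then show ?thesis by (simp add: tens_norm_def)
qed

lemma tens_norm_scale:
  assumes "f \<in> tens_carrier \<nu>"
  shows "tens_norm q \<nu> (scale c f) = cmod c * tens_norm q \<nu> f"
proof -
  have "tens_inner q \<nu> (scale c f) (scale c f) = complex_of_real ((cmod c * tens_norm q \<nu> f)\<^sup>2)"
    using complex_norm_square[of c]
    by (simp add: tens_inner_scale_left tens_inner_scale_right tens_inner_self(2)[OF assms]
        power_mult_distrib mult_ac)
  then show ?thesis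
    using tens_inner_self(1)[OF assms] by (simp add: tens_norm_def[of _ _ "scale c f"])
qed

lemma tens_norm_triangle:
  assumes f: "f \<in> tens_carrier \<nu>" and g: "g \<in> tens_carrier \<nu>"
  shows "tens_norm q \<nu> (f + g) \<le> tens_norm q \<nu> f + tens_norm q \<nu> g"
proof -
  \<comment> \<open>The cross term of a quadratic polynomial in a real variable; adding both orders
    is what expanding the form in its two arguments produces.\<close>
  define b where "b = Re (tens_inner q \<nu> f g + tens_inner q \<nu> g f)"
  have exp: "(tens_norm q \<nu> (f + scale (complex_of_real s) g))\<^sup>2
    = (tens_norm q \<nu> f)\<^sup>2 + s * b + s\<^sup>2 * (tens_norm q \<nu> g)\<^sup>2" for s
    unfolding tens_norm_square[OF f] tens_norm_square[OF g]
      tens_norm_square[OF tens_carrier_add[OF f tens_carrier_scale[OF g]]]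
    by (simp add: tens_inner_add_left tens_inner_add_right tens_inner_scale_left tens_inner_scale_right b_def power2_eq_square
        algebra_simps)
  have "0 \<le> (tens_norm q \<nu> f)\<^sup>2 + s * b + s\<^sup>2 * (tens_norm q \<nu> g)\<^sup>2" for s
    by (subst exp[symmetric]) (rule zero_le_power2)
  then have "b\<^sup>2 \<le> 4 * (tens_norm q \<nu> f)\<^sup>2 * (tens_norm q \<nu> g)\<^sup>2"
    by (rule quadratic_nonneg_discriminant[OF zero_le_power2])
  also have "\<dots> = (2 * tens_norm q \<nu> f * tens_norm q \<nu> g)\<^sup>2"
    by (simp add: power_mult_distrib)
  finally have "b \<le> 2 * tens_norm q \<nu> f * tens_norm q \<nu> g"
    by (rule power2_le_imp_le) (simp add: tens_inner_self(1) f g)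
  then have "(tens_norm q \<nu> (f + g))\<^sup>2 \<le> (tens_norm q \<nu> f + tens_norm q \<nu> g)\<^sup>2"
    using exp[of 1] by (simp add: power2_sum)
  then show ?thesis
    by (rule power2_le_imp_le) (simp add: tens_inner_self(1) f g)
qed

lemma tens_norm_zero [simp]: "tens_norm q \<nu> 0 = 0"
  by (simp add: tens_norm_def tens_inner_kernel)

lemma tens_norm_diff_commute:
  assumes "f \<in> tens_carrier \<nu>" "g \<in> tens_carrier \<nu>"
  shows "tens_norm q \<nu> (f - g) = tens_norm q \<nu> (g - f)"
  using tens_norm_scale[of "f - g" "- 1"] assms by (simp add: tens_carrier_diff)

lemma tens_norm_sum:
  assumes "\<And>i. i \<in> A \<Longrightarrow> f i \<in> tens_carrier \<nu>"
  shows "tens_norm q \<nu> (sum f A) \<le> (\<Sum>i\<in>A. tens_norm q \<nu> (f i))"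
  using assms
proof (induction A rule: infinite_finite_induct)
  case (insert x A)
  then have "tens_norm q \<nu> (f x + sum f A) \<le> tens_norm q \<nu> (f x) + tens_norm q \<nu> (sum f A)"
    by (intro tens_norm_triangle tens_carrier_sum) auto
  with insert show ?case by fastforce
qed auto

lemma tens_norm_sum_list:
  assumes "\<And>i. i \<in> set xs \<Longrightarrow> f i \<in> tens_carrier \<nu>"
  shows "tens_norm q \<nu> (\<Sum>i\<leftarrow>xs. f i) \<le> (\<Sum>i\<leftarrow>xs. tens_norm q \<nu> (f i))"
  using assms
proof (induction xs)
  case (Cons x xs)
  then have "tens_norm q \<nu> (f x + (\<Sum>i\<leftarrow>xs. f i)) \<le> tens_norm q \<nu> (f x) + tens_norm q \<nu> (\<Sum>i\<leftarrow>xs. f i)"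
    by (intro tens_norm_triangle tens_carrier_sum_list) auto
  with Cons show ?case by fastforce
qed auto

lemma tens_norm_reverse_triangle:
  assumes f: "f \<in> tens_carrier \<nu>" and g: "g \<in> tens_carrier \<nu>"
  shows "\<bar>tens_norm q \<nu> f - tens_norm q \<nu> g\<bar> \<le> tens_norm q \<nu> (f - g)"
  using tens_norm_triangle[OF tens_carrier_diff[OF f g] g] tens_norm_triangle[OF tens_carrier_diff[OF g f] f]
    tens_norm_diff_commute[OF f g] by simp

section \<open>Cauchy sequences as elements of the completion\<close>

lemma fockD: "u \<in> fock q \<nu> \<Longrightarrow> u m \<in> tens_carrier \<nu>"
  by (simp add: fock_def)

lemma fock_cauchy:
  "u \<in> fock q \<nu> \<Longrightarrow> 0 < e \<Longrightarrow> \<exists>M. \<forall>i\<ge>M. \<forall>j\<ge>M. tens_norm q \<nu> (u i - u j) < e"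
  by (simp add: fock_def)

text \<open>\<open>fock_inner\<close> is a \<open>lim\<close> and carries information only once
  convergence is known. The norms form a real Cauchy sequence by the reverse triangle inequality,
  and \<open>tens_inner_self\<close> identifies the diagonal inner products with their
  squares.\<close>

lemma fock_norm_tendsto:
  assumes u: "u \<in> fock q \<nu>"
  shows "(\<lambda>m. tens_norm q \<nu> (u m)) \<longlonglongrightarrow> fock_norm q \<nu> u"
proof -
  have "Cauchy (\<lambda>m. tens_norm q \<nu> (u m))"
  proof (rule CauchyI)
    fix e :: real assume "e > 0"
    with u obtain M where "\<forall>i\<ge>M. \<forall>j\<ge>M. tens_norm q \<nu> (u i - u j) < e"
      by (auto simp: fock_def)
    then show "\<exists>M. \<forall>i\<ge>M. \<forall>j\<ge>M. norm (tens_norm q \<nu> (u i) - tens_norm q \<nu> (u j)) < e"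
      using tens_norm_reverse_triangle[OF fockD[OF u] fockD[OF u]]
      by (intro exI[of _ M] allI impI) (metis real_norm_def le_less_trans)
  qed
  then obtain L where L: "(\<lambda>m. tens_norm q \<nu> (u m)) \<longlonglongrightarrow> L"
    using real_Cauchy_convergent convergent_def by blast
  have "L \<ge> 0"
    using tens_inner_self(1)[OF fockD[OF u]] by (intro LIMSEQ_le_const[OF L]) auto
  have "(\<lambda>m. tens_inner q \<nu> (u m) (u m)) \<longlonglongrightarrow> complex_of_real (L\<^sup>2)"
    unfolding tens_inner_self(2)[OF fockD[OF u]] by (intro tendsto_of_real tendsto_power L)
  then have "fock_norm q \<nu> u = L"
    using \<open>L \<ge> 0\<close> by (simp add: fock_norm_def fock_inner_def limI)
  with L show ?thesis by simp
qed

lemma fock_const: "f \<in> tens_carrier \<nu> \<Longrightarrow> (\<lambda>_. f) \<in> fock q \<nu>"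
  by (simp add: fock_def)

lemma fock_add:
  assumes u: "u \<in> fock q \<nu>" and v: "v \<in> fock q \<nu>"
  shows "(\<lambda>m. u m + v m) \<in> fock q \<nu>"
proof -
  have "\<exists>M. \<forall>i\<ge>M. \<forall>j\<ge>M. tens_norm q \<nu> (u i + v i - (u j + v j)) < e" if e: "e > 0" for e
  proof -
    obtain M1 M2 where M: "\<forall>i\<ge>M1. \<forall>j\<ge>M1. tens_norm q \<nu> (u i - u j) < e / 2"
      "\<forall>i\<ge>M2. \<forall>j\<ge>M2. tens_norm q \<nu> (v i - v j) < e / 2"
      using fock_cauchy[OF u, of "e / 2"] fock_cauchy[OF v, of "e / 2"] e by auto
    have "tens_norm q \<nu> (u i + v i - (u j + v j)) < e" if "i \<ge> max M1 M2" "j \<ge> max M1 M2" for i j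
    proof -
      have "tens_norm q \<nu> ((u i - u j) + (v i - v j)) \<le> tens_norm q \<nu> (u i - u j) + tens_norm q \<nu> (v i - v j)"
        by (intro tens_norm_triangle tens_carrier_diff fockD u v)
      also have "\<dots> < e / 2 + e / 2"
        using M that by (intro add_strict_mono) auto
      finally show ?thesis by (simp add: algebra_simps)
    qed
    then show ?thesis by blast
  qed
  then show ?thesis
    using u v by (auto simp: fock_def intro: tens_carrier_add)
qed

lemma fock_scale_fock:
  assumes u: "u \<in> fock q \<nu>"
  shows "fock_scale c u \<in> fock q \<nu>"
proof -
  have "\<exists>M. \<forall>i\<ge>M. \<forall>j\<ge>M. tens_norm q \<nu> (scale c (u i) - scale c (u j)) < e" if e: "e > 0" for e
  proof -
    \<comment> \<open>The added 1 keeps the divisor positive when \<open>c = 0\<close>.\<close>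
    obtain M where M: "\<forall>i\<ge>M. \<forall>j\<ge>M. tens_norm q \<nu> (u i - u j) < e / (cmod c + 1)"
      using fock_cauchy[OF u, of "e / (cmod c + 1)"] e by (auto simp: add_nonneg_pos)
    have "tens_norm q \<nu> (scale c (u i) - scale c (u j)) < e" if "i \<ge> M" "j \<ge> M" for i j
    proof -
      have "tens_norm q \<nu> (scale c (u i) - scale c (u j)) = cmod c * tens_norm q \<nu> (u i - u j)"
        using tens_norm_scale[OF tens_carrier_diff[OF fockD[OF u] fockD[OF u]]]
        by (simp add: formal.scale_right_diff_distrib)
      also have "\<dots> \<le> (cmod c + 1) * tens_norm q \<nu> (u i - u j)"
        by (intro mult_right_mono tens_inner_self(1) tens_carrier_diff fockD u) simp
      also have "\<dots> < (cmod c + 1) * (e / (cmod c + 1))"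
        using M that by (intro mult_strict_left_mono) (auto simp: add_nonneg_pos)
      also have "\<dots> = e"
      proof -
        have "cmod c + 1 \<noteq> 0" using norm_ge_zero[of c] by linarith
        then show ?thesis by simp
      qed
      finally show ?thesis .
    qed
    then show ?thesis by blast
  qed
  then show ?thesis
    using u by (auto simp: fock_def fock_scale_def intro: tens_carrier_scale)
qed

lemma fock_diff: "u \<in> fock q \<nu> \<Longrightarrow> v \<in> fock q \<nu> \<Longrightarrow> (\<lambda>m. u m - v m) \<in> fock q \<nu>"
  using fock_add[of u "fock_scale (- 1) v"] fock_scale_fock[of v "- 1"] by (simp add: fock_scale_def)

lemma sum_fvec_apply: "(\<Sum>i\<in>A. u i) m = (\<Sum>i\<in>A. (u i :: fvec) m)"
  by (induction A rule: infinite_finite_induct) auto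

lemma fock_sum: "(\<And>i. i \<in> A \<Longrightarrow> u i \<in> fock q \<nu>) \<Longrightarrow> sum u A \<in> fock q \<nu>"
proof (induction A rule: infinite_finite_induct)
  case (insert x A)
  then have "(\<lambda>m. u x m + sum u A m) \<in> fock q \<nu>" by (intro fock_add) auto
  with insert show ?case by (simp add: plus_fun_def)
qed (auto simp: zero_fun_def intro: fock_const)

lemma fock_dist_tendsto:
  assumes "u \<in> fock q \<nu>" "v \<in> fock q \<nu>"
  shows "(\<lambda>m. tens_norm q \<nu> (u m - v m)) \<longlonglongrightarrow> fock_dist q \<nu> u v"
  unfolding fock_dist_def by (rule fock_norm_tendsto[OF fock_diff[OF assms]])

lemma fock_dist_const:
  assumes "f \<in> tens_carrier \<nu>" "g \<in> tens_carrier \<nu>"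
  shows "fock_dist q \<nu> (\<lambda>_. f) (\<lambda>_. g) = tens_norm q \<nu> (f - g)"
  using fock_dist_tendsto[OF assms[THEN fock_const]] by (simp add: LIMSEQ_const_iff)

lemma fock_dist_nonneg: "u \<in> fock q \<nu> \<Longrightarrow> v \<in> fock q \<nu> \<Longrightarrow> 0 \<le> fock_dist q \<nu> u v"
  using tens_inner_self(1)
  by (intro LIMSEQ_le_const[OF fock_dist_tendsto]) (auto intro: tens_carrier_diff fockD)

lemma fock_dist_commute: "u \<in> fock q \<nu> \<Longrightarrow> v \<in> fock q \<nu> \<Longrightarrow> fock_dist q \<nu> u v = fock_dist q \<nu> v u"
  using fock_dist_tendsto[of u v] fock_dist_tendsto[of v u] tens_norm_diff_commute[OF fockD[of u] fockD[of v]]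
  by (simp add: LIMSEQ_unique)

lemma fock_dist_triangle:
  assumes "u \<in> fock q \<nu>" "v \<in> fock q \<nu>" "w \<in> fock q \<nu>"
  shows "fock_dist q \<nu> u w \<le> fock_dist q \<nu> u v + fock_dist q \<nu> v w"
proof (rule LIMSEQ_le[OF fock_dist_tendsto tendsto_add[OF fock_dist_tendsto fock_dist_tendsto]])
  show "\<exists>N. \<forall>m\<ge>N. tens_norm q \<nu> (u m - w m) \<le> tens_norm q \<nu> (u m - v m) + tens_norm q \<nu> (v m - w m)"
  proof (intro exI[of _ 0] allI impI)
    fix m
    have "tens_norm q \<nu> ((u m - v m) + (v m - w m)) \<le> tens_norm q \<nu> (u m - v m) + tens_norm q \<nu> (v m - w m)"
      by (intro tens_norm_triangle tens_carrier_diff fockD assms)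
    then show "tens_norm q \<nu> (u m - w m) \<le> tens_norm q \<nu> (u m - v m) + tens_norm q \<nu> (v m - w m)"
      by simp
  qed
qed (use assms in auto)

lemma fock_eq_sum_scale:
  assumes "\<And>i. i \<in> A \<Longrightarrow> fock_eq q \<nu> (u i) (v i)"
  shows "fock_eq q \<nu> (\<Sum>i\<in>A. fock_scale (c i) (u i)) (\<Sum>i\<in>A. fock_scale (c i) (v i))"
proof -
  have u: "\<And>i. i \<in> A \<Longrightarrow> u i \<in> fock q \<nu>" and v: "\<And>i. i \<in> A \<Longrightarrow> v i \<in> fock q \<nu>"
    and d: "\<And>i. i \<in> A \<Longrightarrow> fock_dist q \<nu> (u i) (v i) = 0"
    using assms by (auto simp: fock_eq_def)
  let ?U = "\<Sum>i\<in>A. fock_scale (c i) (u i)" and ?V = "\<Sum>i\<in>A. fock_scale (c i) (v i)"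
  have U: "?U \<in> fock q \<nu>" and V: "?V \<in> fock q \<nu>"
    using u v by (auto intro!: fock_sum fock_scale_fock)
  have C: "u i m - v i m \<in> tens_carrier \<nu>" if "i \<in> A" for i m
    using u v that by (intro tens_carrier_diff fockD) auto
  have "(\<lambda>m. tens_norm q \<nu> (u i m - v i m)) \<longlonglongrightarrow> 0" if "i \<in> A" for i
    using fock_dist_tendsto[OF u[OF that] v[OF that]] d[OF that] by simp
  then have "(\<lambda>m. \<Sum>i\<in>A. cmod (c i) * tens_norm q \<nu> (u i m - v i m)) \<longlonglongrightarrow> (\<Sum>i\<in>A. cmod (c i) * 0)"
    by (intro tendsto_sum tendsto_mult_left)
  moreover have "tens_norm q \<nu> (?U m - ?V m) \<le> (\<Sum>i\<in>A. cmod (c i) * tens_norm q \<nu> (u i m - v i m))" for m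
  proof -
    have "?U m - ?V m = (\<Sum>i\<in>A. scale (c i) (u i m - v i m))"
      by (simp add: sum_fvec_apply fock_scale_def formal.scale_right_diff_distrib sum_subtractf)
    also have "tens_norm q \<nu> \<dots> \<le> (\<Sum>i\<in>A. tens_norm q \<nu> (scale (c i) (u i m - v i m)))"
      by (intro tens_norm_sum tens_carrier_scale C)
    finally show ?thesis by (simp add: tens_norm_scale C)
  qed
  ultimately have "fock_dist q \<nu> ?U ?V \<le> 0"
    using LIMSEQ_le[OF fock_dist_tendsto[OF U V]] by fastforce
  then show ?thesis
    using fock_dist_nonneg[OF U V] U V by (simp add: fock_eq_def)
qed

text \<open>Serves two filters: simple functions approaching a box, where it pins down the vector
  chosen by \<open>SOME\<close>, and fine subdivisions, where it gives uniqueness of the stochastic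
  measure.\<close>

lemma fock_limit_unique:
  assumes F: "F \<noteq> bot" and u: "u \<in> fock q \<nu>" and v: "v \<in> fock q \<nu>"
    and s: "eventually (\<lambda>x. s x \<in> fock q \<nu>) F"
    and su: "((\<lambda>x. fock_dist q \<nu> (s x) u) \<longlongrightarrow> 0) F" and sv: "((\<lambda>x. fock_dist q \<nu> (s x) v) \<longlongrightarrow> 0) F"
  shows "fock_eq q \<nu> u v"
proof -
  have "((\<lambda>x. fock_dist q \<nu> (s x) u + fock_dist q \<nu> (s x) v) \<longlongrightarrow> 0) F"
    using tendsto_add[OF su sv] by simp
  moreover have "eventually (\<lambda>x. fock_dist q \<nu> u v \<le> fock_dist q \<nu> (s x) u + fock_dist q \<nu> (s x) v) F"
    using s
  proof eventually_elim
    case (elim x)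
    then show ?case
      using fock_dist_triangle[OF u elim v] fock_dist_commute[OF u elim] by simp
  qed
  ultimately have "fock_dist q \<nu> u v \<le> 0"
    using F by (intro tendsto_le[OF F _ tendsto_const])
  then show ?thesis
    using u v fock_dist_nonneg[OF u v] by (simp add: fock_eq_def)
qed

end

section \<open>Norm bounds for words of step functions\<close>

lemma tens_inner0_eq: "tens_inner0 \<nu> f g = cnj (lin_eval (\<lambda>v. cnj (lin_eval (word_inner \<nu> v) g)) f)"
  by (simp add: tens_inner0_def lin_eval_def sum_distrib_left mult.assoc)

text \<open>Wider than \<open>half_open\<close> so as to be closed under intersection: preservation
  intersects the intervals of the operator and of the letter, and the result may be empty.\<close>

definition bounded_borel :: "real set \<Rightarrow> bool"
  where "bounded_borel I \<longleftrightarrow> I \<in> sets borel \<and> bounded I \<and> I \<subseteq> {0..}"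

lemma bounded_borel_Int: "bounded_borel I \<Longrightarrow> bounded_borel J \<Longrightarrow> bounded_borel (I \<inter> J)"
  by (auto simp: bounded_borel_def intro: bounded_subset)

lemma bounded_borel_half_open: "half_open I \<Longrightarrow> bounded_borel I"
  by (auto simp: bounded_borel_def half_open_def intro: bounded_subset[OF bounded_closed_interval])

lemma bounded_borel_interval [simp]: "bounded_borel {0..<t}"
  by (auto simp: bounded_borel_def intro: bounded_subset[OF bounded_closed_interval])

lemma sets_rplus: "bounded_borel I \<Longrightarrow> I \<in> sets rplus"
  by (auto simp: bounded_borel_def rplus_def sets_restrict_space)

lemma emeasure_rplus: "bounded_borel I \<Longrightarrow> emeasure rplus I = emeasure lborel I"
  unfolding rplus_def by (rule emeasure_restrict_space) (auto simp: bounded_borel_def)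

lemma measure_rplus: "bounded_borel I \<Longrightarrow> measure rplus I = measure lborel I"
  by (simp add: measure_def emeasure_rplus)

lemma emeasure_rplus_finite: "bounded_borel I \<Longrightarrow> emeasure rplus I < \<infinity>"
  using emeasure_bounded_finite[of I] by (simp add: emeasure_rplus bounded_borel_def)

lemma integrable_indicator_rplus:
  assumes "bounded_borel I"
  shows "integrable rplus (indicator I :: real \<Rightarrow> complex)" "(\<integral>x. (indicator I x :: complex) \<partial>rplus) = measure rplus I"
proof -
  have eq: "(indicator I :: real \<Rightarrow> complex) = (\<lambda>x. complex_of_real (indicator I x))"
    by (auto simp: indicator_def)
  have "integrable rplus (indicator I :: real \<Rightarrow> real)"
    using emeasure_rplus_finite[OF assms] sets_rplus[OF assms] by (intro integrable_real_indicator) auto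
  then show "integrable rplus (indicator I :: real \<Rightarrow> complex)"
    unfolding eq by (rule integrable_of_real)
  show "(\<integral>x. (indicator I x :: complex) \<partial>rplus) = measure rplus I"
    unfolding eq integral_complex_of_real using sets.sets_into_space[OF sets_rplus[OF assms]]
    by (simp add: Int_absorb2)
qed

lemma cmod_square: "complex_of_real ((cmod z)\<^sup>2) = cnj z * z"
  using complex_norm_square[of z] by (simp add: mult.commute)

context q_levy
begin

section \<open>Moments and step letters\<close>

definition moment :: "nat \<Rightarrow> real"
  where "moment k = (\<integral>x. x ^ k \<partial>\<nu>)"

lemma measurable_power_nu [measurable]: "(\<lambda>x. x ^ k) \<in> borel_measurable \<nu>"
  by (subst measurable_cong_sets[OF sets_nu refl]) measurable

text \<open>On a compact set carrying all the mass every power is bounded, so all moments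
  exist.\<close>

lemma integrable_power: "integrable \<nu> (\<lambda>x. x ^ k)"
proof -
  obtain K where K: "compact K" "prob K = 1"
    using compact_support by auto
  have "K \<in> events"
    using K(1) by (simp add: sets_nu borel_compact)
  with K(2) have AE: "AE x in \<nu>. x \<in> K"
    using prob_eq_1 by blast
  obtain R where R: "\<And>x. x \<in> K \<Longrightarrow> \<bar>x\<bar> \<le> R"
    using compact_imp_bounded[OF K(1)] by (auto simp: bounded_iff)
  have "AE x in \<nu>. norm (x ^ k) \<le> R ^ k"
    using AE by eventually_elim (auto simp: power_abs intro!: power_mono R)
  then show ?thesis
    by (intro integrable_const_bound) auto
qed

interpretation pair: pair_sigma_finite rplus \<nu>
  unfolding pair_sigma_finite_def using sigma_finite_rplus by (auto intro: sigma_finite_measure_axioms)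

lemma ind_mono_integral:
  assumes I: "bounded_borel I"
  shows "integrable (hmeas \<nu>) (ind_mono I k)"
    and "(\<integral>z. ind_mono I k z \<partial>hmeas \<nu>) = complex_of_real (measure rplus I * moment k)"
proof -
  have [measurable]: "(\<lambda>z. indicator I (fst z) :: complex) \<in> borel_measurable (rplus \<Otimes>\<^sub>M \<nu>)"
    by (rule measurable_compose[OF measurable_fst borel_measurable_indicator[OF sets_rplus[OF I]]])
  have [measurable]: "(\<lambda>z. snd z ^ k) \<in> borel_measurable (rplus \<Otimes>\<^sub>M \<nu>)"
    by (rule measurable_compose[OF measurable_snd]) measurable
  have eq: "ind_mono I k = (\<lambda>z. indicator I (fst z) * complex_of_real (snd z ^ k))"
    by (auto simp: ind_mono_def)
  have m: "ind_mono I k \<in> borel_measurable (rplus \<Otimes>\<^sub>M \<nu>)"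
    unfolding eq by measurable
  have iI: "integrable rplus (indicator I :: real \<Rightarrow> real)"
    using emeasure_rplus_finite[OF I] sets_rplus[OF I] by (auto intro!: integrable_real_indicator)
  have int: "integrable \<nu> (\<lambda>x. complex_of_real (x ^ k))"
    by (intro integrable_of_real integrable_power)
  have norm_eq: "(\<integral>x. norm (ind_mono I k (s, x)) \<partial>\<nu>) = indicator I s * (\<integral>x. \<bar>x ^ k\<bar> \<partial>\<nu>)" for s
    by (simp add: ind_mono_def norm_mult norm_power power_abs indicator_def)
  show *: "integrable (hmeas \<nu>) (ind_mono I k)"
    unfolding hmeas_def
  proof (rule pair.Fubini_integrable[OF m])
    show "integrable rplus (\<lambda>s. \<integral>x. norm (ind_mono I k (s, x)) \<partial>\<nu>)"
      unfolding norm_eq using iI by simp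
    show "AE s in rplus. integrable \<nu> (\<lambda>x. ind_mono I k (s, x))"
      using int by (simp add: ind_mono_def)
  qed
  have "(\<integral>z. ind_mono I k z \<partial>hmeas \<nu>) = (\<integral>s. (\<integral>x. ind_mono I k (s, x) \<partial>\<nu>) \<partial>rplus)"
    unfolding hmeas_def using pair.integral_fst'[OF *[unfolded hmeas_def]] by simp
  also have "\<dots> = (\<integral>s. indicator I s * complex_of_real (moment k) \<partial>rplus)"
    using int by (simp add: ind_mono_def moment_def flip: integral_complex_of_real)
  also have "\<dots> = complex_of_real (measure rplus I * moment k)"
    using integrable_indicator_rplus[OF I] by simp
  finally show "(\<integral>z. ind_mono I k z \<partial>hmeas \<nu>) = complex_of_real (measure rplus I * moment k)" .
qed

lemma ind_mono_mult: "cnj (ind_mono I k z) * ind_mono J l z = ind_mono (I \<inter> J) (k + l) z"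
  by (cases z) (auto simp: ind_mono_def power_add indicator_def)

lemma ind_mono_L2:
  assumes I: "bounded_borel I"
  shows "ind_mono I k \<in> L2 (hmeas \<nu>)"
proof -
  have "complex_of_real ((cmod (ind_mono I k z))\<^sup>2) = ind_mono I (k + k) z" for z
    unfolding cmod_square using ind_mono_mult[of I k z I k] by simp
  then have "integrable (hmeas \<nu>) (\<lambda>z. complex_of_real ((cmod (ind_mono I k z))\<^sup>2))"
    using ind_mono_integral(1)[OF I, of "k + k"] by simp
  then show ?thesis
    using borel_measurable_integrable[OF ind_mono_integral(1)[OF I, of k]]
    by (simp add: L2_def complex_of_real_integrable_eq del: of_real_power)
qed

lemma L2_inner_ind_mono:
  assumes "bounded_borel I" "bounded_borel J"
  shows "L2_inner (hmeas \<nu>) (ind_mono I k) (ind_mono J l)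
    = complex_of_real (measure rplus (I \<inter> J) * moment (k + l))"
  using assms by (simp add: L2_inner_def ind_mono_mult ind_mono_integral(2) bounded_borel_Int)

text \<open>In effect the invariance of the product measure under permutation of coordinates,
  obtained by moving the permutation from the points to the words.\<close>

lemma permuted_tens_fun_integral:
  assumes f: "f \<in> tens_carrier \<nu>" and len: "\<And>w. w \<in> Poly_Mapping.keys f \<Longrightarrow> length w = n"
    and \<tau>: "\<tau> permutes {..<n}"
  shows "integrable (hpow n) (\<lambda>z. (cmod (tens_fun f (map (z \<circ> inv \<tau>) [0..<n])))\<^sup>2)"
    and "complex_of_real (\<integral>z. (cmod (tens_fun f (map (z \<circ> inv \<tau>) [0..<n])))\<^sup>2 \<partial>hpow n) = tens_inner0 \<nu> f f"
proof -
  let ?h = "\<lambda>v w z. cnj (word_fun (perm_word \<tau> v) (map z [0..<n])) * word_fun (perm_word \<tau> w) (map z [0..<n])"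
  have eq: "complex_of_real ((cmod (tens_fun f (map (z \<circ> inv \<tau>) [0..<n])))\<^sup>2)
    = (\<Sum>v\<in>Poly_Mapping.keys f. \<Sum>w\<in>Poly_Mapping.keys f.
        cnj (Poly_Mapping.lookup f v) * Poly_Mapping.lookup f w * ?h v w z)" for z
    unfolding cmod_square tens_fun_def lin_eval_def cnj_sum sum_product
    by (intro sum.cong refl) (simp add: word_fun_perm_word[OF \<tau>])
  have L: "set (perm_word \<tau> v) \<subseteq> L2 (hmeas \<nu>)" "length (perm_word \<tau> v) = n"
    if "v \<in> Poly_Mapping.keys f" for v
    using f that set_perm_word[of \<tau> v] \<tau> len[OF that] by (auto simp: tens_carrier_def)
  have int: "integrable (hpow n) (?h v w)" "(\<integral>z. ?h v w z \<partial>hpow n) = word_inner \<nu> v w"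
    if "v \<in> Poly_Mapping.keys f" "w \<in> Poly_Mapping.keys f" for v w
    using word_inner_integral[OF L(2)[OF that(1)] L(2)[OF that(2)] L(1)[OF that(1)] L(1)[OF that(2)]]
      word_inner_perm_word[OF \<tau> len[OF that(1)] len[OF that(2)]] by auto
  have "integrable (hpow n) (\<lambda>z. complex_of_real ((cmod (tens_fun f (map (z \<circ> inv \<tau>) [0..<n])))\<^sup>2))"
    unfolding eq by (intro Bochner_Integration.integrable_sum integrable_mult_right int)
  then show "integrable (hpow n) (\<lambda>z. (cmod (tens_fun f (map (z \<circ> inv \<tau>) [0..<n])))\<^sup>2)"
    by (simp only: complex_of_real_integrable_eq)
  have "complex_of_real (\<integral>z. (cmod (tens_fun f (map (z \<circ> inv \<tau>) [0..<n])))\<^sup>2 \<partial>hpow n)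
    = (\<Sum>v\<in>Poly_Mapping.keys f. \<Sum>w\<in>Poly_Mapping.keys f.
        (\<integral>z. cnj (Poly_Mapping.lookup f v) * Poly_Mapping.lookup f w * ?h v w z \<partial>hpow n))"
    unfolding integral_complex_of_real[symmetric] eq using int(1)
    by (subst Bochner_Integration.integral_sum, force intro!: Bochner_Integration.integrable_sum)
       (intro sum.cong refl, subst Bochner_Integration.integral_sum, auto)
  also have "\<dots> = tens_inner0 \<nu> f f"
    unfolding tens_inner0_def by (intro sum.cong refl) (simp add: int(2))
  finally show "complex_of_real (\<integral>z. (cmod (tens_fun f (map (z \<circ> inv \<tau>) [0..<n])))\<^sup>2 \<partial>hpow n) = tens_inner0 \<nu> f f" .
qed

lemma abs_character: "\<bar>character T \<tau>\<bar> = 1"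
  unfolding character_def abs_prod by (rule prod.neutral) (simp add: order_sign_def)

text \<open>The weights sum to 1, being those of independent choices with probabilities
  \<open>(1 - q) / 2\<close> and \<open>(1 + q) / 2\<close>, so this is the crude bound n! for the
  operator \<open>P\<close> on n-fold tensors.\<close>

definition q_bound :: "nat \<Rightarrow> real"
  where "q_bound n = fact n * (\<Sum>T\<in>Pow (pairs n). character_weight q n T)"

lemma q_bound_nonneg: "0 \<le> q_bound n"
  unfolding q_bound_def
  by (intro mult_nonneg_nonneg sum_nonneg character_weight_nonneg[OF q_gt q_lt]) auto

text \<open>A component is a signed sum of n! functions of equal \<open>L2\<close> norm, so
  Cauchy-Schwarz bounds its squared norm by (n!)^2 times that of \<open>f\<close>. The division by
  \<open>fact n\<close> in the decomposition leaves \<open>q_bound n\<close>.\<close>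

lemma tens_norm_le_tens_inner0:
  assumes f: "f \<in> tens_carrier \<nu>" and len: "\<And>w. w \<in> Poly_Mapping.keys f \<Longrightarrow> length w = n"
  shows "(tens_norm q \<nu> f)\<^sup>2 \<le> q_bound n * Re (tens_inner0 \<nu> f f)"
proof -
  let ?P = "{\<tau>. \<tau> permutes {..<n}}"
  let ?h = "\<lambda>\<tau> z. (cmod (tens_fun f (map (z \<circ> inv \<tau>) [0..<n])))\<^sup>2"
  have fin: "finite ?P" and card: "real (card ?P) = fact n"
    by (simp_all add: finite_permutations card_permutations[of "{..<n}" n])
  have int: "integrable (hpow n) (\<lambda>z. (cmod (component n T f z))\<^sup>2)" for T
  proof -
    have "integrable (hpow n) (\<lambda>z. complex_of_real ((cmod (component n T f z))\<^sup>2))"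
      unfolding cmod_square by (rule component_mult_integrable[OF f f])
    then show ?thesis by (simp only: complex_of_real_integrable_eq)
  qed
  have bound: "(\<integral>z. (cmod (component n T f z))\<^sup>2 \<partial>hpow n) \<le> fact n * fact n * Re (tens_inner0 \<nu> f f)" for T
  proof -
    have "(cmod (component n T f z))\<^sup>2 \<le> fact n * (\<Sum>\<tau>\<in>?P. ?h \<tau> z)" for z
    proof -
      have "cmod (component n T f z) \<le> (\<Sum>\<tau>\<in>?P. 1 * cmod (tens_fun f (map (z \<circ> inv \<tau>) [0..<n])))"
        unfolding component_def by (rule order_trans[OF norm_sum]) (simp add: norm_mult abs_character)
      then have "(cmod (component n T f z))\<^sup>2 \<le> (\<Sum>\<tau>\<in>?P. 1 * cmod (tens_fun f (map (z \<circ> inv \<tau>) [0..<n])))\<^sup>2"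
        by (rule power_mono) simp
      also have "\<dots> \<le> (\<Sum>\<tau>\<in>?P. 1\<^sup>2) * (\<Sum>\<tau>\<in>?P. ?h \<tau> z)"
        by (rule Cauchy_Schwarz_ineq_sum)
      finally show ?thesis by (simp add: card)
    qed
    then have "(\<integral>z. (cmod (component n T f z))\<^sup>2 \<partial>hpow n) \<le> (\<integral>z. fact n * (\<Sum>\<tau>\<in>?P. ?h \<tau> z) \<partial>hpow n)"
      using int permuted_tens_fun_integral(1)[OF f len]
      by (intro integral_mono integrable_mult_right Bochner_Integration.integrable_sum) auto
    also have "\<dots> = fact n * (\<Sum>\<tau>\<in>?P. (\<integral>z. ?h \<tau> z \<partial>hpow n))"
      using permuted_tens_fun_integral(1)[OF f len] by (subst Bochner_Integration.integral_sum[symmetric]) auto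
    also have "\<dots> = fact n * (\<Sum>\<tau>\<in>?P. Re (tens_inner0 \<nu> f f))"
      using permuted_tens_fun_integral(2)[OF f len]
      by (intro arg_cong2[where f = "(*)"] sum.cong refl) (metis Re_complex_of_real mem_Collect_eq)
    finally show ?thesis by (simp add: card)
  qed
  have "component m T f z = 0" if "m \<noteq> n" for m T z
    unfolding component_eq using that len by (subst lin_eval_cong[of _ _ "\<lambda>_. 0"]) (auto simp: word_component_length)
  then have "(\<Sum>T\<in>Pow (pairs m). complex_of_real (character_weight q m T / fact m) *
      (\<integral>z. cnj (component m T f z) * component m T f z \<partial>hpow m)) = 0" if "m < n" for m
    using that by simp
  then have "tens_inner q \<nu> f f = (\<Sum>T\<in>Pow (pairs n). complex_of_real (character_weight q n T / fact n) *
      (\<integral>z. cnj (component n T f z) * component n T f z \<partial>hpow n))"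
    using len by (subst tens_inner_components[OF f f, of "Suc n"]) auto
  also have "\<dots> = (\<Sum>T\<in>Pow (pairs n). complex_of_real (character_weight q n T / fact n) *
      complex_of_real (\<integral>z. (cmod (component n T f z))\<^sup>2 \<partial>hpow n))"
    unfolding integral_complex_of_real[symmetric] cmod_square ..
  also have "\<dots> = complex_of_real (\<Sum>T\<in>Pow (pairs n). character_weight q n T / fact n *
      (\<integral>z. (cmod (component n T f z))\<^sup>2 \<partial>hpow n))"
    by (simp del: of_real_power)
  finally have "(tens_norm q \<nu> f)\<^sup>2 = (\<Sum>T\<in>Pow (pairs n). character_weight q n T / fact n *
      (\<integral>z. (cmod (component n T f z))\<^sup>2 \<partial>hpow n))"
    unfolding tens_norm_square[OF f] by (simp only: Re_complex_of_real)
  also have "\<dots> \<le> (\<Sum>T\<in>Pow (pairs n). character_weight q n T / fact n * (fact n * fact n * Re (tens_inner0 \<nu> f f)))"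
    using bound character_weight_nonneg[OF q_gt q_lt]
    by (intro sum_mono mult_left_mono divide_nonneg_nonneg) auto
  also have "\<dots> = q_bound n * Re (tens_inner0 \<nu> f f)"
    by (simp add: q_bound_def sum_distrib_left sum_distrib_right mult_ac)
  finally show ?thesis .
qed

lemma box_ind_mult_integral:
  assumes "length Is = n" "length Js = n" "\<And>I. I \<in> set Is \<Longrightarrow> bounded_borel I" "\<And>J. J \<in> set Js \<Longrightarrow> bounded_borel J"
  shows "integrable (rplus_pow n) (\<lambda>x. cnj (box_ind Is x) * box_ind Js x)"
    and "(\<integral>x. cnj (box_ind Is x) * box_ind Js x \<partial>rplus_pow n)
      = complex_of_real (\<Prod>i<n. measure rplus (Is ! i \<inter> Js ! i))"
proof -
  have eq: "cnj (box_ind Is x) * box_ind Js x = (\<Prod>i<n. indicator (Is ! i \<inter> Js ! i) (x i))" for x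
    using assms(1,2)
    by (auto simp: box_ind_def prod.distrib[symmetric] indicator_def intro!: prod.cong)
  have b: "bounded_borel (Is ! i \<inter> Js ! i)" if "i < n" for i
    using assms that by (intro bounded_borel_Int) auto
  show "integrable (rplus_pow n) (\<lambda>x. cnj (box_ind Is x) * box_ind Js x)"
    unfolding eq rplus_pow_def
    by (rule rp.product_integrable_prod) (use b integrable_indicator_rplus in auto)
  show "(\<integral>x. cnj (box_ind Is x) * box_ind Js x \<partial>rplus_pow n)
      = complex_of_real (\<Prod>i<n. measure rplus (Is ! i \<inter> Js ! i))"
    unfolding eq rplus_pow_def
    by (subst rp.product_integral_prod) (use b integrable_indicator_rplus in auto)
qed

lemma box_sum_integral:
  assumes "finite A" "\<And>j. j \<in> A \<Longrightarrow> length (Is j) = n" "\<And>j I. j \<in> A \<Longrightarrow> I \<in> set (Is j) \<Longrightarrow> bounded_borel I"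
  shows "integrable (rplus_pow n) (\<lambda>x. (cmod (\<Sum>j\<in>A. c j * box_ind (Is j) x))\<^sup>2)"
    and "complex_of_real (\<integral>x. (cmod (\<Sum>j\<in>A. c j * box_ind (Is j) x))\<^sup>2 \<partial>rplus_pow n)
      = (\<Sum>j\<in>A. \<Sum>l\<in>A. cnj (c j) * c l * complex_of_real (\<Prod>i<n. measure rplus (Is j ! i \<inter> Is l ! i)))"
proof -
  let ?h = "\<lambda>j l x. cnj (box_ind (Is j) x) * box_ind (Is l) x"
  have eq: "complex_of_real ((cmod (\<Sum>j\<in>A. c j * box_ind (Is j) x))\<^sup>2)
    = (\<Sum>j\<in>A. \<Sum>l\<in>A. cnj (c j) * c l * ?h j l x)" for x
    unfolding cmod_square cnj_sum sum_product
    by (intro sum.cong refl) simp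
  have int: "integrable (rplus_pow n) (?h j l)"
    "(\<integral>x. ?h j l x \<partial>rplus_pow n) = complex_of_real (\<Prod>i<n. measure rplus (Is j ! i \<inter> Is l ! i))"
    if "j \<in> A" "l \<in> A" for j l
    using box_ind_mult_integral[of "Is j" n "Is l"] assms that by auto
  have "integrable (rplus_pow n) (\<lambda>x. complex_of_real ((cmod (\<Sum>j\<in>A. c j * box_ind (Is j) x))\<^sup>2))"
    unfolding eq by (intro Bochner_Integration.integrable_sum integrable_mult_right int)
  then show "integrable (rplus_pow n) (\<lambda>x. (cmod (\<Sum>j\<in>A. c j * box_ind (Is j) x))\<^sup>2)"
    by (simp only: complex_of_real_integrable_eq)
  have "complex_of_real (\<integral>x. (cmod (\<Sum>j\<in>A. c j * box_ind (Is j) x))\<^sup>2 \<partial>rplus_pow n)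
    = (\<Sum>j\<in>A. \<Sum>l\<in>A. (\<integral>x. cnj (c j) * c l * ?h j l x \<partial>rplus_pow n))"
    unfolding integral_complex_of_real[symmetric] eq using int(1)
    by (subst Bochner_Integration.integral_sum, force intro!: Bochner_Integration.integrable_sum)
       (intro sum.cong refl, subst Bochner_Integration.integral_sum, auto)
  also have "\<dots> = (\<Sum>j\<in>A. \<Sum>l\<in>A. cnj (c j) * c l * complex_of_real (\<Prod>i<n. measure rplus (Is j ! i \<inter> Is l ! i)))"
    by (intro sum.cong refl) (simp add: int(2) del: of_real_prod)
  finally show "complex_of_real (\<integral>x. (cmod (\<Sum>j\<in>A. c j * box_ind (Is j) x))\<^sup>2 \<partial>rplus_pow n)
      = (\<Sum>j\<in>A. \<Sum>l\<in>A. cnj (c j) * c l * complex_of_real (\<Prod>i<n. measure rplus (Is j ! i \<inter> Is l ! i)))" .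
qed

definition step_word :: "real set list \<Rightarrow> nat list \<Rightarrow> tens"
  where "step_word Is ks = Poly_Mapping.single (map2 ind_mono Is ks) 1"

lemma step_word_carrier:
  assumes "\<And>I. I \<in> set Is \<Longrightarrow> bounded_borel I"
  shows "step_word Is ks \<in> tens_carrier \<nu>"
  unfolding step_word_def using assms
  by (auto intro!: tens_carrier_single ind_mono_L2 assms dest: set_zip_leftD)

definition step_bound :: "nat list \<Rightarrow> real"
  where "step_bound ks = q_bound (length ks) * (\<Prod>i<length ks. moment (2 * ks ! i))"

lemma moment_even_nonneg: "0 \<le> moment (2 * k)"
  unfolding moment_def power_mult by (intro Bochner_Integration.integral_nonneg) simp

lemma step_bound_nonneg: "0 \<le> step_bound ks"
  unfolding step_bound_def by (intro mult_nonneg_nonneg q_bound_nonneg prod_nonneg) (auto simp: moment_even_nonneg)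

text \<open>The exponents \<open>ks\<close> are common to all words, so each inner product of two
  words splits into the measure of the intersection of two boxes and a constant product of even
  moments. What remains is the squared \<open>L2\<close> norm of the combination of box
  indicators.\<close>

lemma step_word_norm:
  assumes "finite A" "\<And>j. j \<in> A \<Longrightarrow> length (Is j) = length ks"
    and "\<And>j I. j \<in> A \<Longrightarrow> I \<in> set (Is j) \<Longrightarrow> bounded_borel I"
  shows "(tens_norm q \<nu> (\<Sum>j\<in>A. scale (c j) (step_word (Is j) ks)))\<^sup>2
    \<le> step_bound ks * (\<integral>x. (cmod (\<Sum>j\<in>A. c j * box_ind (Is j) x))\<^sup>2 \<partial>rplus_pow (length ks))"
proof -
  let ?f = "\<Sum>j\<in>A. scale (c j) (step_word (Is j) ks)" and ?n = "length ks"
  let ?w = "\<lambda>j. map2 ind_mono (Is j) ks"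
  have f: "?f \<in> tens_carrier \<nu>"
    using assms by (intro tens_carrier_sum tens_carrier_scale step_word_carrier) auto
  have len: "length w = ?n" if "w \<in> Poly_Mapping.keys ?f" for w
    using that keys_sum_subset[of "\<lambda>j. scale (c j) (step_word (Is j) ks)" A] assms
    by (fastforce simp: step_word_def split: if_splits)
  have inner: "word_inner \<nu> (?w j) (?w l) = complex_of_real (\<Prod>i<?n. measure rplus (Is j ! i \<inter> Is l ! i)) *
      complex_of_real (\<Prod>i<?n. moment (2 * ks ! i))" if "j \<in> A" "l \<in> A" for j l
    unfolding of_real_mult[symmetric] prod.distrib[symmetric] word_inner_def of_real_prod
    using that assms by (auto simp: L2_inner_ind_mono mult_2 intro!: prod.cong)
  have "tens_inner0 \<nu> ?f ?f = (\<Sum>j\<in>A. \<Sum>l\<in>A. cnj (c j) * c l * word_inner \<nu> (?w j) (?w l))"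
    by (simp add: tens_inner0_eq lin_eval_sum lin_eval_scale step_word_def sum_distrib_left mult.assoc)
  also have "\<dots> = (\<Sum>j\<in>A. \<Sum>l\<in>A. cnj (c j) * c l * complex_of_real (\<Prod>i<?n. measure rplus (Is j ! i \<inter> Is l ! i)))
      * complex_of_real (\<Prod>i<?n. moment (2 * ks ! i))"
    unfolding sum_distrib_right by (intro sum.cong refl) (simp add: inner del: of_real_prod)
  also have "\<dots> = complex_of_real ((\<integral>x. (cmod (\<Sum>j\<in>A. c j * box_ind (Is j) x))\<^sup>2 \<partial>rplus_pow ?n)
      * (\<Prod>i<?n. moment (2 * ks ! i)))"
    by (simp only: box_sum_integral(2)[OF assms] of_real_mult)
  finally have "Re (tens_inner0 \<nu> ?f ?f) = (\<integral>x. (cmod (\<Sum>j\<in>A. c j * box_ind (Is j) x))\<^sup>2 \<partial>rplus_pow ?n)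
      * (\<Prod>i<?n. moment (2 * ks ! i))"
    by (simp only: Re_complex_of_real)
  with tens_norm_le_tens_inner0[OF f len] show ?thesis
    by (simp add: step_bound_def mult_ac)
qed

end

section \<open>Sums over the boxes of a subdivision\<close>

text \<open>One occurrence of each element of \<open>B\<close> is kept and every other factor is at
  most \<open>T\<close>; \<open>1 \<le> T\<close> pads the exponent to the full length.\<close>

lemma prod_list_le_prod_subset:
  fixes h :: "'a \<Rightarrow> real"
  assumes "1 \<le> T" "\<And>x. x \<in> set xs \<Longrightarrow> 0 \<le> h x" "\<And>x. x \<in> set xs \<Longrightarrow> h x \<le> T" "B \<subseteq> set xs"
  shows "(\<Prod>x\<leftarrow>xs. h x) \<le> T ^ length xs * (\<Prod>x\<in>B. h x)"
  using assms
proof (induction xs arbitrary: B)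
  case (Cons a xs)
  have fin: "finite B" using Cons.prems(4) finite_subset by blast
  have IH: "(\<Prod>x\<leftarrow>xs. h x) \<le> T ^ length xs * (\<Prod>x\<in>B - {a}. h x)"
    using Cons.prems by (intro Cons.IH) auto
  have nn: "0 \<le> (\<Prod>x\<in>B - {a}. h x)" and nl: "0 \<le> (\<Prod>x\<leftarrow>xs. h x)"
    using Cons.prems by (auto intro!: prod_nonneg prod_list_nonneg)
  have ha: "0 \<le> h a" "h a \<le> T" using Cons.prems by auto
  show ?case
  proof (cases "a \<in> B")
    case True
    have "h a * (\<Prod>x\<leftarrow>xs. h x) \<le> h a * (T ^ length xs * (\<Prod>x\<in>B - {a}. h x))"
      using IH ha by (intro mult_left_mono)
    also have "\<dots> = T ^ length xs * (\<Prod>x\<in>B. h x)"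
      using True fin by (simp add: prod.remove[of B a] mult_ac)
    also have "\<dots> \<le> T * (T ^ length xs * (\<Prod>x\<in>B. h x))"
    proof -
      have "0 \<le> (\<Prod>x\<in>B. h x)" using Cons.prems by (intro prod_nonneg) auto
      then show ?thesis
        using mult_right_mono[of 1 T "T ^ length xs * (\<Prod>x\<in>B. h x)"] Cons.prems(1) by simp
    qed
    finally show ?thesis by (simp add: mult_ac)
  next
    case False
    then have "B - {a} = B" by auto
    then have "h a * (\<Prod>x\<leftarrow>xs. h x) \<le> T * (T ^ length xs * (\<Prod>x\<in>B. h x))"
      using IH ha nl Cons.prems(1) by (intro mult_mono) auto
    then show ?thesis by (simp add: mult_ac)
  qed
qed simp

text \<open>One repeated factor is bounded by the small number \<open>d\<close> and the other
  surplus factors by \<open>T\<close>, which leaves one factor for each element of the set.\<close>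

lemma prod_list_not_distinct_le:
  fixes h :: "'a \<Rightarrow> real"
  assumes "1 \<le> T" "\<And>x. x \<in> set xs \<Longrightarrow> 0 \<le> h x" "\<And>x. x \<in> set xs \<Longrightarrow> h x \<le> T"
    and "\<And>x. x \<in> set xs \<Longrightarrow> h x \<le> d" and "\<not> distinct xs" "0 \<le> d"
  shows "(\<Prod>x\<leftarrow>xs. h x) \<le> d * T ^ length xs * (\<Prod>x\<in>set xs. h x)"
  using assms
proof (induction xs)
  case (Cons a xs)
  have nn: "0 \<le> (\<Prod>x\<in>set xs. h x)" and nl: "0 \<le> (\<Prod>x\<leftarrow>xs. h x)"
    using Cons.prems by (auto intro!: prod_nonneg prod_list_nonneg)
  have ha: "0 \<le> h a" "h a \<le> T" "h a \<le> d" using Cons.prems by auto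
  show ?case
  proof (cases "a \<in> set xs")
    case True
    have "(\<Prod>x\<leftarrow>xs. h x) \<le> T ^ length xs * (\<Prod>x\<in>set xs. h x)"
      using Cons.prems by (intro prod_list_le_prod_subset) auto
    then have "h a * (\<Prod>x\<leftarrow>xs. h x) \<le> d * (T ^ length xs * (\<Prod>x\<in>set xs. h x))"
      using ha nl Cons.prems by (intro mult_mono) auto
    also have "\<dots> \<le> T * (d * (T ^ length xs * (\<Prod>x\<in>set xs. h x)))"
      using mult_right_mono[of 1 T "d * (T ^ length xs * (\<Prod>x\<in>set xs. h x))"] Cons.prems nn
      by (auto intro!: mult_nonneg_nonneg)
    finally show ?thesis using True by (simp add: mult_ac insert_absorb)
  next
    case False
    have "(\<Prod>x\<leftarrow>xs. h x) \<le> d * T ^ length xs * (\<Prod>x\<in>set xs. h x)"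
      using Cons.prems False by (intro Cons.IH) auto
    then have "h a * (\<Prod>x\<leftarrow>xs. h x) \<le> h a * (d * T ^ length xs * (\<Prod>x\<in>set xs. h x))"
      using ha by (intro mult_left_mono)
    also have "\<dots> \<le> T * (h a * (d * T ^ length xs * (\<Prod>x\<in>set xs. h x)))"
      using mult_right_mono[of 1 T "h a * (d * T ^ length xs * (\<Prod>x\<in>set xs. h x))"] Cons.prems nn ha
      by (auto intro!: mult_nonneg_nonneg)
    finally show ?thesis using False by (simp add: mult_ac)
  qed
qed simp

lemma sum_UNION_le:
  fixes f :: "'a \<Rightarrow> real"
  assumes "finite I" "\<And>i. i \<in> I \<Longrightarrow> finite (C i)" "\<And>i x. i \<in> I \<Longrightarrow> x \<in> C i \<Longrightarrow> 0 \<le> f x"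
  shows "(\<Sum>x\<in>(\<Union>i\<in>I. C i). f x) \<le> (\<Sum>i\<in>I. \<Sum>x\<in>C i. f x)"
  using assms
proof (induction I rule: finite_induct)
  case (insert i I)
  let ?V = "\<Union>i\<in>I. C i"
  have "sum f (C i \<union> ?V) + sum f (C i \<inter> ?V) = sum f (C i) + sum f ?V"
    using insert by (intro sum.union_inter) auto
  moreover have "0 \<le> sum f (C i \<inter> ?V)"
    using insert.prems by (intro sum_nonneg) auto
  moreover have "sum f ?V \<le> (\<Sum>i\<in>I. \<Sum>x\<in>C i. f x)"
    using insert by auto
  ultimately show ?case using insert.hyps by simp
qed simp

text \<open>A non-injective map satisfies \<open>u a = u b\<close> for some pair of distinct points.
  The factor of \<open>a\<close> is at most \<open>d\<close>, the remaining product summed over maps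
  on \<open>A - {a}\<close> gives at most \<open>T ^ card A\<close>, and there are at most
  \<open>card A * card A\<close> pairs.\<close>

lemma sum_not_inj_le:
  fixes h :: "nat \<Rightarrow> real"
  assumes A: "finite A" and h: "\<And>j. j < N \<Longrightarrow> 0 \<le> h j" "\<And>j. j < N \<Longrightarrow> h j \<le> d"
    and sum: "(\<Sum>j<N. h j) \<le> T" and T: "1 \<le> T" and d: "0 \<le> d"
  shows "(\<Sum>u\<in>{u \<in> A \<rightarrow>\<^sub>E {..<N}. \<not> inj_on u A}. \<Prod>a\<in>A. h (u a)) \<le> d * (real (card A))\<^sup>2 * T ^ card A"
proof -
  let ?E = "A \<rightarrow>\<^sub>E {..<N}"
  let ?C = "\<lambda>p. {u \<in> ?E. u (fst p) = u (snd p)}"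
  have finE: "finite ?E" using A by (intro finite_PiE) auto
  have bound: "(\<Sum>u\<in>?C (a, b). \<Prod>a\<in>A. h (u a)) \<le> d * T ^ card A" if ab: "a \<in> A" "b \<in> A" "a \<noteq> b" for a b
  proof -
    let ?r = "\<lambda>u. restrict u (A - {a})"
    \<comment> \<open>The value at \<open>a\<close> is recovered from the value at
      \<open>b\<close>.\<close>
    have inj: "inj_on ?r (?C (a, b))"
    proof (rule inj_onI)
      fix u v assume u: "u \<in> ?C (a, b)" and v: "v \<in> ?C (a, b)" and eq: "?r u = ?r v"
      have *: "u x = v x" if "x \<in> A - {a}" for x
        using fun_cong[OF eq, of x] that by simp
      have "u x = v x" if "x \<in> A" for x
        using *[of x] *[of b] ab u v that by (cases "x = a") auto
      then show "u = v"
        using u v by (auto intro: PiE_ext)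
    qed
    have "(\<Sum>u\<in>?C (a, b). \<Prod>a\<in>A. h (u a)) \<le> (\<Sum>u\<in>?C (a, b). d * (\<Prod>x\<in>A - {a}. h (?r u x)))"
    proof (rule sum_mono)
      fix u assume u: "u \<in> ?C (a, b)"
      then have lt: "u x < N" if "x \<in> A" for x using that by (auto dest: PiE_mem)
      have "(\<Prod>x\<in>A. h (u x)) = h (u a) * (\<Prod>x\<in>A - {a}. h (u x))"
        using A ab by (simp add: prod.remove)
      also have "\<dots> \<le> d * (\<Prod>x\<in>A - {a}. h (u x))"
        using lt ab by (intro mult_right_mono h prod_nonneg) auto
      finally show "(\<Prod>x\<in>A. h (u x)) \<le> d * (\<Prod>x\<in>A - {a}. h (?r u x))" by simp
    qed
    also have "\<dots> = (\<Sum>v\<in>?r ` ?C (a, b). d * (\<Prod>x\<in>A - {a}. h (v x)))"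
      by (subst sum.reindex[OF inj]) simp
    also have "\<dots> \<le> (\<Sum>v\<in>(A - {a}) \<rightarrow>\<^sub>E {..<N}. d * (\<Prod>x\<in>A - {a}. h (v x)))"
    proof (intro sum_mono2 mult_nonneg_nonneg prod_nonneg)
      show "?r ` ?C (a, b) \<subseteq> (A - {a}) \<rightarrow>\<^sub>E {..<N}"
        by (rule image_subsetI) (auto simp: restrict_PiE_iff dest: PiE_mem)
    qed (use A d in \<open>auto intro!: h(1) finite_PiE dest: PiE_mem\<close>)
    also have "\<dots> = d * (\<Prod>x\<in>A - {a}. \<Sum>j<N. h j)"
      using A by (subst prod_sum_PiE) (auto simp: sum_distrib_left)
    also have "\<dots> \<le> d * T ^ card A"
    proof (rule mult_left_mono[OF _ d])
      have "(\<Prod>x\<in>A - {a}. \<Sum>j<N. h j) \<le> (\<Prod>x\<in>A - {a}. T)"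
        using sum h(1) by (intro prod_mono) (auto intro!: sum_nonneg)
      also have "\<dots> \<le> T ^ card A"
        using T A by (auto intro!: power_increasing card_mono)
      finally show "(\<Prod>x\<in>A - {a}. \<Sum>j<N. h j) \<le> T ^ card A" .
    qed
    finally show ?thesis .
  qed
  have nn: "0 \<le> (\<Prod>a\<in>A. h (u a))" if "u \<in> ?E" for u
    using that by (intro prod_nonneg h) (auto dest: PiE_mem)
  let ?D = "{p \<in> A \<times> A. fst p \<noteq> snd p}"
  have finD: "finite ?D" using A by auto
  have "(\<Sum>u\<in>{u \<in> ?E. \<not> inj_on u A}. \<Prod>a\<in>A. h (u a)) \<le> (\<Sum>u\<in>(\<Union>p\<in>?D. ?C p). \<Prod>a\<in>A. h (u a))"
    using finE finD nn by (intro sum_mono2) (auto simp: inj_on_def)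
  also have "\<dots> \<le> (\<Sum>p\<in>?D. \<Sum>u\<in>?C p. \<Prod>a\<in>A. h (u a))"
    using finE finD nn by (intro sum_UNION_le) auto
  also have "\<dots> \<le> (\<Sum>p\<in>?D. d * T ^ card A)"
    using bound by (intro sum_mono) auto
  also have "\<dots> \<le> (\<Sum>p\<in>A \<times> A. d * T ^ card A)"
    using A d T by (intro sum_mono2) auto
  also have "\<dots> = d * (real (card A))\<^sup>2 * T ^ card A"
    by (simp add: card_cartesian_product power2_eq_square)
  finally show ?thesis .
qed

section \<open>Subdivisions of the time interval\<close>

lemma subdivision_half_open: "subdivision t Is \<Longrightarrow> j < length Is \<Longrightarrow> half_open (Is ! j)"
  by (simp add: subdivision_def)

lemma subdivision_bounded_borel: "subdivision t Is \<Longrightarrow> j < length Is \<Longrightarrow> bounded_borel (Is ! j)"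
  by (simp add: subdivision_half_open bounded_borel_half_open)

lemma subdivision_sum_indicator:
  assumes "subdivision t Is"
  shows "(\<Sum>j<length Is. indicator (Is ! j) x) = (indicator {0..<t} x :: 'a :: semiring_1)"
proof (cases "x \<in> {0..<t}")
  case True
  then have "x \<in> \<Union> (set Is)"
    using assms by (simp add: subdivision_def)
  then obtain j where j: "j < length Is" "x \<in> Is ! j"
    by (metis UnionE in_set_conv_nth)
  have "x \<notin> Is ! i" if "i < length Is" "i \<noteq> j" for i
    using assms j that by (auto simp: subdivision_def)
  then have "(\<Sum>i<length Is. indicator (Is ! i) x :: 'a) = (\<Sum>i<length Is. if i = j then 1 else 0)"
    using j(2) by (intro sum.cong) auto
  then show ?thesis using True j(1) by simp
next
  case False
  then have "x \<notin> Is ! j" if "j < length Is" for j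
    using assms that nth_mem[OF that] unfolding subdivision_def by blast
  then show ?thesis using False by simp
qed

lemma subdivision_sum_measure:
  assumes "subdivision t Is" "0 \<le> t"
  shows "(\<Sum>j<length Is. measure rplus (Is ! j)) = t"
proof -
  have sub: "Is ! j \<in> lmeasurable" if "j < length Is" for j
    using subdivision_bounded_borel[OF assms(1) that]
    by (auto simp: bounded_borel_def intro: bounded_set_imp_lmeasurable)
  have "(\<Sum>j<length Is. measure rplus (Is ! j)) = (\<Sum>j<length Is. measure lebesgue (Is ! j))"
    using subdivision_bounded_borel[OF assms(1)]
    by (intro sum.cong refl) (simp add: measure_rplus measure_completion bounded_borel_def)
  also have "\<dots> = measure lebesgue (\<Union>j<length Is. Is ! j)"
    using assms(1) sub by (intro measure_UNION'[symmetric]) (auto simp: pairwise_def disjnt_def subdivision_def)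
  also have "(\<Union>j<length Is. Is ! j) = \<Union> (set Is)"
  proof -
    have "set Is = (\<lambda>j. Is ! j) ` {..<length Is}" by (auto simp: set_conv_nth)
    then show ?thesis by simp
  qed
  also have "\<Union> (set Is) = {0..<t}"
    using assms(1) by (simp add: subdivision_def)
  also have "measure lebesgue {0..<t} = t"
    using assms(2) by (simp add: measure_completion)
  finally show ?thesis .
qed

lemma subdivision_measure_mesh: "j < length Is \<Longrightarrow> bounded_borel (Is ! j) \<Longrightarrow> measure rplus (Is ! j) \<le> mesh Is"
  by (simp add: mesh_def measure_rplus)

text \<open>Makes the filter of fine subdivisions proper, so that limits along it are unique. The
  witness is the division into more than \<open>t / d\<close> equal cells.\<close>

lemma subdivision_exists:
  assumes t: "0 < t" and d: "0 < d"
  shows "\<exists>Is. subdivision t Is \<and> mesh Is < d"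
proof -
  obtain N :: nat where N: "t / d < real N" using reals_Archimedean2 by blast
  then have N0: "0 < real N" using t d by (meson divide_pos_pos order.strict_trans)
  define a where "a i = real i * t / real N" for i
  define Is where "Is = map (\<lambda>i. {a i..<a (Suc i)}) [0..<N]"
  have mono: "a i < a j \<longleftrightarrow> i < j" "a i \<le> a j \<longleftrightarrow> i \<le> j" for i j
    using t N0 by (auto simp: a_def divide_less_cancel divide_le_cancel)
  have a0: "a 0 = 0" "a N = t" using N0 by (auto simp: a_def)
  have disj: "{a i..<a (Suc i)} \<inter> {a j..<a (Suc j)} = {}" if "i \<noteq> j" for i j
  proof (rule ccontr)
    assume "\<not> ?thesis"
    then obtain x where "x \<in> {a i..<a (Suc i)} \<inter> {a j..<a (Suc j)}" by blast
    then have "a i \<le> x" "x < a (Suc i)" "a j \<le> x" "x < a (Suc j)" by auto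
    then have "a i < a (Suc j)" "a j < a (Suc i)" by linarith+
    then show False using that by (simp add: mono)
  qed
  have "\<exists>i<N. x \<in> {a i..<a (Suc i)}" if x: "x \<in> {0..<t}" for x
  proof -
    define i where "i = nat \<lfloor>x * real N / t\<rfloor>"
    have nn: "0 \<le> x * real N / t" using x t by simp
    have i: "real i \<le> x * real N / t" "x * real N / t < real i + 1"
      using nn unfolding i_def by linarith+
    have "a i \<le> x" "x < a (Suc i)"
      using i t N0 by (simp_all add: a_def field_simps)
    moreover have "i < N"
      using \<open>a i \<le> x\<close> x mono(1)[of i N] by (simp add: a0)
    ultimately show ?thesis by auto
  qed
  moreover have "x \<in> {0..<t}" if "i < N" "x \<in> {a i..<a (Suc i)}" for i x
    using that mono(2)[of 0 i] mono(2)[of "Suc i" N] by (auto simp: a0)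
  ultimately have Un: "\<Union> (set Is) = {0..<t}"
    by (fastforce simp: Is_def)
  have ho: "half_open {a i..<a (Suc i)}" for i
    unfolding half_open_def using mono(2)[of 0 i] mono(1)[of i "Suc i"] by (metis a0(1) le0 lessI)
  have "subdivision t Is"
    unfolding subdivision_def using Un ho disj by (auto simp: Is_def)
  moreover have "mesh Is < d"
  proof -
    have "Is \<noteq> []" using N0 by (simp add: Is_def)
    moreover have "measure lborel I < d" if "I \<in> set Is" for I
    proof -
      from that obtain i where "I = {a i..<a (Suc i)}" by (auto simp: Is_def)
      then have "measure lborel I = t / real N"
        using mono(2)[of i "Suc i"] by (simp add: a_def algebra_simps add_divide_distrib)
      also have "\<dots> < d" using N N0 d by (simp add: field_simps)
      finally show ?thesis .
    qed
    ultimately show ?thesis by (simp add: mesh_def)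
  qed
  ultimately show ?thesis by blast
qed

lemma eventually_fine_subdivisions:
  assumes "0 < d" "\<And>Is. subdivision t Is \<Longrightarrow> mesh Is < d \<Longrightarrow> P Is"
  shows "eventually P (fine_subdivisions t)"
  unfolding fine_subdivisions_def using assms
  by (intro eventually_INF1[of d]) (auto simp: eventually_principal)

lemma fine_subdivisions_nonempty:
  assumes "eventually P (fine_subdivisions t)" "0 < t"
  shows "\<exists>Is. subdivision t Is \<and> P Is"
proof -
  have "\<exists>d\<in>{0<..}. eventually P (principal {Is. subdivision t Is \<and> mesh Is < d})"
    using assms(1) unfolding fine_subdivisions_def
  proof (subst (asm) eventually_INF_base)
    show "{0 :: real <..} \<noteq> {}" by auto
    fix a b :: real assume "a \<in> {0<..}" "b \<in> {0<..}"
    then show "\<exists>x\<in>{0<..}. principal {Is. subdivision t Is \<and> mesh Is < x}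
      \<le> principal {Is. subdivision t Is \<and> mesh Is < a} \<sqinter> principal {Is. subdivision t Is \<and> mesh Is < b}"
      by (intro bexI[of _ "min a b"]) auto
  qed auto
  then show ?thesis
    using subdivision_exists[OF assms(2)] by (auto simp: eventually_principal)
qed

text \<open>For \<open>k\<close> annihilated classes, \<open>l\<close> letters and \<open>m\<close>
  distinct labels, \<open>T ^ k * T ^ m\<close> bounds a sum of weighted boxes pointwise, and the
  mesh times the second factor bounds its integral. The two summands there serve a repeated label
  and a non-injective assignment.\<close>

definition estimate :: "real \<Rightarrow> nat \<Rightarrow> nat \<Rightarrow> nat \<Rightarrow> real"
  where "estimate T k l m = T ^ k * T ^ m * (T ^ (k + l) * T ^ m + (real m)\<^sup>2 * T ^ m)"

section \<open>Bounds in \<open>L2\<close> for weighted sums of boxes\<close>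

context q_levy
begin

lemma real_box_integral:
  assumes "\<And>i. i < n \<Longrightarrow> bounded_borel (J i)"
  shows "integrable (rplus_pow n) (\<lambda>x. \<Prod>i<n. indicator (J i) (x i) :: real)"
    and "(\<integral>x. (\<Prod>i<n. indicator (J i) (x i) :: real) \<partial>rplus_pow n) = (\<Prod>i<n. measure rplus (J i))"
proof -
  have int: "integrable rplus (indicator (J i) :: real \<Rightarrow> real)" "(\<integral>x. indicator (J i) x \<partial>rplus) = measure rplus (J i)"
    if "i < n" for i
    using emeasure_rplus_finite[OF assms[OF that]] sets_rplus[OF assms[OF that]]
      sets.sets_into_space[OF sets_rplus[OF assms[OF that]]]
    by (auto intro!: integrable_real_indicator simp: Int_absorb2)
  show "integrable (rplus_pow n) (\<lambda>x. \<Prod>i<n. indicator (J i) (x i) :: real)"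
    unfolding rplus_pow_def by (rule rp.product_integrable_prod) (use int in auto)
  show "(\<integral>x. (\<Prod>i<n. indicator (J i) (x i) :: real) \<partial>rplus_pow n) = (\<Prod>i<n. measure rplus (J i))"
    unfolding rplus_pow_def by (subst rp.product_integral_prod) (use int in auto)
qed

text \<open>Both the terms with a repeated label and the non-injective assignments of cells to labels live on
  boxes of total mass of the order of the mesh; since the overlap of the boxes is bounded, this controls
  the \<open>L2\<close> norm.\<close>

lemma label_sum_estimate:
  fixes cl lb :: "'a list"
  assumes sub: "subdivision t Is" and t: "0 < t"
    and A: "A = set cl \<union> set lb" and U: "U \<subseteq> A \<rightarrow>\<^sub>E {..<length Is}"
    and small: "\<not> distinct (cl @ lb) \<or> (\<forall>u\<in>U. \<not> inj_on u A)"
  shows "(\<integral>x. (cmod (\<Sum>u\<in>U. complex_of_real (\<Prod>b\<leftarrow>cl. measure rplus (Is ! u b)) *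
      box_ind (map (\<lambda>b. Is ! u b) lb) x))\<^sup>2 \<partial>rplus_pow (length lb))
    \<le> mesh Is * estimate (max 1 t) (length cl) (length lb) (card A)"
proof -
  define T where "T = max 1 t"
  have T: "1 \<le> T" "t \<le> T" by (auto simp: T_def)
  define h where "h j = measure rplus (Is ! j)" for j
  let ?n = "length lb" and ?E = "A \<rightarrow>\<^sub>E {..<length Is}"
  have finA: "finite A" using A by simp
  then have finE: "finite ?E" by (intro finite_PiE) auto
  then have finU: "finite U" using U finite_subset by blast
  have h: "0 \<le> h j" "h j \<le> mesh Is" "h j \<le> T" if "j < length Is" for j
  proof -
    show "0 \<le> h j" by (simp add: h_def)
    show "h j \<le> mesh Is"
      unfolding h_def by (intro subdivision_measure_mesh that subdivision_bounded_borel[OF sub])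
    have "h j \<le> (\<Sum>j<length Is. h j)"
      using that by (intro member_le_sum) (auto simp: h_def)
    then show "h j \<le> T" using subdivision_sum_measure[OF sub] t T by (simp add: h_def)
  qed
  have sum_h: "(\<Sum>j<length Is. h j) = t" using subdivision_sum_measure[OF sub] t by (simp add: h_def)
  have mesh: "0 \<le> mesh Is"
  proof -
    have "length Is \<noteq> 0" using sum_h t by (intro notI) simp
    then show ?thesis using h(1,2)[of 0] by linarith
  qed
  have lt: "u b < length Is" if "u \<in> ?E" "b \<in> A" for u b
    using that by (auto dest: PiE_mem)
  define w where "w u = (\<Prod>b\<leftarrow>cl. h (u b))" for u :: "'a \<Rightarrow> nat"
  define r where "r u x = (\<Prod>i<?n. indicator (Is ! u (lb ! i)) (x i) :: real)" for u :: "'a \<Rightarrow> nat" and x :: "nat \<Rightarrow> real"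
  define F where "F x = (\<Sum>u\<in>U. w u * r u x)" for x
  have w_nn: "0 \<le> w u" if "u \<in> ?E" for u
    unfolding w_def by (auto simp: h_def intro!: prod_list_nonneg)
  have r_nn: "0 \<le> r u x" for u x
    unfolding r_def by (intro prod_nonneg) auto
  have F_nn: "0 \<le> F x" for x
    unfolding F_def using U w_nn r_nn by (intro sum_nonneg mult_nonneg_nonneg) auto
  have F_eq: "(cmod (\<Sum>u\<in>U. complex_of_real (\<Prod>b\<leftarrow>cl. measure rplus (Is ! u b)) *
      box_ind (map (\<lambda>b. Is ! u b) lb) x))\<^sup>2 = (F x)\<^sup>2" for x
  proof -
    have "box_ind (map (\<lambda>b. Is ! u b) lb) x = complex_of_real (r u x)" for u
      by (auto simp: box_ind_def r_def indicator_def intro!: prod.cong)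
    then have "(\<Sum>u\<in>U. complex_of_real (\<Prod>b\<leftarrow>cl. measure rplus (Is ! u b)) *
      box_ind (map (\<lambda>b. Is ! u b) lb) x) = complex_of_real (F x)"
      by (simp add: F_def w_def h_def)
    then show ?thesis by (simp only: norm_of_real power2_abs)
  qed
  \<comment> \<open>For a fixed \<open>x\<close> the sum over assignments factorizes over the labels
    once the surplus factors are bounded. A label with a letter keeps one coordinate
    \<open>idx a\<close>, whose indicators sum to at most 1 over the cells; any other label keeps
    one length, and these sum to \<open>t\<close>.\<close>
  have F_le: "F x \<le> T ^ length cl * T ^ card A" for x
  proof -
    define idx where "idx a = (SOME i. i < ?n \<and> lb ! i = a)" for a
    have idx: "idx a < ?n \<and> lb ! idx a = a" if "a \<in> set lb" for a
      unfolding idx_def by (rule someI_ex) (use that in \<open>auto simp: in_set_conv_nth\<close>)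
    define g where "g a j = (if a \<in> set lb then indicator (Is ! j) (x (idx a)) else h j)" for a j
    have "w u * r u x \<le> T ^ length cl * (\<Prod>a\<in>A. g a (u a))" if u: "u \<in> ?E" for u
    proof -
      have "w u \<le> T ^ length cl * (\<Prod>a\<in>A - set lb. h (u a))"
        unfolding w_def using T lt[OF u] A by (intro prod_list_le_prod_subset h) auto
      moreover have "r u x \<le> (\<Prod>a\<in>set lb. indicator (Is ! u a) (x (idx a)))"
      proof -
        have "r u x = (\<Prod>i\<leftarrow>[0..<?n]. indicator (Is ! u (lb ! i)) (x i))"
          unfolding r_def by (simp add: prod.list_conv_set_nth atLeast0LessThan)
        also have "\<dots> \<le> 1 ^ length [0..<?n] * (\<Prod>i\<in>idx ` set lb. indicator (Is ! u (lb ! i)) (x i))"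
          using idx by (intro prod_list_le_prod_subset) auto
        also have "\<dots> = (\<Prod>a\<in>set lb. indicator (Is ! u a) (x (idx a)))"
        proof -
          have "inj_on idx (set lb)"
            by (rule inj_on_inverseI[of _ "\<lambda>i. lb ! i"]) (use idx in auto)
          then show ?thesis
            using idx by (simp add: prod.reindex)
        qed
        finally show ?thesis .
      qed
      ultimately have "w u * r u x \<le> (T ^ length cl * (\<Prod>a\<in>A - set lb. h (u a))) * (\<Prod>a\<in>set lb. indicator (Is ! u a) (x (idx a)))"
        using r_nn T lt[OF u] by (intro mult_mono mult_nonneg_nonneg prod_nonneg) (auto intro!: h)
      also have "\<dots> = T ^ length cl * ((\<Prod>a\<in>A - set lb. g a (u a)) * (\<Prod>a\<in>set lb. g a (u a)))"
        by (simp add: g_def)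
      also have "\<dots> = T ^ length cl * (\<Prod>a\<in>A. g a (u a))"
        using prod.subset_diff[of "set lb" A "\<lambda>a. g a (u a)"] finA A by simp
      finally show ?thesis .
    qed
    then have "F x \<le> (\<Sum>u\<in>U. T ^ length cl * (\<Prod>a\<in>A. g a (u a)))"
      unfolding F_def using U by (intro sum_mono) auto
    also have "\<dots> \<le> (\<Sum>u\<in>?E. T ^ length cl * (\<Prod>a\<in>A. g a (u a)))"
      using U finE T by (intro sum_mono2 mult_nonneg_nonneg prod_nonneg) (auto simp: g_def h_def)
    also have "\<dots> = T ^ length cl * (\<Prod>a\<in>A. \<Sum>j<length Is. g a j)"
      using finA by (simp add: sum_distrib_left prod_sum_PiE)
    also have "\<dots> \<le> T ^ length cl * (\<Prod>a\<in>A. T)"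
    proof (intro mult_left_mono prod_mono conjI)
      fix a
      show "0 \<le> (\<Sum>j<length Is. g a j)" by (intro sum_nonneg) (auto simp: g_def h_def)
      show "(\<Sum>j<length Is. g a j) \<le> T"
      proof (cases "a \<in> set lb")
        case True
        then have "(\<Sum>j<length Is. g a j) = indicator {0..<t} (x (idx a))"
          by (simp add: g_def subdivision_sum_indicator[OF sub])
        then show ?thesis using T by (simp add: indicator_def)
      next
        case False
        then show ?thesis using T sum_h by (simp add: g_def)
      qed
    qed (use T in auto)
    finally show ?thesis by simp
  qed
  have int_r: "integrable (rplus_pow ?n) (r u)" "(\<integral>x. r u x \<partial>rplus_pow ?n) = (\<Prod>b\<leftarrow>lb. h (u b))"
    if u: "u \<in> ?E" for u
  proof -
    have bb: "bounded_borel (Is ! u (lb ! i))" if "i < ?n" for i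
      using lt[OF u, of "lb ! i"] that A by (intro subdivision_bounded_borel[OF sub]) auto
    show "integrable (rplus_pow ?n) (r u)"
      unfolding r_def by (rule real_box_integral(1)) (use bb in auto)
    have "(\<integral>x. r u x \<partial>rplus_pow ?n) = (\<Prod>i<?n. h (u (lb ! i)))"
      unfolding r_def h_def by (rule real_box_integral(2)) (use bb in auto)
    then show "(\<integral>x. r u x \<partial>rplus_pow ?n) = (\<Prod>b\<leftarrow>lb. h (u b))"
      by (simp add: prod.list_conv_set_nth atLeast0LessThan)
  qed
  have int_F: "integrable (rplus_pow ?n) F"
    unfolding F_def using U int_r by (intro Bochner_Integration.integrable_sum integrable_mult_right) auto
  have "(\<integral>x. F x \<partial>rplus_pow ?n) = (\<Sum>u\<in>U. \<Prod>b\<leftarrow>cl @ lb. h (u b))"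
    unfolding F_def using U int_r
    by (subst Bochner_Integration.integral_sum) (auto simp: w_def subset_iff)
  \<comment> \<open>The integral is a sum of products of cell lengths. With distinct labels it is
    small because two labels share a cell, otherwise because one label contributes its length
    twice.\<close>
  also have "\<dots> \<le> mesh Is * (T ^ (length cl + ?n) * T ^ card A + (real (card A))\<^sup>2 * T ^ card A)"
  proof (cases "distinct (cl @ lb)")
    case True
    have "(\<Sum>u\<in>U. \<Prod>b\<leftarrow>cl @ lb. h (u b)) = (\<Sum>u\<in>U. \<Prod>a\<in>A. h (u a))"
      using A by (intro sum.cong refl, subst prod.distinct_set_conv_list[OF True, symmetric]) auto
    also have "\<dots> \<le> (\<Sum>u\<in>{u \<in> ?E. \<not> inj_on u A}. \<Prod>a\<in>A. h (u a))"
      using U small True finE by (intro sum_mono2 prod_nonneg) (auto simp: h_def)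
    also have "\<dots> \<le> mesh Is * (real (card A))\<^sup>2 * T ^ card A"
      using h sum_h T mesh by (intro sum_not_inj_le finA) auto
    also have "\<dots> \<le> mesh Is * (T ^ (length cl + ?n) * T ^ card A + (real (card A))\<^sup>2 * T ^ card A)"
      using mesh T by (simp add: mult.assoc mult_left_mono)
    finally show ?thesis .
  next
    case False
    have "(\<Sum>u\<in>U. \<Prod>b\<leftarrow>cl @ lb. h (u b))
      \<le> (\<Sum>u\<in>U. mesh Is * T ^ length (cl @ lb) * (\<Prod>a\<in>set (cl @ lb). h (u a)))"
    proof (rule sum_mono)
      fix u assume "u \<in> U"
      then have "u b < length Is" if "b \<in> set (cl @ lb)" for b
        using U that A by (intro lt) auto
      then show "(\<Prod>b\<leftarrow>cl @ lb. h (u b)) \<le> mesh Is * T ^ length (cl @ lb) * (\<Prod>a\<in>set (cl @ lb). h (u a))"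
        using T mesh False by (intro prod_list_not_distinct_le h) auto
    qed
    also have "\<dots> \<le> (\<Sum>u\<in>?E. mesh Is * T ^ length (cl @ lb) * (\<Prod>a\<in>A. h (u a)))"
      using U finE mesh T A by (simp, intro sum_mono2 mult_nonneg_nonneg prod_nonneg) (auto simp: h_def)
    also have "\<dots> = mesh Is * T ^ (length cl + ?n) * t ^ card A"
      using prod_sum_PiE[of A "\<lambda>_. {..<length Is}" "\<lambda>_. h"] finA sum_h
      by (simp add: sum_distrib_left[symmetric])
    also have "\<dots> \<le> mesh Is * T ^ (length cl + ?n) * T ^ card A"
      using mesh T t by (intro mult_left_mono power_mono) auto
    also have "\<dots> \<le> mesh Is * (T ^ (length cl + ?n) * T ^ card A + (real (card A))\<^sup>2 * T ^ card A)"
      using mesh T by (simp add: mult.assoc mult_left_mono)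
    finally show ?thesis .
  qed
  finally have I_F: "(\<integral>x. F x \<partial>rplus_pow ?n) \<le> mesh Is * (T ^ (length cl + ?n) * T ^ card A + (real (card A))\<^sup>2 * T ^ card A)" .
  have "integrable (rplus_pow ?n) (\<lambda>x. (F x)\<^sup>2)"
  proof -
    have "bounded_borel (Is ! u b)" if "u \<in> U" "b \<in> set lb" for u b
      using U A that by (intro subdivision_bounded_borel[OF sub] lt) auto
    then show ?thesis
      unfolding F_eq[symmetric] using finU by (intro box_sum_integral(1)) auto
  qed
  \<comment> \<open>The supremum of \<open>F\<close> times its integral bounds the squared
    \<open>L2\<close> norm.\<close>
  moreover have "(F x)\<^sup>2 \<le> T ^ length cl * T ^ card A * F x" for x
    unfolding power2_eq_square by (intro mult_right_mono F_le F_nn)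
  ultimately have "(\<integral>x. (F x)\<^sup>2 \<partial>rplus_pow ?n) \<le> (\<integral>x. T ^ length cl * T ^ card A * F x \<partial>rplus_pow ?n)"
    using int_F by (intro integral_mono integrable_mult_right) auto
  also have "\<dots> = T ^ length cl * T ^ card A * (\<integral>x. F x \<partial>rplus_pow ?n)"
    by simp
  also have "\<dots> \<le> T ^ length cl * T ^ card A * (mesh Is * (T ^ (length cl + ?n) * T ^ card A + (real (card A))\<^sup>2 * T ^ card A))"
    using T by (intro mult_left_mono I_F) auto
  also have "\<dots> = mesh Is * estimate T (length cl) ?n (card A)"
    by (simp add: estimate_def mult_ac)
  finally show ?thesis unfolding F_eq T_def .
qed

text \<open>Over all assignments the sum of products is a product of sums, one for each label: an
  annihilated class contributes the total length \<open>t\<close>, a letter the indicator of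
  \<open>{0..<t}\<close>. Distinctness makes each label occur exactly once.\<close>

lemma full_box_expansion:
  fixes cl lb :: "'a list"
  assumes sub: "subdivision t Is" and t: "0 < t" and A: "A = set cl \<union> set lb" and dist: "distinct (cl @ lb)"
  shows "(\<Sum>u\<in>A \<rightarrow>\<^sub>E {..<length Is}. complex_of_real (\<Prod>b\<leftarrow>cl. measure rplus (Is ! u b)) *
      box_ind (map (\<lambda>b. Is ! u b) lb) x)
    = complex_of_real (t ^ length cl) * box_ind (replicate (length lb) {0..<t}) x"
proof -
  define idx where "idx a = (SOME i. i < length lb \<and> lb ! i = a)" for a
  have idx: "idx (lb ! i) = i" if "i < length lb" for i
    unfolding idx_def using that dist by (intro some_equality) (auto simp: nth_eq_iff_index_eq)
  define g :: "'a \<Rightarrow> nat \<Rightarrow> complex"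
    where "g a j = (if a \<in> set lb then indicator (Is ! j) (x (idx a)) else complex_of_real (measure rplus (Is ! j)))" for a j
  have set_prod: "(\<Prod>a\<in>A. f a) = (\<Prod>b\<leftarrow>cl. f b) * (\<Prod>i<length lb. f (lb ! i))" for f :: "'a \<Rightarrow> complex"
  proof -
    have "(\<Prod>a\<in>A. f a) = (\<Prod>b\<leftarrow>cl @ lb. f b)"
      using prod.distinct_set_conv_list[OF dist, of f] A by simp
    then show ?thesis
      by (simp add: prod.list_conv_set_nth[of "map f lb"] atLeast0LessThan)
  qed
  have ncl: "b \<notin> set lb" if "b \<in> set cl" for b
    using dist that by auto
  have "(\<Sum>u\<in>A \<rightarrow>\<^sub>E {..<length Is}. complex_of_real (\<Prod>b\<leftarrow>cl. measure rplus (Is ! u b)) *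
      box_ind (map (\<lambda>b. Is ! u b) lb) x) = (\<Sum>u\<in>A \<rightarrow>\<^sub>E {..<length Is}. \<Prod>a\<in>A. g a (u a))"
  proof (rule sum.cong[OF refl])
    fix u
    have "(\<Prod>b\<leftarrow>cl. g b (u b)) = complex_of_real (\<Prod>b\<leftarrow>cl. measure rplus (Is ! u b))"
      using ncl by (induction cl) (auto simp: g_def)
    moreover have "(\<Prod>i<length lb. g (lb ! i) (u (lb ! i))) = box_ind (map (\<lambda>b. Is ! u b) lb) x"
      by (auto simp: g_def box_ind_def idx intro!: prod.cong)
    ultimately show "complex_of_real (\<Prod>b\<leftarrow>cl. measure rplus (Is ! u b)) *
      box_ind (map (\<lambda>b. Is ! u b) lb) x = (\<Prod>a\<in>A. g a (u a))"
      by (simp add: set_prod)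
  qed
  also have "\<dots> = (\<Prod>a\<in>A. \<Sum>j<length Is. g a j)"
    using A by (subst prod_sum_PiE) auto
  also have "\<dots> = complex_of_real (t ^ length cl) * box_ind (replicate (length lb) {0..<t}) x"
  proof -
    have "(\<Sum>j<length Is. g b j) = complex_of_real t" if "b \<in> set cl" for b
      using ncl[OF that] subdivision_sum_measure[OF sub] t by (simp add: g_def flip: of_real_sum)
    then have "(\<Prod>b\<leftarrow>cl. \<Sum>j<length Is. g b j) = complex_of_real (t ^ length cl)"
      by (induction cl) auto
    moreover have "(\<Prod>i<length lb. \<Sum>j<length Is. g (lb ! i) j) = box_ind (replicate (length lb) {0..<t}) x"
      by (auto simp: g_def box_ind_def idx subdivision_sum_indicator[OF sub] intro!: prod.cong)
    ultimately show ?thesis by (simp add: set_prod)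
  qed
  finally show ?thesis .
qed

text \<open>By \<open>full_box_expansion\<close> the difference is minus the sum over the
  non-injective assignments, which \<open>label_sum_estimate\<close> controls.\<close>

lemma injective_sum_estimate:
  fixes cl lb :: "'a list"
  assumes sub: "subdivision t Is" and t: "0 < t" and A: "A = set cl \<union> set lb" and dist: "distinct (cl @ lb)"
  shows "(\<integral>x. (cmod ((\<Sum>u\<in>{u \<in> A \<rightarrow>\<^sub>E {..<length Is}. inj_on u A}.
      complex_of_real (\<Prod>b\<leftarrow>cl. measure rplus (Is ! u b)) * box_ind (map (\<lambda>b. Is ! u b) lb) x)
      - complex_of_real (t ^ length cl) * box_ind (replicate (length lb) {0..<t}) x))\<^sup>2 \<partial>rplus_pow (length lb))
    \<le> mesh Is * estimate (max 1 t) (length cl) (length lb) (card A)"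
proof -
  let ?E = "A \<rightarrow>\<^sub>E {..<length Is}"
  let ?N = "{u \<in> ?E. \<not> inj_on u A}" and ?I = "{u \<in> ?E. inj_on u A}"
  define f where "f u x = complex_of_real (\<Prod>b\<leftarrow>cl. measure rplus (Is ! u b)) * box_ind (map (\<lambda>b. Is ! u b) lb) x" for u x
  have "finite ?E" using A by (intro finite_PiE) auto
  then have "(\<Sum>u\<in>?E. f u x) = (\<Sum>u\<in>?I. f u x) + (\<Sum>u\<in>?N. f u x)" for x
    by (subst sum.union_disjoint[symmetric]) (auto intro!: sum.cong)
  then have "(\<Sum>u\<in>?I. f u x) - complex_of_real (t ^ length cl) * box_ind (replicate (length lb) {0..<t}) x
    = - (\<Sum>u\<in>?N. f u x)" for x
    unfolding full_box_expansion[OF assms, of x, folded f_def, symmetric] by simp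
  then have "cmod ((\<Sum>u\<in>?I. f u x) - complex_of_real (t ^ length cl) * box_ind (replicate (length lb) {0..<t}) x)
    = cmod (\<Sum>u\<in>?N. f u x)" for x
    by simp
  moreover have "(\<integral>x. (cmod (\<Sum>u\<in>?N. f u x))\<^sup>2 \<partial>rplus_pow (length lb))
    \<le> mesh Is * estimate (max 1 t) (length cl) (length lb) (card A)"
    unfolding f_def by (rule label_sum_estimate[OF sub t A]) auto
  ultimately show ?thesis by (simp add: f_def)
qed

end

section \<open>The processes acting on words of step functions\<close>

lemma lookup_lin_ext:
  "Poly_Mapping.lookup (lin_ext \<Phi> f) w = lin_eval (\<lambda>v. Poly_Mapping.lookup (\<Phi> v) w) f"
  by (simp add: lin_ext_def lookup_sum lin_eval_def)

lemma lin_ext_add: "lin_ext \<Phi> (f + g) = lin_ext \<Phi> f + lin_ext \<Phi> g"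
  by (rule poly_mapping_eqI) (simp add: lookup_lin_ext lookup_add lin_eval_add)

lemma lin_ext_scale: "lin_ext \<Phi> (scale c f) = scale c (lin_ext \<Phi> f)"
  by (rule poly_mapping_eqI) (simp add: lookup_lin_ext lin_eval_scale)

lemma lin_ext_single: "lin_ext \<Phi> (Poly_Mapping.single w 1) = \<Phi> w"
  by (rule poly_mapping_eqI) (simp add: lookup_lin_ext)

lemma tens_Y_add: "tens_Y q \<nu> k I (f + g) = tens_Y q \<nu> k I f + tens_Y q \<nu> k I g"
  by (simp add: tens_Y_def tens_annihilate_def tens_create_def tens_preserve_def lin_ext_add)

lemma tens_Y_scale: "tens_Y q \<nu> k I (scale c f) = scale c (tens_Y q \<nu> k I f)"
  by (simp add: tens_Y_def tens_annihilate_def tens_create_def tens_preserve_def lin_ext_scale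
      formal.scale_right_distrib)

lemma tens_Y_zero: "tens_Y q \<nu> k I 0 = 0"
  using tens_Y_scale[of q \<nu> k I 0 0] by simp

lemma tens_Y_sum_list: "tens_Y q \<nu> k I (\<Sum>x\<leftarrow>xs. f x) = (\<Sum>x\<leftarrow>xs. tens_Y q \<nu> k I (f x))"
  by (induction xs) (simp_all add: tens_Y_add tens_Y_zero)

definition word_vec :: "(real set \<times> nat) list \<Rightarrow> tens"
  where "word_vec Ls = Poly_Mapping.single (map (\<lambda>(I, k). ind_mono I k) Ls) 1"

definition omit :: "nat \<Rightarrow> 'a list \<Rightarrow> 'a list"
  where "omit p xs = take p xs @ drop (Suc p) xs"

lemma map_omit: "map f (omit p xs) = omit p (map f xs)"
  by (simp add: omit_def take_map drop_map)

lemma mult_op_ind_mono: "mult_op (ind_mono I k) (ind_mono J j) = ind_mono (I \<inter> J) (k + j)"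
  by (auto simp: mult_op_def ind_mono_def power_add indicator_def)

lemma word_vec_empty: "tens_eq (word_vec (({}, k) # Ls)) 0"
proof -
  have "word_fun (map (\<lambda>(I, k). ind_mono I k) (({}, k) # Ls)) zs = 0" for zs
    by (cases zs) (auto simp: ind_mono_def split: prod.split)
  then show ?thesis by (simp add: tens_eq_def word_vec_def)
qed

text \<open>A domain that the processes visibly preserve: \<open>mult_op\<close> maps step letters
  to step letters by \<open>mult_op_ind_mono\<close>, and square integrability then comes from
  \<open>ind_mono_L2\<close>.\<close>

definition step_tens :: "tens set"
  where "step_tens = {f. \<forall>w \<in> Poly_Mapping.keys f. set w \<subseteq> {ind_mono J j | J j. bounded_borel J}}"

lemma step_tens_zero: "0 \<in> step_tens"
  by (simp add: step_tens_def)

lemma step_tens_add: "f \<in> step_tens \<Longrightarrow> g \<in> step_tens \<Longrightarrow> f + g \<in> step_tens"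
  unfolding step_tens_def using Poly_Mapping.keys_add[of f g] by blast

lemma step_tens_scale: "f \<in> step_tens \<Longrightarrow> scale c f \<in> step_tens"
  unfolding step_tens_def using keys_scale[of c f] by blast

lemma step_tens_sum: "(\<And>i. i \<in> A \<Longrightarrow> f i \<in> step_tens) \<Longrightarrow> sum f A \<in> step_tens"
  by (induction A rule: infinite_finite_induct) (auto intro: step_tens_add step_tens_zero)

lemma step_tens_sum_list: "(\<And>i. i \<in> set xs \<Longrightarrow> f i \<in> step_tens) \<Longrightarrow> sum_list (map f xs) \<in> step_tens"
  by (induction xs) (auto intro: step_tens_add step_tens_zero)

lemma step_tens_single:
  "set w \<subseteq> {ind_mono J j | J j. bounded_borel J} \<Longrightarrow> Poly_Mapping.single w c \<in> step_tens"
  by (simp add: step_tens_def)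

lemma word_vec_step_tens: "(\<And>I k. (I, k) \<in> set Ls \<Longrightarrow> bounded_borel I) \<Longrightarrow> word_vec Ls \<in> step_tens"
  unfolding word_vec_def by (rule step_tens_single) auto

lemma word_vec_Nil: "word_vec [] \<in> step_tens"
  by (rule word_vec_step_tens) simp

lemma lin_ext_step_tens:
  assumes "f \<in> step_tens"
    and "\<And>w. set w \<subseteq> {ind_mono J j | J j. bounded_borel J} \<Longrightarrow> \<Phi> w \<in> step_tens"
  shows "lin_ext \<Phi> f \<in> step_tens"
  unfolding lin_ext_def
proof (intro step_tens_sum step_tens_scale assms(2))
  fix w assume "w \<in> Poly_Mapping.keys f"
  then show "set w \<subseteq> {ind_mono J j | J j. bounded_borel J}"
    using assms(1) unfolding step_tens_def by blast
qed

lemma tens_Y_step_tens: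
  assumes f: "f \<in> step_tens" and I: "bounded_borel I"
  shows "tens_Y q \<nu> k I f \<in> step_tens"
proof -
  let ?L = "{ind_mono J j | J j. bounded_borel J}"
  have omit: "set (take p w @ drop (Suc p) w) \<subseteq> ?L" if "set w \<subseteq> ?L" for p w
    using that by (auto dest: in_set_takeD in_set_dropD)
  have mult: "mult_op (ind_mono I k) (w ! p) \<in> ?L" if "set w \<subseteq> ?L" "p < length w" for p w
  proof -
    have "w ! p \<in> ?L" using that nth_mem by blast
    then obtain J j where "w ! p = ind_mono J j" "bounded_borel J" by blast
    then show ?thesis
      using bounded_borel_Int[OF I] by (auto simp: mult_op_ind_mono)
  qed
  have "tens_annihilate q \<nu> (ind_mono I (k - 1)) f \<in> step_tens"
    unfolding tens_annihilate_def
    by (intro lin_ext_step_tens[OF f] step_tens_sum step_tens_single omit)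
  moreover have "tens_create (ind_mono I (k - 1)) f \<in> step_tens"
    unfolding tens_create_def using I
    by (intro lin_ext_step_tens[OF f] step_tens_single) auto
  moreover have "tens_preserve q (mult_op (ind_mono I k)) f \<in> step_tens"
    unfolding tens_preserve_def
  proof (intro lin_ext_step_tens[OF f] step_tens_sum step_tens_single)
    fix w p assume w: "set w \<subseteq> ?L" and p: "p \<in> {..<length w}"
    show "set (mult_op (ind_mono I k) (w ! p) # take p w @ drop (Suc p) w) \<subseteq> ?L"
      using mult[OF w, of p] omit[OF w, of p] p by simp
  qed
  ultimately show ?thesis
    by (simp add: tens_Y_def step_tens_add)
qed

context q_levy
begin

lemma step_word_eq: "step_word Is ks = word_vec (zip Is ks)"
  by (simp add: step_word_def word_vec_def)

lemma step_tens_carrier: "f \<in> step_tens \<Longrightarrow> f \<in> tens_carrier \<nu>"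
  unfolding step_tens_def tens_carrier_def using ind_mono_L2 by blast

text \<open>Creation, annihilation and preservation all have formulas in terms of
  \<open>tens_fun\<close>, so representatives may be exchanged inside a product of
  operators.\<close>

lemma tens_Y_cong:
  assumes f: "f \<in> tens_carrier \<nu>" and g: "g \<in> tens_carrier \<nu>" and I: "bounded_borel I" and eq: "tens_eq f g"
  shows "tens_eq (tens_Y q \<nu> k I f) (tens_Y q \<nu> k I g)"
  unfolding tens_eq_def
proof
  fix zs
  have "tens_fun f = tens_fun g" using eq by (auto simp: tens_eq_def)
  then show "tens_fun (tens_Y q \<nu> k I f) zs = tens_fun (tens_Y q \<nu> k I g) zs"
    by (cases zs) (simp_all add: tens_Y_def tens_fun_annihilate[OF f ind_mono_L2[OF I]]
        tens_fun_annihilate[OF g ind_mono_L2[OF I]] tens_fun_create tens_fun_preserve)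
qed

lemma tens_Y_word_vec:
  assumes I: "bounded_borel I" and Ls: "\<And>J j. (J, j) \<in> set Ls \<Longrightarrow> bounded_borel J"
  shows "tens_Y q \<nu> k I (word_vec Ls) = word_vec ((I, k - 1) # Ls) + (\<Sum>p<length Ls.
    scale (complex_of_real (q ^ p * (measure rplus (I \<inter> fst (Ls ! p)) * moment (k - 1 + snd (Ls ! p)))))
      (word_vec (omit p Ls)) +
    scale (complex_of_real (q ^ p)) (word_vec ((I \<inter> fst (Ls ! p), k + snd (Ls ! p)) # omit p Ls)))"
proof -
  let ?w = "map (\<lambda>(I, k). ind_mono I k) Ls"
  have "L2_inner (hmeas \<nu>) (ind_mono I (k - 1)) (?w ! p)
     = complex_of_real (measure rplus (I \<inter> fst (Ls ! p)) * moment (k - 1 + snd (Ls ! p)))"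
    "mult_op (ind_mono I k) (?w ! p) = ind_mono (I \<inter> fst (Ls ! p)) (k + snd (Ls ! p))"
    if "p < length Ls" for p
    using that Ls[of "fst (Ls ! p)" "snd (Ls ! p)"] I
    by (simp_all add: case_prod_unfold L2_inner_ind_mono mult_op_ind_mono)
  then have "(\<Sum>p<length Ls. Poly_Mapping.single (omit p ?w)
        (complex_of_real (q ^ p) * L2_inner (hmeas \<nu>) (ind_mono I (k - 1)) (?w ! p)))
    = (\<Sum>p<length Ls. scale (complex_of_real (q ^ p * (measure rplus (I \<inter> fst (Ls ! p)) * moment (k - 1 + snd (Ls ! p)))))
      (word_vec (omit p Ls)))"
    "(\<Sum>p<length Ls. Poly_Mapping.single (mult_op (ind_mono I k) (?w ! p) # omit p ?w) (complex_of_real (q ^ p)))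
    = (\<Sum>p<length Ls. scale (complex_of_real (q ^ p)) (word_vec ((I \<inter> fst (Ls ! p), k + snd (Ls ! p)) # omit p Ls)))"
    by (auto intro!: sum.cong simp: word_vec_def map_omit)
  then show ?thesis
    by (simp add: tens_Y_def tens_annihilate_def tens_create_def tens_preserve_def word_vec_def
        lin_ext_single sum.distrib add_ac flip: omit_def)
qed

text \<open>Disjointness kills annihilation through a zero inner product and preservation through an
  empty letter; only creation is left.\<close>

lemma tens_Y_disjoint:
  assumes I: "bounded_borel I" and Ls: "\<And>J j. (J, j) \<in> set Ls \<Longrightarrow> bounded_borel J \<and> I \<inter> J = {}"
  shows "tens_eq (tens_Y q \<nu> k I (word_vec Ls)) (word_vec ((I, k - 1) # Ls))"
proof -
  have disj: "I \<inter> fst (Ls ! p) = {}" if "p < length Ls" for p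
    using Ls[of "fst (Ls ! p)" "snd (Ls ! p)"] that by simp
  have "tens_Y q \<nu> k I (word_vec Ls) = word_vec ((I, k - 1) # Ls) + (\<Sum>p<length Ls.
    scale (complex_of_real (q ^ p)) (word_vec (({}, k + snd (Ls ! p)) # omit p Ls)))"
    using Ls by (subst tens_Y_word_vec[OF I]) (auto simp: disj)
  moreover have "tens_eq (\<Sum>p<length Ls. scale (complex_of_real (q ^ p)) (word_vec (({}, k + snd (Ls ! p)) # omit p Ls)))
     (\<Sum>p<length Ls. scale (complex_of_real (q ^ p)) 0)"
    by (intro tens_eq_sum tens_eq_scale word_vec_empty)
  ultimately show ?thesis
    using tens_eq_add[OF tens_eq_refl] by fastforce
qed

definition Y_product :: "nat list \<Rightarrow> real set list \<Rightarrow> tens"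
  where "Y_product ks Is = foldr (\<lambda>(k, I). tens_Y q \<nu> k I) (zip ks Is) (word_vec [])"

lemma op_prod_vacuum: "op_prod (map2 (Y_op q \<nu>) ks Is) vacuum = (\<lambda>_. Y_product ks Is)"
proof -
  have "op_prod (map (\<lambda>(k, I). Y_op q \<nu> k I) xs) vacuum
    = (\<lambda>_. foldr (\<lambda>(k, I). tens_Y q \<nu> k I) xs (word_vec []))" for xs
  proof (induction xs)
    case Nil
    show ?case by (simp add: op_prod_def vacuum_def word_vec_def)
  next
    case (Cons x xs)
    have "op_prod (map (\<lambda>(k, I). Y_op q \<nu> k I) (x # xs)) vacuum
      = Y_op q \<nu> (fst x) (snd x) (op_prod (map (\<lambda>(k, I). Y_op q \<nu> k I) xs) vacuum)"
      by (simp add: op_prod_def case_prod_unfold)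
    also have "\<dots> = (\<lambda>_. foldr (\<lambda>(k, I). tens_Y q \<nu> k I) (x # xs) (word_vec []))"
      unfolding Cons.IH by (simp add: Y_op_def case_prod_unfold)
    finally show ?case .
  qed
  then show ?thesis by (simp add: Y_product_def)
qed

text \<open>On disjoint sides every operator only creates, and \<open>Y\<close> with index
  \<open>k\<close> creates the exponent \<open>k - 1\<close>.\<close>

lemma Y_product_disjoint:
  assumes "length ks = length Is" "\<And>I. I \<in> set Is \<Longrightarrow> bounded_borel I"
    and "\<And>i j. i < length Is \<Longrightarrow> j < length Is \<Longrightarrow> i \<noteq> j \<Longrightarrow> Is ! i \<inter> Is ! j = {}"
  shows "Y_product ks Is \<in> step_tens" "tens_eq (Y_product ks Is) (step_word Is (map (\<lambda>k. k - 1) ks))"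
proof -
  have "Y_product ks Is \<in> step_tens \<and> tens_eq (Y_product ks Is) (step_word Is (map (\<lambda>k. k - 1) ks))"
    using assms
  proof (induction ks Is rule: list_induct2)
    case Nil
    then show ?case by (simp add: Y_product_def step_word_eq word_vec_Nil)
  next
    case (Cons k ks I Is)
    have IH: "Y_product ks Is \<in> step_tens" "tens_eq (Y_product ks Is) (step_word Is (map (\<lambda>k. k - 1) ks))"
      using Cons.IH Cons.prems(1) Cons.prems(2)[of "Suc _" "Suc _"] by auto
    have I: "bounded_borel I" using Cons.prems by simp
    have eq: "Y_product (k # ks) (I # Is) = tens_Y q \<nu> k I (Y_product ks Is)"
      by (simp add: Y_product_def)
    have disj: "bounded_borel J \<and> I \<inter> J = {}" if J: "J \<in> set Is" for J
    proof -
      obtain j where "j < length Is" "J = Is ! j" using J by (auto simp: in_set_conv_nth)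
      then show ?thesis using Cons.prems(1)[of J] Cons.prems(2)[of 0 "Suc j"] by simp
    qed
    have "step_word Is (map (\<lambda>k. k - 1) ks) \<in> step_tens"
      unfolding step_word_eq using disj by (intro word_vec_step_tens) (auto dest: set_zip_leftD)
    then have "tens_eq (tens_Y q \<nu> k I (Y_product ks Is)) (tens_Y q \<nu> k I (step_word Is (map (\<lambda>k. k - 1) ks)))"
      using IH by (intro tens_Y_cong step_tens_carrier I)
    also have "tens_eq \<dots> (word_vec ((I, k - 1) # zip Is (map (\<lambda>k. k - 1) ks)))"
      unfolding step_word_eq using disj by (intro tens_Y_disjoint I) (auto dest: set_zip_leftD)
    finally show ?case
      using IH I by (auto simp: eq step_word_eq intro: tens_Y_step_tens)
  qed
  then show "Y_product ks Is \<in> step_tens" "tens_eq (Y_product ks Is) (step_word Is (map (\<lambda>k. k - 1) ks))"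
    by auto
qed

section \<open>Multiple integrals\<close>

lemma box_ind_L2:
  assumes "\<And>I. I \<in> set Is \<Longrightarrow> bounded_borel I"
  shows "box_ind Is \<in> L2 (rplus_pow (length Is))"
proof -
  have eq: "(\<lambda>x. cnj (box_ind Is x) * box_ind Is x) = box_ind Is"
    unfolding box_ind_def cnj_prod prod.distrib[symmetric]
    by (intro ext prod.cong refl) (auto simp: indicator_def)
  have "integrable (rplus_pow (length Is)) (box_ind Is)"
    using box_ind_mult_integral(1)[of Is "length Is" Is] assms unfolding eq by simp
  moreover have "integrable (rplus_pow (length Is)) (\<lambda>x. (cmod (box_ind Is x))\<^sup>2)"
    using box_sum_integral(1)[of "{()}" "\<lambda>_. Is" "length Is" "\<lambda>_. 1"] assms by simp
  ultimately show ?thesis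
    by (auto simp: L2_def dest: borel_measurable_integrable)
qed

lemma sum_list_index: "(\<Sum>x\<leftarrow>xs. f x) = (\<Sum>i<length xs. f (xs ! i))"
  by (simp add: sum_list_sum_nth atLeast0LessThan)

lemma step_word_norm_list:
  assumes "\<And>c Is. (c, Is) \<in> set G \<Longrightarrow> length Is = length ks"
    and "\<And>c Is I. (c, Is) \<in> set G \<Longrightarrow> I \<in> set Is \<Longrightarrow> bounded_borel I"
  shows "(tens_norm q \<nu> (\<Sum>(c, Is)\<leftarrow>G. scale c (step_word Is ks)))\<^sup>2
    \<le> step_bound ks * (\<integral>x. (cmod (simple_fun G x))\<^sup>2 \<partial>rplus_pow (length ks))"
proof -
  have mem: "(fst (G ! i), snd (G ! i)) \<in> set G" if "i < length G" for i
    using that by simp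
  show ?thesis
    unfolding simple_fun_def sum_list_index case_prod_unfold
    using assms(1)[OF mem] assms(2)[OF mem] by (intro step_word_norm) auto
qed

lemma simple_integral_bound:
  assumes G: "G \<in> simple_functions (length ks)"
  shows "simple_integral q \<nu> ks G \<in> fock q \<nu>"
    and "fock_dist q \<nu> (simple_integral q \<nu> ks G)
        (\<lambda>_. step_word (replicate (length ks) {0..<t}) (map (\<lambda>k. k - 1) ks))
      \<le> sqrt (step_bound (map (\<lambda>k. k - 1) ks)) *
        L2_dist (rplus_pow (length ks)) (simple_fun G) (box_ind (replicate (length ks) {0..<t}))"
proof -
  let ?ks = "map (\<lambda>k. k - 1) ks" and ?B = "replicate (length ks) {0..<t}"
  have mem: "length Is = length ks" "\<And>I. I \<in> set Is \<Longrightarrow> bounded_borel I"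
    "\<And>i j. i < length Is \<Longrightarrow> j < length Is \<Longrightarrow> i \<noteq> j \<Longrightarrow> Is ! i \<inter> Is ! j = {}"
    if "(c, Is) \<in> set G" for c Is
  proof -
    have *: "length Is = length ks \<and> (\<forall>I \<in> set Is. half_open I) \<and>
        (\<forall>i<length ks. \<forall>j<length ks. i \<noteq> j \<longrightarrow> Is ! i \<inter> Is ! j = {})"
      using G that unfolding simple_functions_def by blast
    show "length Is = length ks" "\<And>I. I \<in> set Is \<Longrightarrow> bounded_borel I"
      "\<And>i j. i < length Is \<Longrightarrow> j < length Is \<Longrightarrow> i \<noteq> j \<Longrightarrow> Is ! i \<inter> Is ! j = {}"
      using * bounded_borel_half_open by auto
  qed
  define s where "s = (\<Sum>(c, Is)\<leftarrow>G. scale c (Y_product ks Is))"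
  have "(\<Sum>x\<leftarrow>G. case x of (c, Is) \<Rightarrow> fock_scale c (\<lambda>_. Y_product ks Is)) m = (\<Sum>(c, Is)\<leftarrow>G. scale c (Y_product ks Is))" for m
    by (induction G) (auto simp: fock_scale_def)
  then have int_eq: "simple_integral q \<nu> ks G = (\<lambda>_. s)"
    unfolding simple_integral_def op_prod_vacuum s_def by auto
  have s: "s \<in> tens_carrier \<nu>"
    unfolding s_def
  proof (rule tens_carrier_sum_list)
    fix i assume i: "i \<in> set G"
    obtain c Is where eq: "i = (c, Is)" by (cases i)
    show "(case i of (c, Is) \<Rightarrow> scale c (Y_product ks Is)) \<in> tens_carrier \<nu>"
      using mem[OF i[unfolded eq]] unfolding eq prod.case
      by (intro tens_carrier_scale step_tens_carrier Y_product_disjoint(1)) auto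
  qed
  then show "simple_integral q \<nu> ks G \<in> fock q \<nu>"
    unfolding int_eq by (rule fock_const)
  have B: "step_word ?B ?ks \<in> tens_carrier \<nu>"
    by (rule step_word_carrier) auto
  \<comment> \<open>The target box is appended with coefficient -1, so that the difference is a
    single combination of step words. Its sides all equal \<open>{0..<t}\<close>; the norm bound
    covers boxes with overlapping sides.\<close>
  let ?G = "G @ [(- 1, ?B)]"
  have "tens_eq (\<Sum>(c, Is)\<leftarrow>G. scale c (Y_product ks Is)) (\<Sum>(c, Is)\<leftarrow>G. scale c (step_word Is ?ks))"
  proof (rule tens_eq_sum_list)
    fix i assume i: "i \<in> set G"
    obtain c Is where eq: "i = (c, Is)" by (cases i)
    show "tens_eq (case i of (c, Is) \<Rightarrow> scale c (Y_product ks Is)) (case i of (c, Is) \<Rightarrow> scale c (step_word Is ?ks))"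
      using mem[OF i[unfolded eq]] unfolding eq prod.case
      by (intro tens_eq_scale Y_product_disjoint(2)) auto
  qed
  then have "tens_eq (s - step_word ?B ?ks) (\<Sum>(c, Is)\<leftarrow>?G. scale c (step_word Is ?ks))"
    by (simp add: s_def tens_eq_diff)
  moreover have "(\<Sum>(c, Is)\<leftarrow>?G. scale c (step_word Is ?ks)) \<in> tens_carrier \<nu>"
  proof (rule tens_carrier_sum_list)
    fix i assume i: "i \<in> set ?G"
    obtain c Is where eq: "i = (c, Is)" by (cases i)
    have "\<And>I. I \<in> set Is \<Longrightarrow> bounded_borel I" using i mem(2)[of c Is] unfolding eq by auto
    then show "(case i of (c, Is) \<Rightarrow> scale c (step_word Is ?ks)) \<in> tens_carrier \<nu>"
      unfolding eq prod.case by (intro tens_carrier_scale step_word_carrier)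
  qed
  ultimately have "(tens_norm q \<nu> (s - step_word ?B ?ks))\<^sup>2 = (tens_norm q \<nu> (\<Sum>(c, Is)\<leftarrow>?G. scale c (step_word Is ?ks)))\<^sup>2"
    by (simp only: tens_norm_cong[OF tens_carrier_diff[OF s B]])
  also have "\<dots> \<le> step_bound ?ks * (\<integral>x. (cmod (simple_fun ?G x))\<^sup>2 \<partial>rplus_pow (length ?ks))"
    using mem by (intro step_word_norm_list) auto
  also have "\<dots> = (sqrt (step_bound ?ks) * L2_dist (rplus_pow (length ks)) (simple_fun G) (box_ind ?B))\<^sup>2"
    using step_bound_nonneg by (simp add: L2_dist_def simple_fun_def power_mult_distrib)
  finally have "tens_norm q \<nu> (s - step_word ?B ?ks)
      \<le> sqrt (step_bound ?ks) * L2_dist (rplus_pow (length ks)) (simple_fun G) (box_ind ?B)"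
    by (rule power2_le_imp_le) (simp add: step_bound_nonneg L2_dist_def)
  then show "fock_dist q \<nu> (simple_integral q \<nu> ks G) (\<lambda>_. step_word ?B ?ks)
      \<le> sqrt (step_bound ?ks) * L2_dist (rplus_pow (length ks)) (simple_fun G) (box_ind ?B)"
    unfolding int_eq fock_dist_const[OF s B] .
qed

lemma eventually_simple_near:
  assumes "0 < d" "\<And>G. G \<in> simple_functions k \<Longrightarrow> L2_dist (rplus_pow k) (simple_fun G) F < d \<Longrightarrow> P G"
  shows "eventually P (simple_near k F)"
  unfolding simple_near_def using assms
  by (intro eventually_INF1[of d]) (auto simp: eventually_principal)

lemma tendsto_zeroI:
  fixes f :: "'a \<Rightarrow> real"
  assumes "\<And>e. 0 < e \<Longrightarrow> eventually (\<lambda>x. \<bar>f x\<bar> < e) F"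
  shows "(f \<longlongrightarrow> 0) F"
  using assms by (auto simp: tendsto_iff dist_real_def)

lemma has_multiple_integral_box:
  "has_multiple_integral q \<nu> ks (box_ind (replicate (length ks) {0..<t}))
    (\<lambda>_. step_word (replicate (length ks) {0..<t}) (map (\<lambda>k. k - 1) ks))"
proof -
  let ?ks = "map (\<lambda>k. k - 1) ks" and ?B = "replicate (length ks) {0..<t}"
  have B: "step_word ?B ?ks \<in> tens_carrier \<nu>"
    by (rule step_word_carrier) auto
  have "((\<lambda>G. fock_dist q \<nu> (simple_integral q \<nu> ks G) (\<lambda>_. step_word ?B ?ks)) \<longlongrightarrow> 0)
     (simple_near (length ks) (box_ind ?B))"
  proof (rule tendsto_zeroI)
    fix e :: real assume e: "0 < e"
    define b where "b = sqrt (step_bound ?ks)"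
    have b: "0 \<le> b" using step_bound_nonneg by (simp add: b_def)
    show "eventually (\<lambda>G. \<bar>fock_dist q \<nu> (simple_integral q \<nu> ks G) (\<lambda>_. step_word ?B ?ks)\<bar> < e)
      (simple_near (length ks) (box_ind ?B))"
    proof (rule eventually_simple_near)
      show "0 < e / (b + 1)" using e b by simp
      fix G assume G: "G \<in> simple_functions (length ks)"
        and d: "L2_dist (rplus_pow (length ks)) (simple_fun G) (box_ind ?B) < e / (b + 1)"
      have "fock_dist q \<nu> (simple_integral q \<nu> ks G) (\<lambda>_. step_word ?B ?ks)
         \<le> b * L2_dist (rplus_pow (length ks)) (simple_fun G) (box_ind ?B)"
        unfolding b_def by (rule simple_integral_bound(2)[OF G])
      also have "\<dots> \<le> b * (e / (b + 1))"
        using d b by (intro mult_left_mono) auto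
      also have "\<dots> < e"
        using e b by (simp add: field_simps)
      finally show "\<bar>fock_dist q \<nu> (simple_integral q \<nu> ks G) (\<lambda>_. step_word ?B ?ks)\<bar> < e"
        using fock_dist_nonneg[OF simple_integral_bound(1)[OF G] fock_const[OF B]] by simp
    qed
  qed
  moreover have "box_ind ?B \<in> L2 (rplus_pow (length ks))"
    using box_ind_L2[of ?B] by simp
  ultimately show ?thesis
    using fock_const[OF B] by (simp add: has_multiple_integral_def)
qed

text \<open>The off-diagonal boxes of a fine subdivision approximate the cube with side
  \<open>{0..<t}\<close>, because the diagonal ones have total mass of the order of the mesh. So the
  filter is proper and limits along it are unique.\<close>

lemma simple_near_nontrivial:
  assumes t: "0 < t"
  shows "simple_near m (box_ind (replicate m {0..<t})) \<noteq> bot"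
proof -
  let ?F = "box_ind (replicate m {0..<t})"
  have ex: "\<exists>G \<in> simple_functions m. L2_dist (rplus_pow m) (simple_fun G) ?F < d" if d: "0 < d" for d
  proof -
    \<comment> \<open>The constant of \<open>injective_sum_estimate\<close> for \<open>m\<close>
      letters and no annihilated class.\<close>
    define K where "K = estimate (max 1 t) 0 m m"
    have K: "0 \<le> K" by (simp add: K_def estimate_def)
    obtain Is where Is: "subdivision t Is" "mesh Is < d\<^sup>2 / (K + 1)"
      using subdivision_exists[OF t, of "d\<^sup>2 / (K + 1)"] d K by auto
    define U where "U = {u \<in> {..<m} \<rightarrow>\<^sub>E {..<length Is}. inj_on u {..<m}}"
    have "finite U" unfolding U_def using finite_PiE[of "{..<m}" "\<lambda>_. {..<length Is}"] by simp
    then obtain us where us: "set us = U" "distinct us" using finite_distinct_list by blast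
    define G :: simple where "G = map (\<lambda>u. (1, map (\<lambda>i. Is ! u i) [0..<m])) us"
    have "G \<in> simple_functions m"
    proof -
      have "half_open (Is ! u i)" if "u \<in> U" "i < m" for u i
        using that Is(1) by (intro subdivision_half_open[of t]) (auto simp: U_def dest: PiE_mem)
      moreover have "Is ! u i \<inter> Is ! u j = {}" if "u \<in> U" "i < m" "j < m" "i \<noteq> j" for u i j
      proof -
        have "u i \<noteq> u j" "u i < length Is" "u j < length Is"
          using that by (auto simp: U_def inj_on_def dest: PiE_mem)
        with Is(1) show ?thesis by (auto simp: subdivision_def)
      qed
      ultimately show ?thesis
        by (auto simp: simple_functions_def G_def us(1))
    qed
    moreover have "L2_dist (rplus_pow m) (simple_fun G) ?F < d"
    proof -
      have "simple_fun G x = (\<Sum>u\<in>U. box_ind (map (\<lambda>i. Is ! u i) [0..<m]) x)" for x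
        by (simp add: simple_fun_def G_def o_def sum_list_distinct_conv_sum_set[OF us(2)] us(1))
      then have "(\<integral>x. (cmod (simple_fun G x - ?F x))\<^sup>2 \<partial>rplus_pow m) \<le> mesh Is * K"
        using injective_sum_estimate[OF Is(1) t, of "{..<m}" "[]" "[0..<m]"]
        by (simp add: U_def K_def atLeast0LessThan)
      also have "\<dots> \<le> d\<^sup>2 / (K + 1) * K"
        using Is(2) K by (intro mult_right_mono) auto
      also have "\<dots> < d\<^sup>2"
        using K d by (simp add: field_simps)
      finally have "L2_dist (rplus_pow m) (simple_fun G) ?F < sqrt (d\<^sup>2)"
        unfolding L2_dist_def by (rule real_sqrt_less_mono)
      then show ?thesis using d by simp
    qed
    ultimately show ?thesis by blast
  qed
  show ?thesis
  proof
    assume "simple_near m ?F = bot"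
    then have "eventually (\<lambda>_. False) (simple_near m ?F)" by simp
    then have "\<exists>d\<in>{0<..}. eventually (\<lambda>_. False)
      (principal {G \<in> simple_functions m. L2_dist (rplus_pow m) (simple_fun G) ?F < d})"
      unfolding simple_near_def
    proof (subst (asm) eventually_INF_base)
      show "{0 :: real <..} \<noteq> {}" by auto
      fix a b :: real assume "a \<in> {0<..}" "b \<in> {0<..}"
      then show "\<exists>x\<in>{0<..}. principal {G \<in> simple_functions m. L2_dist (rplus_pow m) (simple_fun G) ?F < x}
        \<le> principal {G \<in> simple_functions m. L2_dist (rplus_pow m) (simple_fun G) ?F < a}
          \<sqinter> principal {G \<in> simple_functions m. L2_dist (rplus_pow m) (simple_fun G) ?F < b}"
        by (intro bexI[of _ "min a b"]) auto
    qed auto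
    then show False
      using ex by (auto simp: eventually_principal)
  qed
qed

text \<open>For a nonempty list, \<open>SOME\<close> returns a limit along the same proper filter as
  the step word, so the two represent the same element of the completion. The empty list gives the
  vacuum on both sides.\<close>

lemma full_measure_eq:
  assumes t: "0 < t"
  shows "fock_eq q \<nu> (full_measure q \<nu> ks t)
    (\<lambda>_. step_word (replicate (length ks) {0..<t}) (map (\<lambda>k. k - 1) ks))"
proof (cases "ks = []")
  case True
  note C = step_tens_carrier[OF word_vec_Nil]
  have v: "full_measure q \<nu> ks t = (\<lambda>_. word_vec [])"
    using True by (simp add: full_measure_def vacuum_def word_vec_def)
  show ?thesis
    unfolding v using True fock_const[OF C] fock_dist_const[OF C C] by (simp add: step_word_eq fock_eq_def)
next
  case False
  let ?F = "box_ind (replicate (length ks) {0..<t})"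
  have "has_multiple_integral q \<nu> ks ?F (full_measure q \<nu> ks t)"
    using False someI[of "has_multiple_integral q \<nu> ks ?F", OF has_multiple_integral_box]
    by (simp add: full_measure_def)
  moreover have "eventually (\<lambda>G. simple_integral q \<nu> ks G \<in> fock q \<nu>) (simple_near (length ks) ?F)"
    by (rule eventually_simple_near[of 1]) (auto intro: simple_integral_bound(1))
  ultimately show ?thesis
    using has_multiple_integral_box[of ks t]
    by (intro fock_limit_unique[OF simple_near_nontrivial[OF t, of "length ks"]])
       (auto simp: has_multiple_integral_def)
qed

end

section \<open>Expanding products of the process over a partition\<close>

text \<open>A term \<open>(c, L, cl)\<close> has coefficient \<open>c\<close>, a word with letters \<open>L\<close> (a class, which supplies the interval,
  and the exponent of the space variable) and annihilated classes \<open>cl\<close>, each contributing the length of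
  its interval.\<close>

type_synonym wick_term = "real \<times> (nat set \<times> nat) list \<times> nat set list"

definition term_value :: "(nat set \<Rightarrow> real set) \<Rightarrow> wick_term \<Rightarrow> tens"
  where "term_value I = (\<lambda>(c, L, cl). scale (complex_of_real (c * (\<Prod>b\<leftarrow>cl. measure rplus (I b))))
    (word_vec (map (\<lambda>(b, j). (I b, j)) L)))"

text \<open>Every entry stands for a cell length, contributed by the coefficient for an annihilated
  class and by a side of the box for a letter. A repeated entry therefore makes the term small in
  the limit.\<close>

definition labels :: "wick_term \<Rightarrow> nat set list"
  where "labels = (\<lambda>(c, L, cl). cl @ map fst L)"

lemma mset_omit: "p < length xs \<Longrightarrow> mset xs = add_mset (xs ! p) (mset (omit p xs))"
  by (subst id_take_nth_drop[of p xs]) (auto simp: omit_def)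

lemma omit_append: "omit (length xs) (xs @ y # ys) = xs @ ys"
  by (simp add: omit_def)

lemma sum_list_concat_map: "(\<Sum>x\<leftarrow>concat (map g xs). f x) = (\<Sum>y\<leftarrow>xs. \<Sum>x\<leftarrow>g y. f x)"
  by (induction xs) auto

lemma sum_list_filter_upt: "(\<Sum>p\<leftarrow>filter P [0..<n]. f p) = (\<Sum>p<n. if P p then f p else 0)"
  by (simp add: sum_list_map_filter' interv_sum_list_conv_sum_set_nat atLeast0LessThan)

context q_levy
begin

text \<open>Creation starts with exponent 0, annihilation of a letter with exponent j produces the
  j-th moment, and preservation raises j by 1. Letters of other classes are skipped because their
  intervals will be disjoint from that of \<open>B\<close>. The power of \<open>q\<close> is the
  position of the letter counted from 0.\<close>

definition attach :: "nat set \<Rightarrow> wick_term \<Rightarrow> wick_term list"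
  where "attach B = (\<lambda>(c, L, cl). (c, (B, 0) # L, cl) # concat (map (\<lambda>p.
      [(c * q ^ p * moment (snd (L ! p)), omit p L, B # cl),
       (c * q ^ p, (B, Suc (snd (L ! p))) # omit p L, cl)])
    (filter (\<lambda>p. fst (L ! p) = B) [0..<length L])))"

text \<open>Creation adds a label, annihilation moves \<open>B\<close> from the letters to the
  annihilated classes, and preservation keeps it among the letters. So labels never
  disappear.\<close>

lemma attach_labels:
  assumes "\<sigma> \<in> set (attach B \<tau>)"
  shows "mset (labels \<sigma>) = add_mset B (mset (labels \<tau>)) \<or> B \<in> set (labels \<tau>) \<and> mset (labels \<sigma>) = mset (labels \<tau>)"
proof -
  obtain c L cl where \<tau>: "\<tau> = (c, L, cl)" by (cases \<tau>)
  have "mset (map fst L) = add_mset (fst (L ! p)) (mset (map fst (omit p L)))" "L ! p \<in> set L" if "p < length L" for p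
    using mset_omit[OF that] that by auto
  then show ?thesis
    using assms by (auto simp: attach_def labels_def \<tau> image_iff)
qed

lemma attach_value:
  assumes I: "bounded_borel (I B)" "\<And>b. b \<in> fst ` set (fst (snd \<tau>)) \<Longrightarrow> bounded_borel (I b)"
    and disj: "\<And>b. b \<in> fst ` set (fst (snd \<tau>)) \<Longrightarrow> b \<noteq> B \<Longrightarrow> I B \<inter> I b = {}"
  shows "tens_eq (tens_Y q \<nu> 1 (I B) (term_value I \<tau>)) (\<Sum>\<sigma>\<leftarrow>attach B \<tau>. term_value I \<sigma>)"
proof -
  obtain c L cl where \<tau>: "\<tau> = (c, L, cl)" by (cases \<tau>)
  define d where "d = complex_of_real (c * (\<Prod>b\<leftarrow>cl. measure rplus (I b)))"
  let ?L = "map (\<lambda>(b, j). (I b, j)) L"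
  define a where "a p = scale d
      (scale (complex_of_real (q ^ p * (measure rplus (I B \<inter> fst (?L ! p)) * moment (1 - 1 + snd (?L ! p))))) (word_vec (omit p ?L)) +
       scale (complex_of_real (q ^ p)) (word_vec ((I B \<inter> fst (?L ! p), 1 + snd (?L ! p)) # omit p ?L)))" for p
  have mem: "fst (L ! p) \<in> fst ` set L" if "p < length L" for p
    using that by auto
  have "tens_Y q \<nu> 1 (I B) (term_value I \<tau>) = scale d (tens_Y q \<nu> 1 (I B) (word_vec ?L))"
    by (simp add: term_value_def \<tau> d_def tens_Y_scale)
  also have "tens_Y q \<nu> 1 (I B) (word_vec ?L) = word_vec ((I B, 1 - 1) # ?L) + (\<Sum>p<length ?L.
      scale (complex_of_real (q ^ p * (measure rplus (I B \<inter> fst (?L ! p)) * moment (1 - 1 + snd (?L ! p))))) (word_vec (omit p ?L)) +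
      scale (complex_of_real (q ^ p)) (word_vec ((I B \<inter> fst (?L ! p), 1 + snd (?L ! p)) # omit p ?L)))"
    using I by (intro tens_Y_word_vec) (force simp: \<tau>)+
  also have "scale d \<dots> = term_value I (c, (B, 0) # L, cl) + (\<Sum>p<length L. a p)"
    by (simp add: formal.scale_right_distrib formal.scale_sum_right term_value_def d_def a_def)
  also have "tens_eq \<dots> (term_value I (c, (B, 0) # L, cl) + (\<Sum>p<length L. if fst (L ! p) = B then
      term_value I (c * q ^ p * moment (snd (L ! p)), omit p L, B # cl) +
      term_value I (c * q ^ p, (B, Suc (snd (L ! p))) # omit p L, cl) else 0))"
  proof (intro tens_eq_add tens_eq_refl tens_eq_sum)
    fix p assume "p \<in> {..<length L}"
    then have p: "p < length L" by simp
    show "tens_eq (a p) (if fst (L ! p) = B then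
      term_value I (c * q ^ p * moment (snd (L ! p)), omit p L, B # cl) +
      term_value I (c * q ^ p, (B, Suc (snd (L ! p))) # omit p L, cl) else 0)"
    proof (cases "fst (L ! p) = B")
      case True
      then have "a p = term_value I (c * q ^ p * moment (snd (L ! p)), omit p L, B # cl) +
        term_value I (c * q ^ p, (B, Suc (snd (L ! p))) # omit p L, cl)"
        using p by (simp add: a_def term_value_def d_def case_prod_unfold map_omit formal.scale_right_distrib mult_ac)
      then show ?thesis using True by simp
    next
      case False
      then have "I B \<inter> I (fst (L ! p)) = {}"
        using disj[of "fst (L ! p)"] mem[OF p] \<tau> by simp
      then have "a p = scale d (scale (complex_of_real (q ^ p)) (word_vec (({}, 1 + snd (?L ! p)) # omit p ?L)))"
        using p by (simp add: a_def case_prod_unfold)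
      moreover have "tens_eq (scale d (scale (complex_of_real (q ^ p)) (word_vec (({}, 1 + snd (?L ! p)) # omit p ?L))))
          (scale d (scale (complex_of_real (q ^ p)) 0))"
        by (intro tens_eq_scale word_vec_empty)
      ultimately show ?thesis using False by simp
    qed
  qed
  also have "term_value I (c, (B, 0) # L, cl) + (\<Sum>p<length L. if fst (L ! p) = B then
      term_value I (c * q ^ p * moment (snd (L ! p)), omit p L, B # cl) +
      term_value I (c * q ^ p, (B, Suc (snd (L ! p))) # omit p L, cl) else 0) = (\<Sum>\<sigma>\<leftarrow>attach B \<tau>. term_value I \<sigma>)"
    by (simp add: attach_def \<tau> sum_list_concat_map sum_list_filter_upt)
  finally show ?thesis .
qed

lemma attach_no_letter:
  assumes "B \<notin> fst ` set L"
  shows "attach B (c, L, cl) = [(c, (B, 0) # L, cl)]"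
proof -
  have "filter (\<lambda>p. fst (L ! p) = B) [0..<length L] = []"
    using assms by (auto simp: filter_empty_conv)
  then show ?thesis by (simp add: attach_def)
qed

lemma attach_one_letter:
  assumes "B \<notin> fst ` set La" "B \<notin> fst ` set Lb"
  shows "attach B (c, La @ (B, j) # Lb, cl) = [(c, (B, 0) # La @ (B, j) # Lb, cl),
    (c * q ^ length La * moment j, La @ Lb, B # cl), (c * q ^ length La, (B, Suc j) # La @ Lb, cl)]"
proof -
  let ?L = "La @ (B, j) # Lb"
  have "[0..<length ?L] = [0..<length La] @ length La # [Suc (length La)..<length ?L]"
    using upt_add_eq_append[of 0 "length La" "Suc (length Lb)"] by (simp add: upt_conv_Cons del: upt_Suc)
  moreover have "filter (\<lambda>p. fst (?L ! p) = B) [0..<length La] = []"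
    using assms(1) by (auto simp: filter_empty_conv nth_append)
  moreover have "filter (\<lambda>p. fst (?L ! p) = B) [Suc (length La)..<length ?L] = []"
    using assms(2) by (auto simp: filter_empty_conv nth_append nth_Cons split: nat.splits)
  ultimately have "filter (\<lambda>p. fst (?L ! p) = B) [0..<length ?L] = [length La]"
    by simp
  then show ?thesis
    by (simp add: attach_def omit_append)
qed

end

section \<open>Symbolic expansion for a fixed partition\<close>

locale partition_levy = q_levy +
  fixes n :: nat and \<pi> :: "nat set set"
  assumes part: "partition_on {1..n} \<pi>"
begin

definition class_of :: "nat \<Rightarrow> nat set"
  where "class_of i = (THE B. B \<in> \<pi> \<and> i \<in> B)"

lemma class_unique: "B \<in> \<pi> \<Longrightarrow> C \<in> \<pi> \<Longrightarrow> i \<in> B \<Longrightarrow> i \<in> C \<Longrightarrow> B = C"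
  using partition_onD2[OF part] by (auto simp: disjoint_def)

lemma class_of_eq: "B \<in> \<pi> \<Longrightarrow> i \<in> B \<Longrightarrow> class_of i = B"
  unfolding class_of_def by (rule the_equality) (use class_unique in blast)+

lemma class_of:
  assumes "1 \<le> i" "i \<le> n"
  shows "class_of i \<in> \<pi>" "i \<in> class_of i"
proof -
  have "i \<in> \<Union>\<pi>" using assms partition_onD1[OF part] by auto
  then obtain B where "B \<in> \<pi>" "i \<in> B" by auto
  then show "class_of i \<in> \<pi>" "i \<in> class_of i" using class_of_eq by auto
qed

lemma class_subset: "B \<in> \<pi> \<Longrightarrow> B \<subseteq> {1..n}"
  using partition_onD1[OF part] by auto

lemma class_finite: "B \<in> \<pi> \<Longrightarrow> finite B"
  using class_subset finite_subset by blast

lemma class_nonempty: "B \<in> \<pi> \<Longrightarrow> B \<noteq> {}"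
  using partition_onD3[OF part] by auto

lemma finite_partition: "finite \<pi>"
  using partition_onD1[OF part] by (metis finite_UnionD finite_atLeastAtMost)

lemma mem_class_iff: "1 \<le> i \<Longrightarrow> i \<le> n \<Longrightarrow> B \<in> \<pi> \<Longrightarrow> i \<in> B \<longleftrightarrow> class_of i = B"
  using class_of_eq class_of by auto

text \<open>At stage \<open>k\<close> the operators at the positions \<open>k + 1, \<dots>, n\<close> have been applied.\<close>

definition expansion :: "nat \<Rightarrow> wick_term list"
  where "expansion k = foldr (\<lambda>i ts. concat (map (attach (class_of i)) ts)) [Suc k..<Suc n] [(1, [], [])]"

definition partial_product :: "(nat set \<Rightarrow> real set) \<Rightarrow> nat \<Rightarrow> tens"
  where "partial_product I k = foldr (\<lambda>i. tens_Y q \<nu> 1 (I (class_of i))) [Suc k..<Suc n] (word_vec [])"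

lemma upt_stage: "k < n \<Longrightarrow> [Suc k..<Suc n] = Suc k # [Suc (Suc k)..<Suc n]"
  by (simp add: upt_conv_Cons)

lemma expansion_step:
  "k < n \<Longrightarrow> expansion k = concat (map (attach (class_of (Suc k))) (expansion (Suc k)))"
  by (simp add: expansion_def upt_stage del: upt_Suc)

lemma partial_product_step:
  "k < n \<Longrightarrow> partial_product I k = tens_Y q \<nu> 1 (I (class_of (Suc k))) (partial_product I (Suc k))"
  by (simp add: partial_product_def upt_stage del: upt_Suc)

text \<open>At stage 0 the labels exhaust \<pi>, so all terms are summed over the same injective
  assignments of cells to classes.\<close>

lemma expansion_labels:
  assumes "k \<le> n"
  shows "\<forall>\<tau>\<in>set (expansion k). set (labels \<tau>) = class_of ` {Suc k..n}"
  using assms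
proof (induction rule: inc_induct)
  case base
  then show ?case by (simp add: expansion_def labels_def)
next
  case (step k)
  show ?case
  proof
    fix \<sigma> assume "\<sigma> \<in> set (expansion k)"
    then obtain \<tau> where \<tau>: "\<tau> \<in> set (expansion (Suc k))" "\<sigma> \<in> set (attach (class_of (Suc k)) \<tau>)"
      using step by (auto simp: expansion_step)
    have "set (labels \<sigma>) = insert (class_of (Suc k)) (set (labels \<tau>))"
      using attach_labels[OF \<tau>(2)] by (metis insert_absorb set_mset_add_mset_insert set_mset_mset)
    moreover have "{Suc k..n} = insert (Suc k) {Suc (Suc k)..n}" using step by auto
    ultimately show "set (labels \<sigma>) = class_of ` {Suc k..n}"
      using step.IH \<tau>(1) by simp
  qed
qed

lemma partial_product_expansion:
  assumes "k \<le> n" and I: "\<And>b. b \<in> \<pi> \<Longrightarrow> bounded_borel (I b)"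
    and disj: "\<And>b c. b \<in> \<pi> \<Longrightarrow> c \<in> \<pi> \<Longrightarrow> b \<noteq> c \<Longrightarrow> I b \<inter> I c = {}"
  shows "partial_product I k \<in> step_tens"
    and "tens_eq (partial_product I k) (\<Sum>\<tau>\<leftarrow>expansion k. term_value I \<tau>)"
    and "\<forall>\<tau>\<in>set (expansion k). term_value I \<tau> \<in> step_tens"
proof -
  have lab: "fst ` set (fst (snd \<tau>)) \<subseteq> \<pi>" if "\<tau> \<in> set (expansion k)" "k \<le> n" for \<tau> k
  proof -
    have "fst ` set (fst (snd \<tau>)) \<subseteq> set (labels \<tau>)" by (auto simp: labels_def case_prod_unfold)
    also have "set (labels \<tau>) = class_of ` {Suc k..n}" using expansion_labels[OF that(2)] that(1) by blast
    also have "\<dots> \<subseteq> \<pi>" using class_of(1) by (intro image_subsetI) simp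
    finally show ?thesis .
  qed
  have val: "term_value I \<tau> \<in> step_tens" if "\<tau> \<in> set (expansion k)" "k \<le> n" for \<tau> k
    unfolding term_value_def case_prod_unfold
  proof (intro step_tens_scale word_vec_step_tens)
    fix J j assume "(J, j) \<in> set (map (\<lambda>p. (I (fst p), snd p)) (fst (snd \<tau>)))"
    then obtain b where "b \<in> fst ` set (fst (snd \<tau>))" "J = I b" by auto
    then show "bounded_borel J" using lab[OF that] I by blast
  qed
  then show "\<forall>\<tau>\<in>set (expansion k). term_value I \<tau> \<in> step_tens"
    using assms(1) by blast
  have "partial_product I k \<in> step_tens \<and> tens_eq (partial_product I k) (\<Sum>\<tau>\<leftarrow>expansion k. term_value I \<tau>)"
    using assms(1)
  proof (induction rule: inc_induct)
    case base
    show ?case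
      by (simp add: partial_product_def expansion_def term_value_def word_vec_Nil)
  next
    case (step k)
    let ?B = "class_of (Suc k)"
    have B: "?B \<in> \<pi>" using step by (intro class_of) auto
    have "partial_product I k \<in> step_tens"
      using step I[OF B] by (simp add: partial_product_step tens_Y_step_tens)
    moreover have "tens_eq (partial_product I k) (\<Sum>\<tau>\<leftarrow>expansion k. term_value I \<tau>)"
    proof -
      have "tens_eq (tens_Y q \<nu> 1 (I ?B) (partial_product I (Suc k)))
          (tens_Y q \<nu> 1 (I ?B) (\<Sum>\<tau>\<leftarrow>expansion (Suc k). term_value I \<tau>))"
        using step val by (intro tens_Y_cong I[OF B] step_tens_carrier step_tens_sum_list) auto
      also have "tens_Y q \<nu> 1 (I ?B) (\<Sum>\<tau>\<leftarrow>expansion (Suc k). term_value I \<tau>)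
         = (\<Sum>\<tau>\<leftarrow>expansion (Suc k). tens_Y q \<nu> 1 (I ?B) (term_value I \<tau>))"
        by (rule tens_Y_sum_list)
      also have "tens_eq \<dots> (\<Sum>\<tau>\<leftarrow>expansion (Suc k). \<Sum>\<sigma>\<leftarrow>attach ?B \<tau>. term_value I \<sigma>)"
      proof (intro tens_eq_sum_list attach_value I[OF B])
        fix \<tau> b assume \<tau>: "\<tau> \<in> set (expansion (Suc k))" and b: "b \<in> fst ` set (fst (snd \<tau>))"
        have "b \<in> \<pi>" using lab[OF \<tau>] step b by auto
        then show "bounded_borel (I b)" "b \<noteq> ?B \<Longrightarrow> I ?B \<inter> I b = {}"
          using I disj B by auto
      qed
      finally show ?thesis
        using step by (simp add: partial_product_step expansion_step sum_list_concat_map)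
    qed
    ultimately show ?case by simp
  qed
  then show "partial_product I k \<in> step_tens"
    "tens_eq (partial_product I k) (\<Sum>\<tau>\<leftarrow>expansion k. term_value I \<tau>)" by auto
qed

text \<open>Such a term has, or at stage 0 will have, a class occurring twice; only these terms vanish in the limit.\<close>

definition doomed :: "nat \<Rightarrow> wick_term \<Rightarrow> bool"
  where "doomed k \<tau> \<longleftrightarrow> \<not> distinct (labels \<tau>) \<or> (\<exists>b\<in>set (snd (snd \<tau>)). b \<inter> {1..k} \<noteq> {})"

text \<open>An operator that creates or preserves the letter of its class puts it at the front, so
  at stage \<open>k\<close> the letters stand in the order of the least elements above
  \<open>k\<close> of their classes. A class has a letter if it survives to the end, being in
  \<open>S\<close>, or if some of its operators are still to act; otherwise it has been
  annihilated.\<close>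

definition visible :: "nat \<Rightarrow> nat set set \<Rightarrow> nat \<Rightarrow> bool"
  where "visible k S i \<longleftrightarrow> class_of i \<inter> {Suc k..<i} = {} \<and> (class_of i \<in> S \<or> class_of i \<inter> {1..k} \<noteq> {})"

text \<open>One creation followed by preservations: the exponent is the number of operators of the
  class that have acted, minus 1.\<close>

definition good_letters :: "nat \<Rightarrow> nat set set \<Rightarrow> (nat set \<times> nat) list"
  where "good_letters k S = map (\<lambda>i. (class_of i, card (class_of i \<inter> {Suc k..n}) - 1))
    (filter (visible k S) [Suc k..<Suc n])"

definition good_closed :: "nat \<Rightarrow> nat set set \<Rightarrow> nat set list"
  where "good_closed k S = map class_of
    (filter (\<lambda>i. class_of i \<inter> {1..<i} = {} \<and> class_of i \<notin> S) [Suc k..<Suc n])"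

text \<open>The term in which, of the classes contained in \<open>{k + 1..n}\<close>, exactly those in \<open>S\<close> still have a letter.\<close>

definition good_term :: "nat \<Rightarrow> nat set set \<Rightarrow> wick_term"
  where "good_term k S = (q ^ (\<Sum>i=Suc k..n. rc_at i S \<pi>) * (\<Prod>b\<leftarrow>good_closed k S. r_moment \<nu> (card b)),
    good_letters k S, good_closed k S)"

definition completed :: "nat \<Rightarrow> nat set set"
  where "completed k = {C \<in> \<pi>. C \<inter> {1..k} = {}}"

text \<open>Labels never disappear, so a repetition stays. If an annihilated class is that of
  \<open>Suc k\<close> and labels are distinct, it has no letter left, and its operator can only
  create a second occurrence.\<close>

lemma doomed_attach:
  assumes k: "k < n" and d: "doomed (Suc k) \<tau>" and cl: "set (snd (snd \<tau>)) \<subseteq> \<pi>"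
    and \<sigma>: "\<sigma> \<in> set (attach (class_of (Suc k)) \<tau>)"
  shows "doomed k \<sigma>"
proof (cases "distinct (labels \<sigma>)")
  case True
  let ?B = "class_of (Suc k)"
  have dist: "distinct (labels \<tau>)"
  proof -
    have "distinct (labels \<sigma>) \<longleftrightarrow> distinct (?B # labels \<tau>)" if "mset (labels \<sigma>) = add_mset ?B (mset (labels \<tau>))"
      using that by (intro mset_eq_imp_distinct_iff) simp
    moreover have "distinct (labels \<sigma>) \<longleftrightarrow> distinct (labels \<tau>)" if "mset (labels \<sigma>) = mset (labels \<tau>)"
      using that by (rule mset_eq_imp_distinct_iff)
    ultimately show ?thesis using True attach_labels[OF \<sigma>] by auto
  qed
  obtain b where b: "b \<in> set (snd (snd \<tau>))" "b \<inter> {1..Suc k} \<noteq> {}"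
    using d dist by (auto simp: doomed_def)
  obtain c L cl' where \<tau>: "\<tau> = (c, L, cl')" by (cases \<tau>)
  have "set cl' \<subseteq> set (snd (snd \<sigma>))"
    using \<sigma> by (auto simp: attach_def \<tau>)
  then have b': "b \<in> set (snd (snd \<sigma>))" using b \<tau> by auto
  have "b \<noteq> ?B"
  proof
    assume "b = ?B"
    then have B: "?B \<in> set cl'" using b \<tau> by simp
    then have "?B \<notin> fst ` set L" using dist by (auto simp: labels_def \<tau>)
    then have "\<sigma> = (c, (?B, 0) # L, cl')" using \<sigma> by (simp add: \<tau> attach_no_letter)
    then show False using True B by (simp add: labels_def)
  qed
  then have "Suc k \<notin> b"
    using b(1) cl k by (metis class_of_eq subsetD)
  then have "b \<inter> {1..k} \<noteq> {}"
    using b(2) by (auto simp: le_Suc_eq)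
  with b' show ?thesis by (auto simp: doomed_def)
qed (simp add: doomed_def)

lemma good_term_not_doomed: "\<not> doomed k (good_term k S)"
proof -
  have inj: "inj_on class_of {i \<in> {Suc k..n}. class_of i \<inter> {Suc k..<i} = {}}"
  proof (rule linorder_inj_onI)
    fix i j assume "i < j" and i: "i \<in> {i \<in> {Suc k..n}. class_of i \<inter> {Suc k..<i} = {}}"
      and j: "j \<in> {i \<in> {Suc k..n}. class_of i \<inter> {Suc k..<i} = {}}"
    then have "i \<notin> class_of j" by auto
    then show "class_of i \<noteq> class_of j" using class_of(2)[of i] i by auto
  qed auto
  have "distinct (good_closed k S)"
    unfolding good_closed_def distinct_map
    by (intro conjI inj_on_subset[OF inj]) auto
  moreover have "distinct (map fst (good_letters k S))"
    unfolding good_letters_def map_map distinct_map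
    by (intro conjI) (simp_all add: comp_def, rule inj_on_subset[OF inj], auto simp: visible_def)
  moreover have closed: "b \<notin> S" "b \<inter> {1..k} = {}" if "b \<in> set (good_closed k S)" for b
  proof -
    obtain i where i: "Suc k \<le> i" "class_of i \<inter> {1..<i} = {}" "class_of i \<notin> S" "b = class_of i"
      using \<open>b \<in> set (good_closed k S)\<close> by (auto simp: good_closed_def)
    moreover have "{1..k} \<subseteq> {1..<i}" using i(1) by auto
    ultimately show "b \<notin> S" "b \<inter> {1..k} = {}" by auto
  qed
  moreover have "b \<in> S \<or> b \<inter> {1..k} \<noteq> {}" if "b \<in> fst ` set (good_letters k S)" for b
    using that by (auto simp: good_letters_def visible_def)
  ultimately have "distinct (good_closed k S @ map fst (good_letters k S))"
    unfolding distinct_append set_map by blast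
  then show ?thesis
    using closed(2) unfolding doomed_def good_term_def labels_def prod.case snd_conv by blast
qed

text \<open>\<open>S\<close> affects \<open>rc_at i\<close> only through classes without elements up
  to \<open>i\<close>. Deciding at the least element of a class whether it joins \<open>S\<close>
  therefore leaves the powers of \<open>q\<close> collected at larger positions unchanged.\<close>

lemma rc_at_insert:
  assumes "B \<inter> {1..i} \<noteq> {}"
  shows "rc_at i (insert B S) \<pi> = rc_at i S \<pi>"
proof -
  have "{C \<in> \<pi>. C \<inter> {i + 1..j - 1} \<noteq> {} \<and> (C \<in> insert B S \<or> C \<inter> {1..i} \<noteq> {})}
     = {C \<in> \<pi>. C \<inter> {i + 1..j - 1} \<noteq> {} \<and> (C \<in> S \<or> C \<inter> {1..i} \<noteq> {})}" for j
    using assms by auto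
  then show ?thesis by (simp only: rc_at_def)
qed

lemma visible_step:
  assumes k: "k < n" and S': "S' = S \<or> S' = insert (class_of (Suc k)) S" and i: "Suc k < i" "i \<le> n"
  shows "visible k S' i \<longleftrightarrow> visible (Suc k) S i \<and> class_of i \<noteq> class_of (Suc k)"
    and "class_of i \<noteq> class_of (Suc k) \<Longrightarrow> class_of i \<inter> {Suc k..n} = class_of i \<inter> {Suc (Suc k)..n}"
proof -
  have iff: "Suc k \<in> class_of i \<longleftrightarrow> class_of i = class_of (Suc k)"
    using mem_class_iff[of "Suc k" "class_of i"] class_of(1)[of i] i k by auto
  have s1: "{Suc k..<i} = insert (Suc k) {Suc (Suc k)..<i}" using i by auto
  have s2: "{1..Suc k} = insert (Suc k) {1..k}" by auto
  show "visible k S' i \<longleftrightarrow> visible (Suc k) S i \<and> class_of i \<noteq> class_of (Suc k)"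
    using iff S' unfolding visible_def s1 s2 by auto
  have "{Suc k..n} = insert (Suc k) {Suc (Suc k)..n}" using k by auto
  then show "class_of i \<noteq> class_of (Suc k) \<Longrightarrow> class_of i \<inter> {Suc k..n} = class_of i \<inter> {Suc (Suc k)..n}"
    using iff by auto
qed

text \<open>The letter of the current class is put at the front or removed. The others keep their
  order and exponents, since their classes do not contain \<open>Suc k\<close>.\<close>

lemma good_letters_step:
  assumes k: "k < n" and S': "S' = S \<or> S' = insert (class_of (Suc k)) S"
  shows "good_letters k S' = (if class_of (Suc k) \<in> S' \<or> class_of (Suc k) \<inter> {1..k} \<noteq> {}
      then [(class_of (Suc k), card (class_of (Suc k) \<inter> {Suc k..n}) - 1)] else [])
    @ filter (\<lambda>x. fst x \<noteq> class_of (Suc k)) (good_letters (Suc k) S)"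
proof -
  let ?B = "class_of (Suc k)" and ?R = "[Suc (Suc k)..<Suc n]"
  have "filter (visible k S') ?R = filter (\<lambda>i. class_of i \<noteq> ?B) (filter (visible (Suc k) S) ?R)"
    unfolding filter_filter using visible_step(1)[OF assms] by (intro filter_cong refl) auto
  moreover have "map (\<lambda>i. (class_of i, card (class_of i \<inter> {Suc k..n}) - 1))
      (filter (\<lambda>i. class_of i \<noteq> ?B) (filter (visible (Suc k) S) ?R))
    = map (\<lambda>i. (class_of i, card (class_of i \<inter> {Suc (Suc k)..n}) - 1))
      (filter (\<lambda>i. class_of i \<noteq> ?B) (filter (visible (Suc k) S) ?R))"
  proof (rule map_cong[OF refl])
    fix i assume "i \<in> set (filter (\<lambda>i. class_of i \<noteq> ?B) (filter (visible (Suc k) S) ?R))"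
    then have "Suc k < i" "i \<le> n" "class_of i \<noteq> ?B" by (auto simp del: upt_Suc)
    then show "(class_of i, card (class_of i \<inter> {Suc k..n}) - 1) = (class_of i, card (class_of i \<inter> {Suc (Suc k)..n}) - 1)"
      using visible_step(2)[OF assms] by simp
  qed
  ultimately have "map (\<lambda>i. (class_of i, card (class_of i \<inter> {Suc k..n}) - 1)) (filter (visible k S') ?R)
    = filter (\<lambda>x. fst x \<noteq> ?B) (good_letters (Suc k) S)"
    by (simp add: good_letters_def filter_map o_def del: upt_Suc)
  then show ?thesis
    unfolding good_letters_def[of k] upt_stage[OF k] by (simp add: visible_def[of k S' "Suc k"] del: upt_Suc)
qed

lemma good_closed_step:
  assumes k: "k < n" and S': "S' = S \<or> S' = insert (class_of (Suc k)) S"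
  shows "good_closed k S' = (if class_of (Suc k) \<inter> {1..k} = {} \<and> class_of (Suc k) \<notin> S'
      then [class_of (Suc k)] else []) @ good_closed (Suc k) S"
proof -
  have "class_of i \<inter> {1..<i} = {} \<and> class_of i \<notin> S' \<longleftrightarrow> class_of i \<inter> {1..<i} = {} \<and> class_of i \<notin> S"
    if i: "i \<in> set [Suc (Suc k)..<Suc n]" for i
  proof -
    have "class_of i \<noteq> class_of (Suc k)" if "class_of i \<inter> {1..<i} = {}"
      using class_of(2)[of "Suc k"] k i that by auto
    then show ?thesis using S' by auto
  qed
  then have "filter (\<lambda>i. class_of i \<inter> {1..<i} = {} \<and> class_of i \<notin> S') [Suc (Suc k)..<Suc n]
    = filter (\<lambda>i. class_of i \<inter> {1..<i} = {} \<and> class_of i \<notin> S) [Suc (Suc k)..<Suc n]"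
    by (rule filter_cong[OF refl])
  then show ?thesis
    unfolding good_closed_def[of k] good_closed_def[of "Suc k"] upt_stage[OF k]
    by (auto simp del: upt_Suc simp: atLeastLessThanSuc_atLeastAtMost)
qed

lemma good_rc_step:
  assumes k: "k < n" and S': "S' = S \<or> S' = insert (class_of (Suc k)) S"
  shows "(\<Sum>i=Suc k..n. rc_at i S' \<pi>) = rc_at (Suc k) S \<pi> + (\<Sum>i=Suc (Suc k)..n. rc_at i S \<pi>)"
proof -
  have "rc_at i S' \<pi> = rc_at i S \<pi>" if "i \<in> {Suc k..n}" for i
  proof -
    have "Suc k \<in> class_of (Suc k) \<inter> {1..i}" using that k class_of(2)[of "Suc k"] by auto
    then have "class_of (Suc k) \<inter> {1..i} \<noteq> {}" by blast
    from rc_at_insert[OF this] show ?thesis using S' by auto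
  qed
  then have "(\<Sum>i=Suc k..n. rc_at i S' \<pi>) = (\<Sum>i=Suc k..n. rc_at i S \<pi>)" by (intro sum.cong) auto
  then show ?thesis using k by (simp add: sum.atLeast_Suc_atMost)
qed

text \<open>Here \<open>Suc k\<close> is the largest element of its class, so its operator is the
  first of the class to act: it finds no letter of its own and has no crossing to count.\<close>

lemma good_letters_no_class:
  assumes k: "k < n" and "class_of (Suc k) \<inter> {Suc (Suc k)..n} = {}"
  shows "class_of (Suc k) \<notin> fst ` set (good_letters (Suc k) S)" "rc_at (Suc k) S \<pi> = 0"
proof -
  let ?B = "class_of (Suc k)"
  show "?B \<notin> fst ` set (good_letters (Suc k) S)"
  proof
    assume "?B \<in> fst ` set (good_letters (Suc k) S)"
    then obtain i where "class_of i = ?B" "Suc (Suc k) \<le> i" "i \<le> n"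
      by (auto simp: good_letters_def)
    then show False using class_of(2)[of i] assms by auto
  qed
  have B: "?B \<in> \<pi>" "Suc k \<in> ?B" using class_of[of "Suc k"] k by auto
  have "Max ?B = Suc k"
  proof (rule Max_eqI)
    fix y assume "y \<in> ?B"
    then show "y \<le> Suc k" using assms(2) class_subset[OF B(1)] by fastforce
  qed (use B class_finite in auto)
  then show "rc_at (Suc k) S \<pi> = 0"
    by (simp add: rc_at_def flip: class_of_def)
qed

text \<open>The letter of the class stands at its next element \<open>j\<close>, so the letters to
  its left stand at the visible positions strictly between \<open>Suc k\<close> and
  \<open>j\<close>. Sending such a position to its class is a bijection onto the classes counted by
  \<open>rc_at\<close>, which makes the power of \<open>q\<close> in \<open>attach\<close> a
  restricted crossing number.\<close>

lemma good_letters_split: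
  assumes k: "k < n" and ne: "class_of (Suc k) \<inter> {Suc (Suc k)..n} \<noteq> {}"
  obtains La Lb where
    "good_letters (Suc k) S = La @ (class_of (Suc k), card (class_of (Suc k) \<inter> {Suc (Suc k)..n}) - 1) # Lb"
    "class_of (Suc k) \<notin> fst ` set La" "class_of (Suc k) \<notin> fst ` set Lb" "length La = rc_at (Suc k) S \<pi>"
proof -
  let ?B = "class_of (Suc k)"
  have B: "?B \<in> \<pi>" "Suc k \<in> ?B" using class_of[of "Suc k"] k by auto
  define j where "j = Min (?B \<inter> {Suc (Suc k)..n})"
  have j: "j \<in> ?B" "Suc (Suc k) \<le> j" "j \<le> n" and jmin: "\<And>i. i \<in> ?B \<Longrightarrow> Suc (Suc k) \<le> i \<Longrightarrow> i \<le> n \<Longrightarrow> j \<le> i"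
    using Min_in[of "?B \<inter> {Suc (Suc k)..n}"] ne by (auto simp: j_def)
  have cj: "class_of j = ?B" using class_of_eq[OF B(1) j(1)] .
  let ?f = "\<lambda>i. (class_of i, card (class_of i \<inter> {Suc (Suc k)..n}) - 1)"
  let ?V = "visible (Suc k) S"
  define La where "La = map ?f (filter ?V [Suc (Suc k)..<j])"
  define Lb where "Lb = map ?f (filter ?V [Suc j..<Suc n])"
  have "[Suc (Suc k)..<Suc n] = [Suc (Suc k)..<j] @ j # [Suc j..<Suc n]"
    using j upt_add_eq_append[of "Suc (Suc k)" j "Suc n - j"] by (simp add: upt_conv_Cons del: upt_Suc)
  moreover have "?V j"
  proof -
    have "x \<notin> ?B" if "Suc (Suc k) \<le> x" "x < j" for x
      using jmin[of x] that j by auto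
    then show ?thesis using B(2) by (auto simp: visible_def cj)
  qed
  ultimately have "good_letters (Suc k) S = La @ (?B, card (?B \<inter> {Suc (Suc k)..n}) - 1) # Lb"
    by (simp add: good_letters_def La_def Lb_def cj del: upt_Suc)
  moreover have "?B \<notin> fst ` set La"
  proof
    assume "?B \<in> fst ` set La"
    then obtain i where i: "class_of i = ?B" "Suc (Suc k) \<le> i" "i < j" by (auto simp: La_def)
    then show False using jmin[of i] class_of(2)[of i] j by auto
  qed
  moreover have "?B \<notin> fst ` set Lb"
  proof
    assume "?B \<in> fst ` set Lb"
    then obtain i where i: "class_of i = ?B" "j < i" "?V i" by (auto simp: Lb_def)
    then show False using j by (auto simp: visible_def)
  qed
  moreover have "length La = rc_at (Suc k) S \<pi>"
  proof -
    let ?M = "{C \<in> \<pi>. C \<inter> {Suc k + 1..j - 1} \<noteq> {} \<and> (C \<in> S \<or> C \<inter> {1..Suc k} \<noteq> {})}"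
    have js: "{Suc (Suc k)..<j} = {Suc k + 1..j - 1}" using j by auto
    have "Max ?B \<ge> j" using j class_finite[OF B(1)] by simp
    then have "Suc k \<noteq> Max ?B" using j by linarith
    moreover have "Min {i \<in> ?B. i > Suc k} = j"
      using class_finite[OF B(1)] j jmin class_subset[OF B(1)] by (intro Min_eqI) auto
    ultimately have rc: "rc_at (Suc k) S \<pi> = card ?M"
      by (simp add: rc_at_def Let_def flip: class_of_def)
    let ?W = "{i \<in> {Suc (Suc k)..<j}. ?V i}"
    have "length La = card ?W"
      unfolding La_def length_map by (subst distinct_card[symmetric]) (auto intro!: arg_cong[where f = card])
    also have "\<dots> = card ?M"
    proof (rule bij_betw_same_card[of class_of], rule bij_betwI')
      fix x y assume x: "x \<in> ?W" and y: "y \<in> ?W"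
      show "(class_of x = class_of y) = (x = y)"
      proof
        assume eq: "class_of x = class_of y"
        have "x \<in> class_of y" "y \<in> class_of x"
          using class_of(2)[of x] class_of(2)[of y] x y j eq by auto
        then have "\<not> x < y" "\<not> y < x"
          using x y by (auto simp: visible_def)
        then show "x = y" by simp
      qed simp
    next
      fix x assume x: "x \<in> ?W"
      then have "class_of x \<in> \<pi>" "x \<in> class_of x" using class_of[of x] j by auto
      moreover have "x \<in> {Suc k + 1..j - 1}" using x js by auto
      ultimately show "class_of x \<in> ?M" using x unfolding visible_def by blast
    next
      fix C assume C: "C \<in> ?M"
      \<comment> \<open>A counted class is visible at its least element in the gap.\<close>
      define i where "i = Min (C \<inter> {Suc (Suc k)..<j})"
      have ne: "C \<inter> {Suc (Suc k)..<j} \<noteq> {}" using C js by auto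
      then have i: "i \<in> C" "Suc (Suc k) \<le> i" "i < j"
        using Min_in[of "C \<inter> {Suc (Suc k)..<j}"] by (auto simp: i_def)
      have imin: "i \<le> l" if "l \<in> C" "Suc (Suc k) \<le> l" "l < j" for l
        unfolding i_def using that by (intro Min_le) auto
      have "class_of i = C" using C i class_of_eq by auto
      moreover have "?V i"
        unfolding visible_def \<open>class_of i = C\<close> using C imin i by fastforce
      ultimately show "\<exists>x\<in>?W. C = class_of x" using i by auto
    qed
    finally show ?thesis using rc by simp
  qed
  ultimately show thesis by (rule that)
qed

end

context q_levy
begin

text \<open>A good term that leaves a singleton out of \<open>S\<close> has the factor
  \<open>r_moment \<nu> 1 = 0\<close> and is not produced by \<open>attach\<close>; its formal
  descendants must count as 0 as well.\<close>

lemma attach_zero: "\<sigma> \<in> set (attach B (0, L, cl)) \<Longrightarrow> fst \<sigma> = 0"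
  by (auto simp: attach_def)

end

context partition_levy
begin

lemma good_term_step:
  assumes k: "k < n" and S': "S' = S \<or> S' = insert (class_of (Suc k)) S"
  shows "good_term k S' = (q ^ rc_at (Suc k) S \<pi> * (if class_of (Suc k) \<inter> {1..k} = {} \<and> class_of (Suc k) \<notin> S'
        then r_moment \<nu> (card (class_of (Suc k))) else 1) * fst (good_term (Suc k) S),
      (if class_of (Suc k) \<in> S' \<or> class_of (Suc k) \<inter> {1..k} \<noteq> {}
        then [(class_of (Suc k), card (class_of (Suc k) \<inter> {Suc (Suc k)..n}))] else [])
        @ filter (\<lambda>x. fst x \<noteq> class_of (Suc k)) (good_letters (Suc k) S),
      (if class_of (Suc k) \<inter> {1..k} = {} \<and> class_of (Suc k) \<notin> S' then [class_of (Suc k)] else []) @ good_closed (Suc k) S)"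
proof -
  have "class_of (Suc k) \<inter> {Suc k..n} = insert (Suc k) (class_of (Suc k) \<inter> {Suc (Suc k)..n})"
    using class_of(2)[of "Suc k"] k by auto
  then have "card (class_of (Suc k) \<inter> {Suc k..n}) - 1 = card (class_of (Suc k) \<inter> {Suc (Suc k)..n})"
    by simp
  then show ?thesis
    using good_rc_step[OF assms] good_closed_step[OF assms] good_letters_step[OF assms]
    by (simp add: good_term_def power_add)
qed

text \<open>If \<open>B\<close> has no letter, only creation occurs. Otherwise creation repeats
  \<open>B\<close> and is doomed, preservation is good, and annihilation is good exactly when no
  operator of \<open>B\<close> remains, that is, when \<open>B \<inter> {1..k} = {}\<close>. In that
  case the two outcomes are the choices of \<open>B\<close> outside or inside
  \<open>S\<close>.\<close>

lemma good_step_sum: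
  fixes g :: "wick_term \<Rightarrow> 'b :: comm_monoid_add"
  assumes g0: "\<And>L cl. g (0, L, cl) = 0" and k: "k < n" and S: "S \<subseteq> completed (Suc k)"
  defines "B \<equiv> class_of (Suc k)"
  shows "(\<Sum>\<sigma>\<leftarrow>filter (\<lambda>\<sigma>. \<not> doomed k \<sigma>) (attach B (good_term (Suc k) S)). g \<sigma>)
    = (if B \<inter> {1..k} = {} then g (good_term k S) + g (good_term k (insert B S)) else g (good_term k S))"
proof -
  have B: "B \<in> \<pi>" "Suc k \<in> B" using class_of[of "Suc k"] k by (auto simp: B_def)
  have BS: "B \<notin> S"
  proof
    assume "B \<in> S"
    then have "B \<inter> {1..Suc k} = {}" using S unfolding completed_def by blast
    then have "Suc k \<notin> {1..Suc k}" using B(2) by blast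
    then show False by simp
  qed
  define m where "m = card (B \<inter> {Suc (Suc k)..n})"
  define c where "c = fst (good_term (Suc k) S)"
  let ?L = "good_letters (Suc k) S" and ?cl = "good_closed (Suc k) S"
  have \<tau>: "good_term (Suc k) S = (c, ?L, ?cl)" by (simp add: c_def good_term_def)
  have card_B: "card B = Suc m" if "B \<inter> {1..k} = {}"
  proof -
    have "B = insert (Suc k) (B \<inter> {Suc (Suc k)..n})"
    proof (rule set_eqI)
      fix x
      have "x \<notin> {1..k}" "x \<in> {1..n}" if "x \<in> B"
        using class_subset[OF B(1)] \<open>B \<inter> {1..k} = {}\<close> that by blast+
      then have "x \<in> B \<Longrightarrow> 1 \<le> x \<and> x \<le> n \<and> \<not> x \<le> k" by auto
      then show "x \<in> B \<longleftrightarrow> x \<in> insert (Suc k) (B \<inter> {Suc (Suc k)..n})" using B(2) by auto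
    qed
    then show ?thesis unfolding m_def by (metis Int_iff Suc_n_not_le_n atLeastAtMost_iff card_insert_disjoint finite_Int finite_atLeastAtMost)
  qed
  note gs = good_term_step[OF k, where S = S, folded B_def, folded m_def c_def]
  show ?thesis
  proof (cases "B \<inter> {Suc (Suc k)..n} = {}")
    case True
    then have m: "m = 0" by (simp add: m_def)
    note nl = good_letters_no_class[OF k, folded B_def, OF True, of S]
    have f: "filter (\<lambda>x. fst x \<noteq> B) ?L = ?L"
      using nl(1) by (auto simp: filter_id_conv)
    have at: "attach B (good_term (Suc k) S) = [(c, (B, 0) # ?L, ?cl)]"
      unfolding \<tau> using nl(1) by (rule attach_no_letter)
    show ?thesis
    proof (cases "B \<inter> {1..k} = {}")
      case True
      have 1: "good_term k (insert B S) = (c, (B, 0) # ?L, ?cl)"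
        using gs[of "insert B S"] True nl(2) m f by simp
      \<comment> \<open>A singleton cannot be annihilated, and the formula with two terms still
        holds because \<open>r_moment \<nu> 1 = 0\<close>.\<close>
      have 2: "g (good_term k S) = 0"
        using gs[of S] True BS card_B m by (simp add: r_moment_def g0)
      show ?thesis
        using good_term_not_doomed[of k "insert B S"] True 2 unfolding at 1 by simp
    next
      case False
      have 1: "good_term k S = (c, (B, 0) # ?L, ?cl)"
        using gs[of S] False nl(2) m f by simp
      show ?thesis
        using good_term_not_doomed[of k S] False unfolding at 1 by simp
    qed
  next
    case False
    obtain La Lb where L: "?L = La @ (B, m - 1) # Lb" "B \<notin> fst ` set La" "B \<notin> fst ` set Lb"
      "length La = rc_at (Suc k) S \<pi>"
      using good_letters_split[OF k False[unfolded B_def], of S] unfolding B_def m_def by blast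
    have m: "0 < m" unfolding m_def using False by (simp add: card_gt_0_iff)
    have f: "filter (\<lambda>x. fst x \<noteq> B) ?L = La @ Lb"
    proof -
      have "filter (\<lambda>x. fst x \<noteq> B) La = La" "filter (\<lambda>x. fst x \<noteq> B) Lb = Lb"
        using L(2,3) by (auto simp: filter_id_conv)
      then show ?thesis by (simp add: L(1))
    qed
    have at: "attach B (good_term (Suc k) S) = [(c, (B, 0) # La @ (B, m - 1) # Lb, ?cl),
        (c * q ^ rc_at (Suc k) S \<pi> * moment (m - 1), La @ Lb, B # ?cl),
        (c * q ^ rc_at (Suc k) S \<pi>, (B, m) # La @ Lb, ?cl)]"
      unfolding \<tau> L(1) using attach_one_letter[OF L(2,3)] m by (simp add: L(4))
    have d: "doomed k (c, (B, 0) # La @ (B, m - 1) # Lb, ?cl)"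
      by (simp add: doomed_def labels_def)
    show ?thesis
    proof (cases "B \<inter> {1..k} = {}")
      case True
      have 1: "good_term k (insert B S) = (c * q ^ rc_at (Suc k) S \<pi>, (B, m) # La @ Lb, ?cl)"
        using gs[of "insert B S"] True f by (simp add: mult.commute)
      have "r_moment \<nu> (card B) = moment (m - 1)"
        using card_B[OF True] m by (simp add: r_moment_def moment_def)
      then have 2: "good_term k S = (c * q ^ rc_at (Suc k) S \<pi> * moment (m - 1), La @ Lb, B # ?cl)"
        using gs[of S] True BS f by (simp add: mult_ac)
      show ?thesis
        using good_term_not_doomed[of k S] good_term_not_doomed[of k "insert B S"] True d unfolding at 1 2 by simp
    next
      case False
      have 1: "good_term k S = (c * q ^ rc_at (Suc k) S \<pi>, (B, m) # La @ Lb, ?cl)"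
        using gs[of S] False f by (simp add: mult.commute)
      have "doomed k (c * q ^ rc_at (Suc k) S \<pi> * moment (m - 1), La @ Lb, B # ?cl)"
        using False unfolding doomed_def by simp
      then show ?thesis
        using good_term_not_doomed[of k S] False d unfolding at 1 by simp
    qed
  qed
qed

text \<open>The values \<open>g\<close> are kept abstract so that the induction hypothesis can be applied to the sum of the
  original values over the terms obtained in one step.\<close>

lemma good_expansion_sum:
  assumes "k \<le> n"
  shows "\<forall>g :: wick_term \<Rightarrow> tens. (\<forall>L cl. g (0, L, cl) = 0) \<longrightarrow>
    (\<Sum>\<sigma>\<leftarrow>filter (\<lambda>\<sigma>. \<not> doomed k \<sigma>) (expansion k). g \<sigma>) = (\<Sum>S\<in>Pow (completed k). g (good_term k S))"
  using assms
proof (induction rule: inc_induct)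
  case base
  have "completed n = {}"
    using class_subset class_nonempty by (fastforce simp: completed_def)
  then show ?case
    by (simp add: expansion_def doomed_def labels_def good_term_def good_letters_def good_closed_def)
next
  case (step k)
  let ?B = "class_of (Suc k)"
  have B: "?B \<in> \<pi>" "Suc k \<in> ?B" using class_of[of "Suc k"] step by auto
  show ?case
  proof (intro allI impI)
    fix g :: "wick_term \<Rightarrow> tens" assume g0: "\<forall>L cl. g (0, L, cl) = 0"
    define h where "h \<tau> = (\<Sum>\<sigma>\<leftarrow>filter (\<lambda>\<sigma>. \<not> doomed k \<sigma>) (attach ?B \<tau>). g \<sigma>)" for \<tau>
    have h0: "h (0, L, cl) = 0" for L cl
    proof -
      have "g \<sigma> = 0" if "\<sigma> \<in> set (attach ?B (0, L, cl))" for \<sigma>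
        using attach_zero[OF that] g0 by (cases \<sigma>) simp
      then have "map g (filter (\<lambda>\<sigma>. \<not> doomed k \<sigma>) (attach ?B (0, L, cl)))
          = map (\<lambda>_. 0) (filter (\<lambda>\<sigma>. \<not> doomed k \<sigma>) (attach ?B (0, L, cl)))"
        by (intro map_cong) auto
      then show ?thesis unfolding h_def by (simp only: sum_list_0)
    qed
    have "(\<Sum>\<sigma>\<leftarrow>filter (\<lambda>\<sigma>. \<not> doomed k \<sigma>) (expansion k). g \<sigma>) = (\<Sum>\<tau>\<leftarrow>expansion (Suc k). h \<tau>)"
      using step by (simp add: expansion_step filter_concat o_def sum_list_concat_map h_def)
    \<comment> \<open>Doomed terms have only doomed successors, so \<open>h\<close> vanishes on
      them.\<close>
    also have "\<dots> = (\<Sum>\<tau>\<leftarrow>filter (\<lambda>\<sigma>. \<not> doomed (Suc k) \<sigma>) (expansion (Suc k)). h \<tau>)"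
    proof (rule sum_list_map_filter[symmetric])
      fix \<tau> assume \<tau>: "\<tau> \<in> set (expansion (Suc k))" and d: "\<not> \<not> doomed (Suc k) \<tau>"
      have "set (snd (snd \<tau>)) \<subseteq> set (labels \<tau>)" by (auto simp: labels_def case_prod_unfold)
      also have "\<dots> = class_of ` {Suc (Suc k)..n}" using expansion_labels[of "Suc k"] step \<tau> by auto
      also have "\<dots> \<subseteq> \<pi>" using class_of(1) by (intro image_subsetI) simp
      finally have "filter (\<lambda>\<sigma>. \<not> doomed k \<sigma>) (attach ?B \<tau>) = []"
        using doomed_attach[of k \<tau>] step d by (auto simp: filter_empty_conv)
      then show "h \<tau> = 0" by (simp add: h_def)
    qed
    also have "\<dots> = (\<Sum>S\<in>Pow (completed (Suc k)). h (good_term (Suc k) S))"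
      using step.IH h0 by blast
    also have "\<dots> = (\<Sum>S\<in>Pow (completed (Suc k)). if ?B \<inter> {1..k} = {}
        then g (good_term k S) + g (good_term k (insert ?B S)) else g (good_term k S))"
      unfolding h_def using step g0 by (intro sum.cong refl good_step_sum) auto
    \<comment> \<open>If \<open>Suc k\<close> is the least element of its class, the subsets of
      \<open>completed k\<close> split according to whether they contain that class; otherwise this
      step completes no class.\<close>
    also have "\<dots> = (\<Sum>S\<in>Pow (completed k). g (good_term k S))"
    proof (cases "?B \<inter> {1..k} = {}")
      case True
      have s2: "{1..Suc k} = insert (Suc k) {1..k}" by auto
      have "completed k = insert ?B (completed (Suc k))"
      proof -
        have "Suc k \<notin> C" if "C \<in> \<pi>" "C \<noteq> ?B" for C using class_of_eq[of C "Suc k"] that by auto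
        then show ?thesis using B True unfolding completed_def s2 by blast
      qed
      moreover have nB: "?B \<notin> completed (Suc k)" using B(2) by (auto simp: completed_def)
      moreover have fin: "finite (completed (Suc k))" using finite_partition by (simp add: completed_def)
      moreover have "inj_on (insert ?B) (Pow (completed (Suc k)))"
        by (rule inj_onI, subst (asm) insert_ident) (use nB in auto)
      moreover have "Pow (completed (Suc k)) \<inter> insert ?B ` Pow (completed (Suc k)) = {}"
        using nB by auto
      ultimately have "(\<Sum>S\<in>Pow (completed k). g (good_term k S)) = (\<Sum>S\<in>Pow (completed (Suc k)). g (good_term k S))
          + (\<Sum>S\<in>Pow (completed (Suc k)). g (good_term k (insert ?B S)))"
        by (simp add: Pow_insert sum.union_disjoint sum.reindex)
      then show ?thesis unfolding if_P[OF True] sum.distrib ..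
    next
      case False
      have s2: "{1..Suc k} = insert (Suc k) {1..k}" by auto
      have "completed k = completed (Suc k)"
      proof -
        have "Suc k \<notin> C" if "C \<in> \<pi>" "C \<noteq> ?B" for C using class_of_eq[of C "Suc k"] that by auto
        then show ?thesis using B False unfolding completed_def s2 by blast
      qed
      then show ?thesis unfolding if_not_P[OF False] by simp
    qed
    finally show "(\<Sum>\<sigma>\<leftarrow>filter (\<lambda>\<sigma>. \<not> doomed k \<sigma>) (expansion k). g \<sigma>)
       = (\<Sum>S\<in>Pow (completed k). g (good_term k S))" .
  qed
qed

section \<open>Stage 0: all operators have acted\<close>

lemma completed_zero: "completed 0 = \<pi>"
  by (auto simp: completed_def)

lemma initial_iff: "1 \<le> i \<Longrightarrow> i \<le> n \<Longrightarrow> class_of i \<inter> {1..<i} = {} \<longleftrightarrow> i = Min (class_of i)"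
proof -
  assume i: "1 \<le> i" "i \<le> n"
  note c = class_of[OF i]
  show ?thesis
  proof
    assume e: "class_of i \<inter> {1..<i} = {}"
    have "i \<le> y" if "y \<in> class_of i" for y
    proof (rule ccontr)
      assume "\<not> i \<le> y"
      then have "y \<in> class_of i \<inter> {1..<i}" using that class_subset[OF c(1)] by auto
      then show False using e by blast
    qed
    then show "i = Min (class_of i)"
      using c class_finite by (intro Min_eqI[symmetric]) auto
  next
    assume m: "i = Min (class_of i)"
    have "i \<le> y" if "y \<in> class_of i" for y
      using Min_le[OF class_finite[OF c(1)] that] m by simp
    then show "class_of i \<inter> {1..<i} = {}" by force
  qed
qed

lemma class_Min:
  assumes "C \<in> \<pi>"
  shows "1 \<le> Min C" "Min C \<le> n" "class_of (Min C) = C"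
proof -
  have "Min C \<in> C" using assms class_finite class_nonempty by (intro Min_in) auto
  then show "1 \<le> Min C" "Min C \<le> n" "class_of (Min C) = C"
    using class_subset[OF assms] class_of_eq[OF assms] by auto
qed

lemma good_closed_zero:
  assumes "S \<subseteq> \<pi>"
  shows "distinct (good_closed 0 S)" "set (good_closed 0 S) = \<pi> - S"
proof -
  show "distinct (good_closed 0 S)"
    using good_term_not_doomed[of 0 S] by (simp add: doomed_def labels_def good_term_def)
  have "C \<in> set (good_closed 0 S)" if "C \<in> \<pi> - S" for C
    using that class_Min[of C] initial_iff[of "Min C"] unfolding good_closed_def
    by (auto intro!: image_eqI[of _ _ "Min C"])
  then show "set (good_closed 0 S) = \<pi> - S"
    using class_of(1) by (auto simp: good_closed_def)
qed

text \<open>At stage 0 the visible positions are the minima of the classes in \<open>S\<close>, so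
  the letters come in the order of \<open>sorted_key_list_of_set Min\<close>. A class of size m has
  exponent m - 1, which is the one created by \<open>Y\<close> with index m.\<close>

lemma good_letters_zero:
  assumes S: "S \<subseteq> \<pi>"
  shows "map snd (good_letters 0 S) = map (\<lambda>k. k - 1) (class_sizes S)"
    and "length (good_letters 0 S) = length (class_sizes S)"
proof -
  define xs where "xs = filter (visible 0 S) [Suc 0..<Suc n]"
  have vis: "visible 0 S i \<longleftrightarrow> i = Min (class_of i) \<and> class_of i \<in> S" if "1 \<le> i" "i \<le> n" for i
    using initial_iff[OF that] by (simp add: visible_def)
  have key: "map Min (map class_of xs) = xs"
  proof -
    have "map (\<lambda>i. Min (class_of i)) xs = map (\<lambda>i. i) xs"
      by (rule map_cong[OF refl]) (use vis in \<open>auto simp: xs_def\<close>)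
    then show ?thesis by (simp add: o_def)
  qed
  have "set (map class_of xs) = S"
  proof
    show "set (map class_of xs) \<subseteq> S" by (auto simp: xs_def visible_def)
    show "S \<subseteq> set (map class_of xs)"
    proof
      fix C assume "C \<in> S"
      then have "Min C \<in> set xs" "class_of (Min C) = C"
        using class_Min[of C] S vis[of "Min C"] by (auto simp: xs_def)
      then show "C \<in> set (map class_of xs)" by (metis image_eqI set_map)
    qed
  qed
  moreover have "sorted (map Min (map class_of xs))" "distinct (map class_of xs)"
  proof -
    show "sorted (map Min (map class_of xs))" unfolding key by (simp add: xs_def sorted_wrt_filter del: upt_Suc)
    have "distinct (map Min (map class_of xs))" unfolding key by (simp add: xs_def del: upt_Suc)
    then show "distinct (map class_of xs)" unfolding distinct_map by blast
  qed
  moreover have "inj_on Min \<pi>"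
    using class_Min(3) by (intro inj_on_inverseI[of _ class_of]) auto
  ultimately have eq: "sorted_key_list_of_set Min S = map class_of xs"
    using folding_insort_key.idem_if_sorted_distinct[of "(\<le>)" "(<)" \<pi> Min "map class_of xs"] S
    by (simp add: folding_insort_key_def folding_insort_key_axioms_def linorder_class.linorder_axioms
        linorder_class.sorted_key_list_of_set_dict)
  have "card (class_of i \<inter> {Suc 0..n}) = card (class_of i)" if "i \<in> set xs" for i
  proof -
    have "class_of i \<inter> {Suc 0..n} = class_of i"
    proof -
      have "1 \<le> i" "i \<le> n" using that by (auto simp: xs_def simp del: upt_Suc)
      then show ?thesis using class_subset[OF class_of(1)] by (simp add: Int_absorb2)
    qed
    then show ?thesis by simp
  qed
  then show "map snd (good_letters 0 S) = map (\<lambda>k. k - 1) (class_sizes S)"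
    by (simp add: good_letters_def class_sizes_def eq xs_def[symmetric] del: upt_Suc)
  then show "length (good_letters 0 S) = length (class_sizes S)"
    by (metis length_map)
qed

end

section \<open>The limit of the partition sums\<close>

context q_levy
begin

text \<open>Norm bounds for step words reduce the claim to box sums. With distinct labels these
  approach the full box with a factor \<open>t\<close> for each annihilated class; with a repeated
  label they approach 0.\<close>

lemma partition_term_estimate:
  fixes cl lb :: "'a list"
  assumes sub: "subdivision t Is" and t: "0 < t" and A: "A = set cl \<union> set lb" and len: "length lb = length ks"
  shows "(tens_norm q \<nu> ((\<Sum>v\<in>{v \<in> A \<rightarrow>\<^sub>E {..<length Is}. inj_on v A}.
      scale (complex_of_real (\<Prod>b\<leftarrow>cl. measure rplus (Is ! v b))) (step_word (map (\<lambda>b. Is ! v b) lb) ks))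
      - (if distinct (cl @ lb) then scale (complex_of_real (t ^ length cl)) (step_word (replicate (length lb) {0..<t}) ks) else 0)))\<^sup>2
    \<le> step_bound ks * (mesh Is * estimate (max 1 t) (length cl) (length lb) (card A))"
proof -
  let ?V = "{v \<in> A \<rightarrow>\<^sub>E {..<length Is}. inj_on v A}"
  let ?c = "\<lambda>v. complex_of_real (\<Prod>b\<leftarrow>cl. measure rplus (Is ! v b))"
  let ?J = "\<lambda>v. map (\<lambda>b. Is ! v b) lb"
  have "finite (A \<rightarrow>\<^sub>E {..<length Is})" using A by (intro finite_PiE) auto
  then have fin: "finite ?V" by simp
  have J: "bounded_borel I" if "v \<in> ?V" "I \<in> set (?J v)" for v I
    using that A by (auto intro!: subdivision_bounded_borel[OF sub] dest: PiE_mem)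
  show ?thesis
  proof (cases "distinct (cl @ lb)")
    case False
    have "(tens_norm q \<nu> (\<Sum>v\<in>?V. scale (?c v) (step_word (?J v) ks)))\<^sup>2
      \<le> step_bound ks * (\<integral>x. (cmod (\<Sum>v\<in>?V. ?c v * box_ind (?J v) x))\<^sup>2 \<partial>rplus_pow (length ks))"
      using J len by (intro step_word_norm fin) auto
    also have "\<dots> \<le> step_bound ks * (mesh Is * estimate (max 1 t) (length cl) (length lb) (card A))"
      using False unfolding len[symmetric]
      by (intro mult_left_mono step_bound_nonneg label_sum_estimate[OF sub t A]) auto
    finally show ?thesis unfolding if_not_P[OF False] diff_zero .
  next
    case True
    obtain vs where vs: "set vs = ?V" "distinct vs" using finite_distinct_list[OF fin] by blast
    \<comment> \<open>The limit enters as one more box with negative coefficient, so that one norm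
      bound covers the difference.\<close>
    define G :: simple where "G = map (\<lambda>v. (?c v, ?J v)) vs @ [(- complex_of_real (t ^ length cl), replicate (length lb) {0..<t})]"
    have "(\<Sum>(c, Is)\<leftarrow>G. scale c (step_word Is ks)) = (\<Sum>v\<in>?V. scale (?c v) (step_word (?J v) ks))
        - scale (complex_of_real (t ^ length cl)) (step_word (replicate (length lb) {0..<t}) ks)"
      by (simp add: G_def o_def sum_list_distinct_conv_sum_set[OF vs(2)] vs(1))
    moreover have "simple_fun G x = (\<Sum>v\<in>?V. ?c v * box_ind (?J v) x)
        - complex_of_real (t ^ length cl) * box_ind (replicate (length lb) {0..<t}) x" for x
      by (simp add: simple_fun_def G_def o_def sum_list_distinct_conv_sum_set[OF vs(2)] vs(1))
    moreover have "(tens_norm q \<nu> (\<Sum>(c, Is)\<leftarrow>G. scale c (step_word Is ks)))\<^sup>2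
      \<le> step_bound ks * (\<integral>x. (cmod (simple_fun G x))\<^sup>2 \<partial>rplus_pow (length ks))"
      using J len vs(1) by (intro step_word_norm_list) (auto simp: G_def)
    moreover have "step_bound ks * (\<integral>x. (cmod ((\<Sum>v\<in>?V. ?c v * box_ind (?J v) x)
        - complex_of_real (t ^ length cl) * box_ind (replicate (length lb) {0..<t}) x))\<^sup>2 \<partial>rplus_pow (length ks))
      \<le> step_bound ks * (mesh Is * estimate (max 1 t) (length cl) (length lb) (card A))"
      unfolding len[symmetric]
      by (intro mult_left_mono step_bound_nonneg injective_sum_estimate[OF sub t A True])
    ultimately show ?thesis unfolding if_P[OF True] by simp
  qed
qed

definition limit_value :: "real \<Rightarrow> wick_term \<Rightarrow> tens"
  where "limit_value t = (\<lambda>(c, L, cl). scale (complex_of_real (c * t ^ length cl))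
    (step_word (replicate (length L) {0..<t}) (map snd L)))"

definition term_bound :: "real \<Rightarrow> wick_term \<Rightarrow> real"
  where "term_bound t = (\<lambda>(c, L, cl). \<bar>c\<bar> * sqrt (step_bound (map snd L) *
    estimate (max 1 t) (length cl) (length L) (card (set cl \<union> fst ` set L))))"

lemma term_value_estimate:
  assumes sub: "subdivision t Is" and t: "0 < t" and A: "A = set (labels \<tau>)"
  shows "tens_norm q \<nu> ((\<Sum>v\<in>{v \<in> A \<rightarrow>\<^sub>E {..<length Is}. inj_on v A}. term_value (\<lambda>b. Is ! v b) \<tau>)
      - (if distinct (labels \<tau>) then limit_value t \<tau> else 0)) \<le> sqrt (mesh Is) * term_bound t \<tau>"
proof -
  obtain c L cl where \<tau>: "\<tau> = (c, L, cl)" by (cases \<tau>)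
  let ?V = "{v \<in> A \<rightarrow>\<^sub>E {..<length Is}. inj_on v A}"
  let ?w = "\<lambda>v. scale (complex_of_real (\<Prod>b\<leftarrow>cl. measure rplus (Is ! v b))) (step_word (map (\<lambda>b. Is ! v b) (map fst L)) (map snd L))"
  let ?l = "if distinct (cl @ map fst L) then scale (complex_of_real (t ^ length cl))
      (step_word (replicate (length (map fst L)) {0..<t}) (map snd L)) else 0"
  have A': "A = set cl \<union> set (map fst L)" using A by (simp add: labels_def \<tau>)
  have "term_value (\<lambda>b. Is ! v b) \<tau> = scale (complex_of_real c) (?w v)" for v
    by (simp add: term_value_def \<tau> step_word_eq zip_map_map zip_same_conv_map case_prod_unfold o_def)
  moreover have "(if distinct (labels \<tau>) then limit_value t \<tau> else 0) = scale (complex_of_real c) ?l"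
    by (simp add: limit_value_def \<tau> labels_def)
  ultimately have eq: "(\<Sum>v\<in>?V. term_value (\<lambda>b. Is ! v b) \<tau>) - (if distinct (labels \<tau>) then limit_value t \<tau> else 0)
    = scale (complex_of_real c) ((\<Sum>v\<in>?V. ?w v) - ?l)"
    by (simp only: formal.scale_sum_right formal.scale_right_diff_distrib)
  have J: "bounded_borel (Is ! v b)" if "v \<in> ?V" "b \<in> A" for v b
    using that by (auto intro!: subdivision_bounded_borel[OF sub] dest: PiE_mem)
  have "step_word (map (\<lambda>b. Is ! v b) (map fst L)) (map snd L) \<in> tens_carrier \<nu>" if "v \<in> ?V" for v
    using J[OF that] by (intro step_word_carrier) (auto simp: A')
  moreover have "?l \<in> tens_carrier \<nu>"
    by (auto intro!: tens_carrier_scale step_word_carrier)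
  ultimately have car: "(\<Sum>v\<in>?V. ?w v) - ?l \<in> tens_carrier \<nu>"
    by (intro tens_carrier_diff tens_carrier_sum tens_carrier_scale)
  have "(tens_norm q \<nu> ((\<Sum>v\<in>?V. ?w v) - ?l))\<^sup>2
    \<le> step_bound (map snd L) * (mesh Is * estimate (max 1 t) (length cl) (length (map fst L)) (card A))"
    by (rule partition_term_estimate[OF sub t A']) simp
  then have "tens_norm q \<nu> ((\<Sum>v\<in>?V. ?w v) - ?l)
    \<le> sqrt (step_bound (map snd L) * (mesh Is * estimate (max 1 t) (length cl) (length (map fst L)) (card A)))"
    by (rule real_le_rsqrt)
  then have "\<bar>c\<bar> * tens_norm q \<nu> ((\<Sum>v\<in>?V. ?w v) - ?l)
    \<le> \<bar>c\<bar> * sqrt (step_bound (map snd L) * (mesh Is * estimate (max 1 t) (length cl) (length (map fst L)) (card A)))"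
    by (intro mult_left_mono) auto
  then show ?thesis
    unfolding eq tens_norm_scale[OF car] by (simp add: term_bound_def \<tau> A' real_sqrt_mult mult_ac)
qed

section \<open>Products of the process on the vacuum and the algebra they come from\<close>

lemma op_prod_X_vacuum:
  "op_prod (map (\<lambda>i. X_op q \<nu> (J i)) xs) vacuum = (\<lambda>_. foldr (\<lambda>i. tens_Y q \<nu> 1 (J i)) xs (word_vec []))"
proof (induction xs)
  case Nil
  show ?case by (simp add: op_prod_def vacuum_def word_vec_def)
next
  case (Cons x xs)
  have "op_prod (map (\<lambda>i. X_op q \<nu> (J i)) (x # xs)) vacuum
    = X_op q \<nu> (J x) (op_prod (map (\<lambda>i. X_op q \<nu> (J i)) xs) vacuum)"
    by (simp add: op_prod_def)
  then show ?case
    unfolding Cons.IH by (simp add: X_op_def Y_op_def)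
qed

text \<open>All three parts of \<open>tens_Y\<close> are additive in the indicator. This connects
  the cells of a subdivision with the generators of the algebra, whose intervals start at 0.\<close>

lemma tens_Y_disjoint_union:
  assumes f: "f \<in> tens_carrier \<nu>" and I: "bounded_borel I" and J: "bounded_borel J" and disj: "I \<inter> J = {}"
  shows "tens_eq (tens_Y q \<nu> k (I \<union> J) f) (tens_Y q \<nu> k I f + tens_Y q \<nu> k J f)"
proof -
  have ind: "ind_mono (I \<union> J) j z = ind_mono I j z + ind_mono J j z" for j z
    using disj by (cases z) (auto simp: ind_mono_def indicator_def)
  have "tens_fun (tens_annihilate q \<nu> (ind_mono (I \<union> J) (k - 1)) f) zs
    = tens_fun (tens_annihilate q \<nu> (ind_mono I (k - 1)) f) zs + tens_fun (tens_annihilate q \<nu> (ind_mono J (k - 1)) f) zs" for zs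
  proof -
    have "L2_inner (hmeas \<nu>) (ind_mono (I \<union> J) (k - 1)) g
      = L2_inner (hmeas \<nu>) (ind_mono I (k - 1)) g + L2_inner (hmeas \<nu>) (ind_mono J (k - 1)) g"
      if "g \<in> L2 (hmeas \<nu>)" for g
      using L2_mult_integrable[OF ind_mono_L2[OF I] that] L2_mult_integrable[OF ind_mono_L2[OF J] that]
      by (simp add: L2_inner_def ind algebra_simps)
    moreover have "w ! p \<in> L2 (hmeas \<nu>)" if "w \<in> Poly_Mapping.keys f" "p < length w" for w p
    proof -
      have "w ! p \<in> set w" using that by simp
      then show ?thesis using f that unfolding tens_carrier_def by blast
    qed
    ultimately show ?thesis
      unfolding tens_fun_def tens_annihilate_def lin_eval_lin_ext lin_eval_fun_add[symmetric]
      by (intro lin_eval_cong) (auto simp: lin_eval_sum sum.distrib[symmetric] algebra_simps intro!: sum.cong)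
  qed
  moreover have "tens_fun (tens_create (ind_mono (I \<union> J) (k - 1)) f) zs
    = tens_fun (tens_create (ind_mono I (k - 1)) f) zs + tens_fun (tens_create (ind_mono J (k - 1)) f) zs" for zs
    by (cases zs) (simp_all add: tens_fun_create ind algebra_simps)
  moreover have "tens_fun (tens_preserve q (mult_op (ind_mono (I \<union> J) k)) f) zs
    = tens_fun (tens_preserve q (mult_op (ind_mono I k)) f) zs + tens_fun (tens_preserve q (mult_op (ind_mono J k)) f) zs" for zs
    by (cases zs) (simp_all add: tens_fun_preserve ind algebra_simps sum.distrib)
  ultimately show ?thesis
    by (simp add: tens_eq_def tens_Y_def algebra_simps)
qed

text \<open>Only up to \<open>tens_eq\<close>: \<open>X([a, b))\<close> and \<open>X([0, b)) - X([0, a))\<close> produce different formal words.\<close>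

definition algebraic :: "tens \<Rightarrow> bool"
  where "algebraic f \<longleftrightarrow> (\<exists>A\<in>X_algebra q \<nu>. \<exists>a\<in>step_tens. A vacuum = (\<lambda>_. a) \<and> tens_eq a f)"

lemma algebraic_X:
  assumes f: "algebraic f" and f': "f \<in> step_tens" and J: "half_open J"
  shows "algebraic (tens_Y q \<nu> 1 J f)"
proof -
  obtain A a where A: "A \<in> X_algebra q \<nu>" "a \<in> step_tens" "A vacuum = (\<lambda>_. a)" "tens_eq a f"
    using f by (auto simp: algebraic_def)
  obtain l r where lr: "0 \<le> l" "l < r" "J = {l..<r}" using J by (auto simp: half_open_def)
  \<comment> \<open>The operator of \<open>{l..<r}\<close> as the difference of the generators at
    \<open>r\<close> and \<open>l\<close>.\<close>
  define X where "X = X_op q \<nu> {0..<r} + (\<lambda>u. fock_scale (- 1) (X_op q \<nu> {0..<l} u))"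
  have "X \<in> X_algebra q \<nu>"
    unfolding X_def using lr by (intro X_algebra.add X_algebra.scale X_algebra.gen) auto
  then have "X \<circ> A \<in> X_algebra q \<nu>" using A(1) by (rule X_algebra.mult)
  moreover have "(X \<circ> A) vacuum = (\<lambda>_. tens_Y q \<nu> 1 {0..<r} a + scale (- 1) (tens_Y q \<nu> 1 {0..<l} a))"
    by (auto simp: A(3) X_def X_op_def Y_op_def fock_scale_def)
  moreover have "tens_Y q \<nu> 1 {0..<r} a + scale (- 1) (tens_Y q \<nu> 1 {0..<l} a) \<in> step_tens"
    by (intro step_tens_add step_tens_scale tens_Y_step_tens A(2)) auto
  moreover have "tens_eq (tens_Y q \<nu> 1 {0..<r} a + scale (- 1) (tens_Y q \<nu> 1 {0..<l} a)) (tens_Y q \<nu> 1 J f)"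
  proof -
    have "{0..<r} = {0..<l} \<union> J" using lr by auto
    then have "tens_eq (tens_Y q \<nu> 1 {0..<r} a) (tens_Y q \<nu> 1 {0..<l} a + tens_Y q \<nu> 1 J a)"
      using tens_Y_disjoint_union[OF step_tens_carrier[OF A(2)] bounded_borel_interval bounded_borel_half_open[OF J], of l 1] lr
      by auto
    then have "tens_eq (tens_Y q \<nu> 1 {0..<r} a + scale (- 1) (tens_Y q \<nu> 1 {0..<l} a)) (tens_Y q \<nu> 1 J a)"
      by (simp add: tens_eq_def)
    also have "tens_eq \<dots> (tens_Y q \<nu> 1 J f)"
      using A f' J by (intro tens_Y_cong step_tens_carrier bounded_borel_half_open)
    finally show ?thesis .
  qed
  ultimately show ?thesis unfolding algebraic_def by blast
qed

lemma algebraic_foldr: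
  assumes "\<And>i. i \<in> set xs \<Longrightarrow> half_open (J i)"
  shows "algebraic (foldr (\<lambda>i. tens_Y q \<nu> 1 (J i)) xs (word_vec []))
    \<and> foldr (\<lambda>i. tens_Y q \<nu> 1 (J i)) xs (word_vec []) \<in> step_tens"
  using assms
proof (induction xs)
  case Nil
  have "algebraic (word_vec [])"
    unfolding algebraic_def using X_algebra.one word_vec_Nil
    by (intro bexI[of _ id] bexI[of _ "word_vec []"]) (auto simp: vacuum_def word_vec_def)
  then show ?case by (simp add: word_vec_Nil)
next
  case (Cons x xs)
  then have "algebraic (foldr (\<lambda>i. tens_Y q \<nu> 1 (J i)) xs (word_vec []))"
    "foldr (\<lambda>i. tens_Y q \<nu> 1 (J i)) xs (word_vec []) \<in> step_tens" "half_open (J x)" by auto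
  then show ?case
    unfolding foldr.simps o_apply by (intro conjI algebraic_X tens_Y_step_tens bounded_borel_half_open)
qed

lemma algebraic_sum:
  assumes "finite V" "\<And>v. v \<in> V \<Longrightarrow> algebraic (f v)"
  shows "algebraic (sum f V)"
  using assms
proof (induction V rule: finite_induct)
  case empty
  \<comment> \<open>The zero operator, obtained as 0 times the identity.\<close>
  have "(\<lambda>u. fock_scale 0 (id u)) \<in> X_algebra q \<nu>" by (intro X_algebra.scale X_algebra.one)
  then show ?case
    unfolding algebraic_def using step_tens_zero by (intro bexI bexI[of _ 0]) (auto simp: fock_scale_def)
next
  case (insert v V)
  have "algebraic (f v)" "algebraic (sum f V)" using insert by auto
  then obtain A a A' a' where A: "A \<in> X_algebra q \<nu>" "a \<in> step_tens" "A vacuum = (\<lambda>_. a)" "tens_eq a (f v)"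
    and A': "A' \<in> X_algebra q \<nu>" "a' \<in> step_tens" "A' vacuum = (\<lambda>_. a')" "tens_eq a' (sum f V)"
    unfolding algebraic_def by blast
  have "(A + A') vacuum = (\<lambda>_. a + a')" using A(3) A'(3) by auto
  then show ?case
    unfolding algebraic_def using insert A A'
    by (intro bexI[of _ "A + A'"] bexI[of _ "a + a'"]) (auto intro: X_algebra.add step_tens_add tens_eq_add)
qed

end

section \<open>Convergence of the partition sums\<close>

context partition_levy
begin

definition limit_vector :: "real \<Rightarrow> tens"
  where "limit_vector t = (\<Sum>S\<in>Pow \<pi>. scale (complex_of_real (q ^ rc n S \<pi> * R_coeff \<nu> (\<pi> - S) t))
    (step_word (replicate (length (class_sizes S)) {0..<t}) (map (\<lambda>k. k - 1) (class_sizes S))))"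

text \<open>With no operator left to act, a doomed term is exactly one with a repeated label, and
  the remaining terms are the good ones, indexed by all subsets of \<pi>.\<close>

lemma limit_vector_expansion:
  "limit_vector t = (\<Sum>\<sigma>\<leftarrow>expansion 0. if distinct (labels \<sigma>) then limit_value t \<sigma> else 0)"
proof -
  have "limit_value t (good_term 0 S) = scale (complex_of_real (q ^ rc n S \<pi> * R_coeff \<nu> (\<pi> - S) t))
    (step_word (replicate (length (class_sizes S)) {0..<t}) (map (\<lambda>k. k - 1) (class_sizes S)))" if S: "S \<in> Pow \<pi>" for S
  proof -
    have S': "S \<subseteq> \<pi>" using S by simp
    note cl = good_closed_zero[OF S'] and L = good_letters_zero[OF S']
    have "(\<Prod>b\<leftarrow>good_closed 0 S. r_moment \<nu> (card b)) = (\<Prod>b\<in>\<pi> - S. r_moment \<nu> (card b))"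
      using prod.distinct_set_conv_list[OF cl(1), of "\<lambda>b. r_moment \<nu> (card b)"] cl(2) by simp
    moreover have "length (good_closed 0 S) = card (\<pi> - S)"
      using distinct_card[OF cl(1)] cl(2) by simp
    ultimately show ?thesis
      by (simp add: limit_value_def good_term_def L R_coeff_def rc_def mult_ac)
  qed
  then have "limit_vector t = (\<Sum>S\<in>Pow (completed 0). limit_value t (good_term 0 S))"
    unfolding limit_vector_def completed_zero by (intro sum.cong refl) simp
  also have "\<dots> = (\<Sum>\<sigma>\<leftarrow>filter (\<lambda>\<sigma>. \<not> doomed 0 \<sigma>) (expansion 0). limit_value t \<sigma>)"
    using good_expansion_sum[of 0] by (simp add: limit_value_def)
  also have "\<dots> = (\<Sum>\<sigma>\<leftarrow>expansion 0. if distinct (labels \<sigma>) then limit_value t \<sigma> else 0)"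
    by (simp add: sum_list_map_filter' doomed_def)
  finally show ?thesis .
qed

lemma limit_vector_carrier: "limit_vector t \<in> tens_carrier \<nu>"
  unfolding limit_vector_def
  by (intro tens_carrier_sum tens_carrier_scale step_word_carrier) auto

text \<open>An index vector that takes equal values exactly within the classes of \<pi> is an
  injective choice of a cell for each class; the inverse evaluates it at the minimum of a
  class.\<close>

lemma St_sum_vacuum:
  "St_sum q \<nu> n \<pi> Is vacuum
    = (\<lambda>_. \<Sum>v\<in>{v \<in> \<pi> \<rightarrow>\<^sub>E {..<length Is}. inj_on v \<pi>}. partial_product (\<lambda>b. Is ! v b) 0)"
proof -
  let ?U = "{u \<in> {1..n} \<rightarrow>\<^sub>E {..<length Is}. \<forall>i\<in>{1..n}. \<forall>j\<in>{1..n}. u i = u j \<longleftrightarrow> (\<exists>B\<in>\<pi>. i \<in> B \<and> j \<in> B)}"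
  let ?V = "{v \<in> \<pi> \<rightarrow>\<^sub>E {..<length Is}. inj_on v \<pi>}"
  let ?r = "\<lambda>v. \<lambda>i\<in>{1..n}. v (class_of i)"
  have same: "(\<exists>B\<in>\<pi>. i \<in> B \<and> j \<in> B) \<longleftrightarrow> class_of i = class_of j" if "i \<in> {1..n}" "j \<in> {1..n}" for i j
  proof
    assume "\<exists>B\<in>\<pi>. i \<in> B \<and> j \<in> B"
    then obtain B where "B \<in> \<pi>" "i \<in> B" "j \<in> B" by blast
    then show "class_of i = class_of j" by (simp add: class_of_eq)
  next
    assume "class_of i = class_of j"
    moreover have "class_of i \<in> \<pi>" "i \<in> class_of i" "j \<in> class_of j"
      using that class_of by auto
    ultimately show "\<exists>B\<in>\<pi>. i \<in> B \<and> j \<in> B" by metis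
  qed
  have bij: "bij_betw ?r ?V ?U"
  proof (rule bij_betw_byWitness[where f' = "\<lambda>u. \<lambda>B\<in>\<pi>. u (Min B)"])
    show "\<forall>v\<in>?V. (\<lambda>B\<in>\<pi>. ?r v (Min B)) = v"
    proof
      fix v assume v: "v \<in> ?V"
      show "(\<lambda>B\<in>\<pi>. ?r v (Min B)) = v"
      proof
        fix B show "(\<lambda>B\<in>\<pi>. ?r v (Min B)) B = v B"
          using v class_Min[of B] by (cases "B \<in> \<pi>") (auto simp: PiE_def extensional_def)
      qed
    qed
    show "\<forall>u\<in>?U. ?r (\<lambda>B\<in>\<pi>. u (Min B)) = u"
    proof
      fix u assume u: "u \<in> ?U"
      show "?r (\<lambda>B\<in>\<pi>. u (Min B)) = u"
      proof
        fix i
        show "?r (\<lambda>B\<in>\<pi>. u (Min B)) i = u i"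
        proof (cases "i \<in> {1..n}")
          case True
          have "Min (class_of i) \<in> {1..n}" "class_of (Min (class_of i)) = class_of i"
            using class_Min[OF class_of(1)] True by auto
          then have "u (Min (class_of i)) = u i" using u same[of "Min (class_of i)" i] True by blast
          then show ?thesis using True class_of(1)[of i] by simp
        next
          case False
          then show ?thesis using u by (auto simp: PiE_def extensional_def)
        qed
      qed
    qed
    show "?r ` ?V \<subseteq> ?U"
    proof (rule image_subsetI)
      fix v assume v: "v \<in> ?V"
      have "v (class_of i) = v (class_of j) \<longleftrightarrow> class_of i = class_of j" if "i \<in> {1..n}" "j \<in> {1..n}" for i j
        using v that class_of(1) by (auto simp: inj_on_eq_iff)
      then show "?r v \<in> ?U" using v same class_of(1) by (auto dest: PiE_mem)
    qed
    show "(\<lambda>u. \<lambda>B\<in>\<pi>. u (Min B)) ` ?U \<subseteq> ?V"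
    proof (rule image_subsetI)
      fix u assume u: "u \<in> ?U"
      have M: "Min B \<in> {1..n}" if "B \<in> \<pi>" for B using class_Min[OF that] by auto
      have "inj_on (\<lambda>B\<in>\<pi>. u (Min B)) \<pi>"
      proof (rule inj_onI)
        fix B C assume B: "B \<in> \<pi>" and C: "C \<in> \<pi>" and eq: "(\<lambda>B\<in>\<pi>. u (Min B)) B = (\<lambda>B\<in>\<pi>. u (Min B)) C"
        then have "u (Min B) = u (Min C)" by simp
        then have "class_of (Min B) = class_of (Min C)" using u M[OF B] M[OF C] same by blast
        then show "B = C" using class_Min(3) B C by simp
      qed
      moreover have "u (Min B) < length Is" if "B \<in> \<pi>" for B using u M[OF that] by (auto dest: PiE_mem)
      ultimately show "(\<lambda>B\<in>\<pi>. u (Min B)) \<in> ?V" by auto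
    qed
  qed
  have apply_sum: "(\<Sum>u\<in>U. f u) x = (\<Sum>u\<in>U. f u x)" for U and f :: "(nat \<Rightarrow> nat) \<Rightarrow> fop" and x
    by (induction U rule: infinite_finite_induct) auto
  have "St_sum q \<nu> n \<pi> Is vacuum = (\<Sum>u\<in>?U. op_prod (map (\<lambda>i. X_op q \<nu> (Is ! u i)) [1..<Suc n]) vacuum)"
    unfolding St_sum_def by (rule apply_sum)
  also have "\<dots> = (\<Sum>v\<in>?V. op_prod (map (\<lambda>i. X_op q \<nu> (Is ! ?r v i)) [1..<Suc n]) vacuum)"
    by (rule sum.reindex_bij_betw[OF bij, symmetric])
  also have "\<dots> = (\<Sum>v\<in>?V. (\<lambda>_. partial_product (\<lambda>b. Is ! v b) 0))"
  proof (rule sum.cong[OF refl])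
    fix v
    have "map (\<lambda>i. X_op q \<nu> (Is ! ?r v i)) [1..<Suc n] = map (\<lambda>i. X_op q \<nu> (Is ! v (class_of i))) [1..<Suc n]"
      by (rule map_cong[OF refl]) auto
    then show "op_prod (map (\<lambda>i. X_op q \<nu> (Is ! ?r v i)) [1..<Suc n]) vacuum = (\<lambda>_. partial_product (\<lambda>b. Is ! v b) 0)"
      by (simp only: op_prod_X_vacuum partial_product_def One_nat_def)
  qed
  also have "\<dots> = (\<lambda>_. \<Sum>v\<in>?V. partial_product (\<lambda>b. Is ! v b) 0)"
    by (rule ext) (simp add: sum_fvec_apply)
  finally show ?thesis .
qed

text \<open>Interchanging the sums over assignments and over terms lets each term be compared with
  its own limit. The constant is uniform because \<open>expansion 0\<close> does not involve the
  subdivision.\<close>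

lemma St_sum_estimate:
  assumes sub: "subdivision t Is" and t: "0 < t"
  obtains f where "f \<in> tens_carrier \<nu>" "St_sum q \<nu> n \<pi> Is vacuum = (\<lambda>_. f)" "algebraic f"
    "tens_norm q \<nu> (f - limit_vector t) \<le> sqrt (mesh Is) * (\<Sum>\<tau>\<leftarrow>expansion 0. term_bound t \<tau>)"
proof
  let ?V = "{v \<in> \<pi> \<rightarrow>\<^sub>E {..<length Is}. inj_on v \<pi>}"
  let ?P = "\<lambda>v. partial_product (\<lambda>b. Is ! v b) 0" and ?T = "\<lambda>v. term_value (\<lambda>b. Is ! v b)"
  let ?l = "\<lambda>\<sigma>. if distinct (labels \<sigma>) then limit_value t \<sigma> else 0"
  have finV: "finite ?V" using finite_partition finite_PiE[of \<pi> "\<lambda>_. {..<length Is}"] by simp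
  have lt: "v b < length Is" if "v \<in> ?V" "b \<in> \<pi>" for v b using that by (auto dest: PiE_mem)
  have ho: "half_open (Is ! v b)" if "v \<in> ?V" "b \<in> \<pi>" for v b
    using lt[OF that] by (rule subdivision_half_open[OF sub])
  have disj: "Is ! v b \<inter> Is ! v c = {}" if "v \<in> ?V" "b \<in> \<pi>" "c \<in> \<pi>" "b \<noteq> c" for v b c
  proof -
    have "v b \<noteq> v c" using that by (auto simp: inj_on_eq_iff)
    then show ?thesis using sub lt[OF that(1)] that by (auto simp: subdivision_def)
  qed
  have P: "?P v \<in> step_tens" "tens_eq (?P v) (\<Sum>\<tau>\<leftarrow>expansion 0. ?T v \<tau>)" "\<forall>\<tau>\<in>set (expansion 0). ?T v \<tau> \<in> step_tens"
    if "v \<in> ?V" for v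
    using partial_product_expansion[of 0 "\<lambda>b. Is ! v b"] ho[OF that] disj[OF that] bounded_borel_half_open by auto
  show "St_sum q \<nu> n \<pi> Is vacuum = (\<lambda>_. \<Sum>v\<in>?V. ?P v)" by (rule St_sum_vacuum)
  show f: "(\<Sum>v\<in>?V. ?P v) \<in> tens_carrier \<nu>"
    using P(1) by (intro step_tens_carrier step_tens_sum)
  show "algebraic (\<Sum>v\<in>?V. ?P v)"
  proof (rule algebraic_sum[OF finV])
    fix v assume v: "v \<in> ?V"
    have "half_open (Is ! v (class_of i))" if "i \<in> set [Suc 0..<Suc n]" for i
      using that by (intro ho[OF v] class_of(1)) auto
    from algebraic_foldr[of "[Suc 0..<Suc n]" "\<lambda>i. Is ! v (class_of i)", OF this] show "algebraic (?P v)"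
      unfolding partial_product_def by blast
  qed
  have lv: "limit_value t \<tau> \<in> tens_carrier \<nu>" for \<tau>
    unfolding limit_value_def case_prod_unfold by (intro tens_carrier_scale step_word_carrier) auto
  have car: "(\<Sum>v\<in>?V. ?T v \<tau>) - ?l \<tau> \<in> tens_carrier \<nu>" if "\<tau> \<in> set (expansion 0)" for \<tau>
  proof -
    have "?l \<tau> \<in> tens_carrier \<nu>" using lv by simp
    moreover have "(\<Sum>v\<in>?V. ?T v \<tau>) \<in> tens_carrier \<nu>"
      using P(3) that by (intro tens_carrier_sum step_tens_carrier) blast
    ultimately show ?thesis by (intro tens_carrier_diff)
  qed
  have swap: "(\<Sum>v\<in>?V. \<Sum>\<tau>\<leftarrow>xs. ?T v \<tau>) = (\<Sum>\<tau>\<leftarrow>xs. \<Sum>v\<in>?V. ?T v \<tau>)" for xs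
    by (induction xs) (auto simp: sum.distrib)
  have "tens_eq (\<Sum>v\<in>?V. ?P v) (\<Sum>\<tau>\<leftarrow>expansion 0. \<Sum>v\<in>?V. ?T v \<tau>)"
    unfolding swap[symmetric] using P(2) by (intro tens_eq_sum)
  then have "tens_eq ((\<Sum>v\<in>?V. ?P v) - limit_vector t) (\<Sum>\<tau>\<leftarrow>expansion 0. (\<Sum>v\<in>?V. ?T v \<tau>) - ?l \<tau>)"
    unfolding sum_list_subtractf limit_vector_expansion by (intro tens_eq_diff tens_eq_refl)
  then have "tens_norm q \<nu> ((\<Sum>v\<in>?V. ?P v) - limit_vector t)
    = tens_norm q \<nu> (\<Sum>\<tau>\<leftarrow>expansion 0. (\<Sum>v\<in>?V. ?T v \<tau>) - ?l \<tau>)"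
    by (intro tens_norm_cong tens_carrier_diff f limit_vector_carrier tens_carrier_sum_list car)
  also have "\<dots> \<le> (\<Sum>\<tau>\<leftarrow>expansion 0. tens_norm q \<nu> ((\<Sum>v\<in>?V. ?T v \<tau>) - ?l \<tau>))"
    by (intro tens_norm_sum_list car)
  also have "\<dots> \<le> (\<Sum>\<tau>\<leftarrow>expansion 0. sqrt (mesh Is) * term_bound t \<tau>)"
  proof (rule sum_list_mono)
    fix \<tau> assume \<tau>: "\<tau> \<in> set (expansion 0)"
    have "class_of ` {Suc 0..n} = \<pi>"
      using class_of(1) class_Min by (force intro!: image_eqI)
    then have "\<pi> = set (labels \<tau>)" using expansion_labels[of 0] \<tau> by auto
    then show "tens_norm q \<nu> ((\<Sum>v\<in>?V. ?T v \<tau>) - ?l \<tau>) \<le> sqrt (mesh Is) * term_bound t \<tau>"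
      by (rule term_value_estimate[OF sub t])
  qed
  also have "\<dots> = sqrt (mesh Is) * (\<Sum>\<tau>\<leftarrow>expansion 0. term_bound t \<tau>)"
    by (simp add: sum_list_const_mult)
  finally show "tens_norm q \<nu> ((\<Sum>v\<in>?V. ?P v) - limit_vector t)
      \<le> sqrt (mesh Is) * (\<Sum>\<tau>\<leftarrow>expansion 0. term_bound t \<tau>)" .
qed

lemma eventually_St_sum_close:
  assumes t: "0 < t" and e: "0 < e"
  shows "eventually (\<lambda>Is. \<exists>f\<in>tens_carrier \<nu>. St_sum q \<nu> n \<pi> Is vacuum = (\<lambda>_. f) \<and> algebraic f
    \<and> tens_norm q \<nu> (f - limit_vector t) < e) (fine_subdivisions t)"
proof -
  define C where "C = (\<Sum>\<tau>\<leftarrow>expansion 0. term_bound t \<tau>)"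
  have "0 \<le> C"
    unfolding C_def by (intro sum_list_nonneg)
      (auto simp: term_bound_def step_bound_nonneg estimate_def intro!: mult_nonneg_nonneg)
  show ?thesis
  proof (rule eventually_fine_subdivisions)
    \<comment> \<open>Squared norms are of the order of the mesh, hence the square; the added 1
      covers \<open>C = 0\<close>.\<close>
    show "0 < (e / (C + 1))\<^sup>2" using e \<open>0 \<le> C\<close> by simp
    fix Is assume sub: "subdivision t Is" and m: "mesh Is < (e / (C + 1))\<^sup>2"
    obtain f where f: "f \<in> tens_carrier \<nu>" "St_sum q \<nu> n \<pi> Is vacuum = (\<lambda>_. f)" "algebraic f"
      "tens_norm q \<nu> (f - limit_vector t) \<le> sqrt (mesh Is) * C"
      using St_sum_estimate[OF sub t] unfolding C_def by blast
    have "sqrt (mesh Is) < sqrt ((e / (C + 1))\<^sup>2)" using m by (rule real_sqrt_less_mono)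
    then have "sqrt (mesh Is) \<le> e / (C + 1)" using e \<open>0 \<le> C\<close> by simp
    then have "sqrt (mesh Is) * C \<le> e / (C + 1) * C" using \<open>0 \<le> C\<close> by (rule mult_right_mono)
    also have "\<dots> < e" using e \<open>0 \<le> C\<close> by (simp add: field_simps)
    finally show "\<exists>f\<in>tens_carrier \<nu>. St_sum q \<nu> n \<pi> Is vacuum = (\<lambda>_. f) \<and> algebraic f
      \<and> tens_norm q \<nu> (f - limit_vector t) < e"
      using f by (intro bexI[of _ f]) auto
  qed
qed

lemma has_stochastic_measure_limit:
  assumes t: "0 < t"
  shows "has_stochastic_measure q \<nu> n \<pi> t (\<lambda>_. limit_vector t)"
  unfolding has_stochastic_measure_def
proof (rule tendsto_zeroI)
  fix e :: real assume "0 < e"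
  from eventually_St_sum_close[OF t this]
  show "eventually (\<lambda>Is. \<bar>fock_dist q \<nu> (St_sum q \<nu> n \<pi> Is vacuum) (\<lambda>_. limit_vector t)\<bar> < e) (fine_subdivisions t)"
  proof eventually_elim
    case (elim Is)
    then obtain f where f: "f \<in> tens_carrier \<nu>" "St_sum q \<nu> n \<pi> Is vacuum = (\<lambda>_. f)"
      "tens_norm q \<nu> (f - limit_vector t) < e" by blast
    then show ?case
      using tens_inner_self(1)[OF tens_carrier_diff[OF f(1) limit_vector_carrier]]
      by (simp add: fock_dist_const limit_vector_carrier)
  qed
qed

text \<open>Each partition sum applied to the vacuum agrees, up to \<open>tens_eq\<close>, with an
  element of the algebra applied to the vacuum, and these vectors approximate the limit.\<close>

lemma limit_vector_L2_X:
  assumes t: "0 < t"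
  shows "(\<lambda>_. limit_vector t) \<in> L2_X q \<nu>"
proof -
  have "\<exists>A\<in>X_algebra q \<nu>. fock_dist q \<nu> (A vacuum) (\<lambda>_. limit_vector t) < e" if e: "0 < e" for e
  proof -
    obtain f where f: "f \<in> tens_carrier \<nu>" "algebraic f" "tens_norm q \<nu> (f - limit_vector t) < e"
      using fine_subdivisions_nonempty[OF eventually_St_sum_close[OF t e] t] by blast
    obtain A a where A: "A \<in> X_algebra q \<nu>" "a \<in> step_tens" "A vacuum = (\<lambda>_. a)" "tens_eq a f"
      using f(2) by (auto simp: algebraic_def)
    note a = step_tens_carrier[OF A(2)]
    have "tens_norm q \<nu> (a - limit_vector t) = tens_norm q \<nu> (f - limit_vector t)"
      by (intro tens_norm_cong tens_carrier_diff a f(1) limit_vector_carrier tens_eq_diff A(4) tens_eq_refl)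
    then show ?thesis
      using f(3) A by (intro bexI[of _ A]) (simp_all add: fock_dist_const[OF a limit_vector_carrier])
  qed
  then show ?thesis
    by (simp add: L2_X_def fock_const limit_vector_carrier)
qed

lemma stochastic_measure_unique:
  assumes t: "0 < t" and w: "w \<in> L2_X q \<nu>" "has_stochastic_measure q \<nu> n \<pi> t w"
  shows "fock_eq q \<nu> w (\<lambda>_. limit_vector t)"
proof (rule fock_limit_unique[of "fine_subdivisions t"])
  show "fine_subdivisions t \<noteq> bot"
    using fine_subdivisions_nonempty[of "\<lambda>_. False" t] t by auto
  show "eventually (\<lambda>Is. St_sum q \<nu> n \<pi> Is vacuum \<in> fock q \<nu>) (fine_subdivisions t)"
    using eventually_St_sum_close[OF t zero_less_one] by eventually_elim (auto intro: fock_const)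
qed (use w has_stochastic_measure_limit[OF t] in
    \<open>auto simp: L2_X_def has_stochastic_measure_def intro: fock_const limit_vector_carrier\<close>)

lemma limit_vector_full_measures:
  assumes t: "0 < t"
  shows "fock_eq q \<nu> (\<lambda>_. limit_vector t)
    (\<Sum>S \<in> Pow \<pi>. fock_scale (complex_of_real (q ^ rc n S \<pi> * R_coeff \<nu> (\<pi> - S) t))
      (full_measure q \<nu> (class_sizes S) t))"
proof -
  let ?w = "\<lambda>S. step_word (replicate (length (class_sizes S)) {0..<t}) (map (\<lambda>k. k - 1) (class_sizes S))"
  have eq: "(\<lambda>_. limit_vector t) = (\<Sum>S \<in> Pow \<pi>. fock_scale (complex_of_real (q ^ rc n S \<pi> * R_coeff \<nu> (\<pi> - S) t)) (\<lambda>_. ?w S))"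
    by (rule ext) (simp only: sum_fvec_apply fock_scale_def limit_vector_def)
  have "fock_eq q \<nu> (\<lambda>_. ?w S) (full_measure q \<nu> (class_sizes S) t)" for S
    using full_measure_eq[OF t, of "class_sizes S"] fock_dist_commute by (auto simp: fock_eq_def)
  then show ?thesis
    unfolding eq by (rule fock_eq_sum_scale)
qed

end

theorem proposition10:
  fixes q t :: real and \<nu> :: "real measure" and n :: nat and \<pi> :: "nat set set"
  assumes "-1 < q" and "q < 1"
    and "prob_space \<nu>" and "sets \<nu> = sets borel"
    and "\<exists>K. compact K \<and> measure \<nu> K = 1"
    and "n \<ge> 1" and "partition_on {1..n} \<pi>" and "t > 0"
  shows "\<exists>v \<in> L2_X q \<nu>. has_stochastic_measure q \<nu> n \<pi> t v \<and>
    (\<forall>w \<in> L2_X q \<nu>. has_stochastic_measure q \<nu> n \<pi> t w \<longrightarrow> fock_eq q \<nu> w v) \<and>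
    fock_eq q \<nu> v
      (\<Sum>S \<in> Pow \<pi>. fock_scale (complex_of_real (q ^ rc n S \<pi> * R_coeff \<nu> (\<pi> - S) t))
        (full_measure q \<nu> (class_sizes S) t))"
proof -
  interpret partition_levy \<nu> q n \<pi>
    using assms by (simp add: partition_levy_def partition_levy_axioms_def q_levy_def q_levy_axioms_def)
  show ?thesis
    using limit_vector_L2_X has_stochastic_measure_limit stochastic_measure_unique
      limit_vector_full_measures \<open>t > 0\<close> by blast
qed

end
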